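(* Let $p\geq 1$ and let $\imath_p:T^p\hookrightarrow\mathbb{R}^{p+2}$ be the standard unknotted embedding. The subgroup $E_{\imath_p}\leq \mathrm{Aut}(T^p)$ contains the stabilizer of some nontrivial element of $H^1(T^p;\mathbb{Z}_2)$ under the natural action of $\mathrm{Aut}(T^p)$. Hence the index of $E_{\imath_p}$ in $\mathrm{Aut}(T^p)$ is at most $2^p-1$.
   Context: $T^p=\mathbb{R}^p/\mathbb{Z}^p=S^1_1\times\cdots\times S^1_p$, with $S^1$ the unit circle in $\mathbb{C}$. $\mathrm{Aut}(T^p)\cong \mathrm{SL}(p,\mathbb{Z})$ is the group of diffeomorphisms of $T^p$ induced by the linear action of $\mathrm{SL}(p,\mathbb{Z})$ on $\mathbb{R}^p$. Standard embedding: let $(\vec\varepsilon_1,\dots,\vec\varepsilon_n)$ be the standard basis of $\mathbb{R}^n$, let $\mathbb{R}^m_{i_1,\dots,i_m}$ be the subspace spanned by $\vec\varepsilon_{i_1},\dots,\vec\varepsilon_{i_m}$, and regard $\mathbb{R}^n\subset\mathbb{R}^{n+1}$ as the span of the first $n$ basis vectors. Let $\imath_0:\mathrm{pt}=T^0\hookrightarrow\mathbb{R}^2$ have image the origin. Inductively for $p\geq 1$, with $\imath_{p-1}(T^{p-1})\subset\mathrm{Int}(D^p)\subset\mathbb{R}^p_{2,\dots,p+1}$ ($D^p$ the unit disk), let $\rho_p(u)\in\mathrm{SO}(p+2)$, $u\in S^1$, be the rotation of $\mathbb{R}^{p+2}$ in the plane $\mathbb{R}^2_{2,p+2}$ by angle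 $\arg(u)$, and define $\imath_p:T^p=T^{p-1}\times S^1_p\hookrightarrow\mathbb{R}^{p+1}_{2,\dots,p+2}\subset\mathbb{R}^{p+2}$ by $$\imath_p(v,u)=\rho_p(u)\left(\tfrac12\vec\varepsilon_2+\tfrac14\imath_{p-1}(v)\right).$$ For a smooth embedding $\imath:T^p\hookrightarrow\mathbb{R}^{p+2}$, $E_\imath\leq\mathrm{Aut}(T^p)$ is the subgroup of those $\tau$ that are extendable over $\imath$: there is a compactly-supported self-diffeomorphism $f$ of $\mathbb{R}^{p+2}$ (i.e. $f$ is the identity outside a compact set) with $f\circ\imath=\imath\circ\tau$. *)

theory Defs
  imports
    "HOL-Analysis.Analysis"
    "HOL-Algebra.Group_Action"
    "HOL-Homology.Homology"
    "Jordan_Normal_Form.Determinant"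
begin

section \<open>Smooth maps and compactly supported diffeomorphisms\<close>

text \<open>On a finite-dimensional domain the following is the usual notion of a \<open>C\<^sup>k\<close> map:
  continuity for \<open>k = 0\<close>; for \<open>k + 1\<close>, differentiability everywhere, all directional derivatives
  being \<open>C\<^sup>k\<close>.\<close>

primrec C_k_map :: "nat \<Rightarrow> ('a::real_normed_vector \<Rightarrow> 'b::real_normed_vector) \<Rightarrow> bool" where
  "C_k_map 0 f \<longleftrightarrow> continuous_on UNIV f"
| "C_k_map (Suc k) f \<longleftrightarrow>
     (\<forall>x. f differentiable (at x)) \<and> (\<forall>v. C_k_map k (\<lambda>x. frechet_derivative f (at x) v))"

definition smooth_map :: "('a::real_normed_vector \<Rightarrow> 'b::real_normed_vector) \<Rightarrow> bool" where
  "smooth_map f \<longleftrightarrow> (\<forall>k. C_k_map k f)"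

definition self_diffeomorphism :: "('a::real_normed_vector \<Rightarrow> 'a) \<Rightarrow> bool" where
  "self_diffeomorphism f \<longleftrightarrow> bij f \<and> smooth_map f \<and> smooth_map (inv_into UNIV f)"

definition compactly_supported :: "('a::real_normed_vector \<Rightarrow> 'a) \<Rightarrow> bool" where
  "compactly_supported f \<longleftrightarrow> (\<exists>K. compact K \<and> (\<forall>x. x \<notin> K \<longrightarrow> f x = x))"

section \<open>The torus and its linear automorphisms\<close>

text \<open>The \<open>p\<close> circle factors are indexed from \<open>0\<close>, to agree with the indexing of vectors and
  matrices: the factor \<open>S\<^sup>1\<^sub>k\<close> is coordinate \<open>k - 1\<close>.\<close>

definition torus :: "nat \<Rightarrow> (nat \<Rightarrow> complex) topology" where
  "torus p = product_topology (\<lambda>_. top_of_set (sphere 0 1)) {..<p}"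

text \<open>The quotient map \<open>\<real>\<^sup>p \<rightarrow> \<real>\<^sup>p / \<int>\<^sup>p\<close>, the quotient being identified with the product of circles.\<close>

definition torus_proj :: "nat \<Rightarrow> real Matrix.vec \<Rightarrow> (nat \<Rightarrow> complex)" where
  "torus_proj p x = (\<lambda>i\<in>{..<p}. cis (2 * pi * vec_index x i))"

definition SL_int :: "nat \<Rightarrow> int mat set" where
  "SL_int p = {A \<in> carrier_mat p p. Determinant.det A = 1}"

definition induced_by :: "nat \<Rightarrow> int mat \<Rightarrow> ((nat \<Rightarrow> complex) \<Rightarrow> (nat \<Rightarrow> complex)) \<Rightarrow> bool" where
  "induced_by p A \<tau> \<longleftrightarrow>
     (\<forall>x \<in> carrier_vec p. \<tau> (torus_proj p x) = torus_proj p (map_mat real_of_int A *\<^sub>v x))"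

definition torus_Aut :: "nat \<Rightarrow> ((nat \<Rightarrow> complex) \<Rightarrow> (nat \<Rightarrow> complex)) monoid" where
  "torus_Aut p = BijGroup (topspace (torus p))
     \<lparr>carrier := {\<tau> \<in> Bij (topspace (torus p)). \<exists>A \<in> SL_int p. induced_by p A \<tau>}\<rparr>"

section \<open>The standard embedding and extendable automorphisms\<close>

text \<open>For orthonormal \<open>a\<close>, \<open>b\<close>: the rotation by \<open>\<theta>\<close> in the plane spanned by \<open>a\<close> and \<open>b\<close>, turning
  \<open>a\<close> towards \<open>b\<close> and fixing the orthogonal complement of the plane.\<close>

definition plane_rotation :: "'a::real_inner \<Rightarrow> 'a \<Rightarrow> real \<Rightarrow> 'a \<Rightarrow> 'a" where
  "plane_rotation a b \<theta> x =
     x - (x \<bullet> a) *\<^sub>R a - (x \<bullet> b) *\<^sub>R b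
       + (cos \<theta> * (x \<bullet> a) - sin \<theta> * (x \<bullet> b)) *\<^sub>R a
       + (sin \<theta> * (x \<bullet> a) + cos \<theta> * (x \<bullet> b)) *\<^sub>R b"

text \<open>Here \<open>\<epsilon> 1, \<epsilon> 2, \<dots>\<close> is the standard basis. All the standard embeddings of \<open>T\<^sup>0, \<dots>, T\<^sup>p\<close> are
  taken to have the same target \<open>\<real>\<^sup>p\<^sup>+\<^sup>2\<close>, of which the lower-dimensional spaces are coordinate
  subspaces. The last factor of \<open>T\<^sup>q\<^sup>+\<^sup>1\<close> is coordinate \<open>q\<close>, and \<open>restrict v {..<q}\<close> is the component
  of \<open>v\<close> in \<open>T\<^sup>q\<close>.\<close>

primrec std_embedding :: "(nat \<Rightarrow> 'a::euclidean_space) \<Rightarrow> nat \<Rightarrow> (nat \<Rightarrow> complex) \<Rightarrow> 'a" where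
  "std_embedding \<epsilon> 0 v = 0"
| "std_embedding \<epsilon> (Suc q) v =
     plane_rotation (\<epsilon> 2) (\<epsilon> (Suc q + 2)) (Arg (v q))
       ((1/2) *\<^sub>R \<epsilon> 2 + (1/4) *\<^sub>R std_embedding \<epsilon> q (restrict v {..<q}))"

definition extendable_Aut ::
  "nat \<Rightarrow> ((nat \<Rightarrow> complex) \<Rightarrow> 'a::euclidean_space) \<Rightarrow> ((nat \<Rightarrow> complex) \<Rightarrow> (nat \<Rightarrow> complex)) set" where
  "extendable_Aut p \<iota> = {\<tau> \<in> carrier (torus_Aut p).
     \<exists>f. self_diffeomorphism f \<and> compactly_supported f \<and>
         (\<forall>v \<in> topspace (torus p). f (\<iota> v) = \<iota> (\<tau> v))}"

section \<open>Singular cohomology\<close>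

definition cochain_group ::
  "nat \<Rightarrow> 'a topology \<Rightarrow> ('g, 'm) monoid_scheme \<Rightarrow> (((nat \<Rightarrow> real) \<Rightarrow> 'a) \<Rightarrow> 'g) monoid" where
  "cochain_group n X G = product_group (singular_simplex_set n X) (\<lambda>_. G)"

definition coboundary ::
  "nat \<Rightarrow> 'a topology \<Rightarrow> ('g, 'm) monoid_scheme
     \<Rightarrow> (((nat \<Rightarrow> real) \<Rightarrow> 'a) \<Rightarrow> 'g) \<Rightarrow> (((nat \<Rightarrow> real) \<Rightarrow> 'a) \<Rightarrow> 'g)" where
  "coboundary n X G \<phi> = (\<lambda>\<sigma> \<in> singular_simplex_set (Suc n) X.
     finprod G (\<lambda>k. \<phi> (singular_face (Suc n) k \<sigma>) [^]\<^bsub>G\<^esub> ((-1) ^ k :: int)) {..Suc n})"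

definition cocycle_set ::
  "nat \<Rightarrow> 'a topology \<Rightarrow> ('g, 'm) monoid_scheme \<Rightarrow> (((nat \<Rightarrow> real) \<Rightarrow> 'a) \<Rightarrow> 'g) set" where
  "cocycle_set n X G = kernel (cochain_group n X G) (cochain_group (Suc n) X G) (coboundary n X G)"

fun coboundary_set ::
  "nat \<Rightarrow> 'a topology \<Rightarrow> ('g, 'm) monoid_scheme \<Rightarrow> (((nat \<Rightarrow> real) \<Rightarrow> 'a) \<Rightarrow> 'g) set" where
  "coboundary_set 0 X G = {\<one>\<^bsub>cochain_group 0 X G\<^esub>}"
| "coboundary_set (Suc n) X G = coboundary n X G ` carrier (cochain_group n X G)"

definition cohomology_group ::
  "nat \<Rightarrow> 'a topology \<Rightarrow> ('g, 'm) monoid_scheme \<Rightarrow> (((nat \<Rightarrow> real) \<Rightarrow> 'a) \<Rightarrow> 'g) set monoid" where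
  "cohomology_group n X G =
     subgroup_generated (cochain_group n X G) (cocycle_set n X G) Mod coboundary_set n X G"

definition cochain_pullback ::
  "nat \<Rightarrow> 'a topology \<Rightarrow> ('a \<Rightarrow> 'b)
     \<Rightarrow> (((nat \<Rightarrow> real) \<Rightarrow> 'b) \<Rightarrow> 'g) \<Rightarrow> (((nat \<Rightarrow> real) \<Rightarrow> 'a) \<Rightarrow> 'g)" where
  "cochain_pullback n X f \<phi> = (\<lambda>\<sigma> \<in> singular_simplex_set n X. \<phi> (simplex_map n f \<sigma>))"

text \<open>For continuous \<open>f\<close> from \<open>X\<close> to \<open>Y\<close>, pulling back any two representatives of a class gives the
  same coset, so the union below is the coset of the pullback of any one of them.\<close>

definition cohomology_pullback ::
  "nat \<Rightarrow> 'a topology \<Rightarrow> 'b topology \<Rightarrow> ('g, 'm) monoid_scheme \<Rightarrow> ('a \<Rightarrow> 'b)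
     \<Rightarrow> (((nat \<Rightarrow> real) \<Rightarrow> 'b) \<Rightarrow> 'g) set \<Rightarrow> (((nat \<Rightarrow> real) \<Rightarrow> 'a) \<Rightarrow> 'g) set" where
  "cohomology_pullback n X Y G f = (\<lambda>c \<in> carrier (cohomology_group n Y G).
     \<Union>\<phi>\<in>c. coboundary_set n X G #>\<^bsub>cochain_group n X G\<^esub> cochain_pullback n X f \<phi>)"

abbreviation torus_H1_Z2 :: "nat \<Rightarrow> (((nat \<Rightarrow> real) \<Rightarrow> (nat \<Rightarrow> complex)) \<Rightarrow> int) set monoid" where
  "torus_H1_Z2 p \<equiv> cohomology_group 1 (torus p) (integer_mod_group 2)"

text \<open>Pullback is contravariant, hence the inverse makes this a left action. Stabilizers are the
  same as for pullback itself.\<close>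

definition torus_H1_action ::
  "nat \<Rightarrow> ((nat \<Rightarrow> complex) \<Rightarrow> (nat \<Rightarrow> complex))
     \<Rightarrow> (((nat \<Rightarrow> real) \<Rightarrow> (nat \<Rightarrow> complex)) \<Rightarrow> int) set
     \<Rightarrow> (((nat \<Rightarrow> real) \<Rightarrow> (nat \<Rightarrow> complex)) \<Rightarrow> int) set" where
  "torus_H1_action p \<tau> =
     cohomology_pullback 1 (torus p) (torus p) (integer_mod_group 2) (inv\<^bsub>torus_Aut p\<^esub> \<tau>)"

end

theory Submission
  imports Defs "HOL-Combinatorics.Transposition"
begin

no_notation Matrix.scalar_prod (infix "\<bullet>" 70)

text \<open>
  The class \<open>c\<close> is the sum of the \<open>p\<close> coordinate classes modulo 2; evaluating it on straight loops shows
  that its stabilizer consists of matrices all of whose column sums are odd. Integer row reduction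
  writes every invertible matrix of this kind as a product of sign changes, transpositions,
  operations \<open>\<theta>\<^sub>i \<mapsto> \<theta>\<^sub>i \<plusminus> 2\<theta>\<^sub>k\<close>, and operations adding \<open>\<plusminus>\<theta>\<^sub>k\<close> to two coordinates at once. All of these come from
  two families of involutions of the angles, \<open>\<theta>\<^sub>1 \<mapsto> 2\<phi> - \<theta>\<^sub>1\<close> and \<open>(\<theta>\<^sub>q\<^sub>-\<^sub>1, \<theta>\<^sub>q) \<mapsto> (\<phi> - \<theta>\<^sub>q, \<phi> - \<theta>\<^sub>q\<^sub>-\<^sub>1)\<close>. Up to a change
  of coordinates they are restrictions of half turns in a plane of \<open>\<real>\<^sup>3\<close>, respectively \<open>\<real>\<^sup>4\<close>, and a half turn
  can be rotated back to the identity away from the torus. The resulting diffeomorphisms depend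
  smoothly on \<open>e\<^sup>i\<^sup>\<phi>\<close>, so rotating the picture about an axis turns the parameter \<open>\<phi>\<close> into the angle of
  the next circle factor. A coset of the extendable automorphisms is determined by the parities of
  the column sums of a matrix, and these are not all even.
\<close>

section \<open>Smooth maps on open sets\<close>

text \<open>The two circles to be exchanged do not look alike in the standard embedding: the radius
  swept by the last angle varies with the preceding angle. The map \<open>flatten\<close> makes them
  coordinate circles of a common radius in two complex planes, and only there is the exchange
  orthogonal. Turning a parameter into an angle puts conditions on a family of diffeomorphisms: it
  has to depend smoothly on the parameter, have a smooth inverse, be the identity near the axis, and
  have its support within a bound that spinning reproduces. Most numerical constants serve this last
  point. Even coefficients enter because two reflections of a circle, in lines at angle \<phi>,
  compose to a rotation by 2\<phi>. Adding an angle to a single other coordinate would change the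
  parity of column sums; no available move does so, and the reduction must succeed without it. What
  makes it succeed is the invariant itself: the configurations in which it would get stuck have an
  even column sum.\<close>

primrec Ck_on :: "nat \<Rightarrow> 'a::real_normed_vector set \<Rightarrow> ('a \<Rightarrow> 'b::real_normed_vector) \<Rightarrow> bool" where
  "Ck_on 0 S f \<longleftrightarrow> continuous_on S f"
| "Ck_on (Suc k) S f \<longleftrightarrow> (\<forall>x\<in>S. f differentiable (at x)) \<and>
     (\<forall>v. Ck_on k S (\<lambda>x. frechet_derivative f (at x) v))"

definition smooth_on :: "'a::real_normed_vector set \<Rightarrow> ('a \<Rightarrow> 'b::real_normed_vector) \<Rightarrow> bool" where
  "smooth_on S f \<longleftrightarrow> (\<forall>k. Ck_on k S f)"

lemma C_k_map_iff_Ck_on: "C_k_map k f \<longleftrightarrow> Ck_on k UNIV f"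
  by (induction k arbitrary: f) auto

lemma smooth_map_iff_smooth_on: "smooth_map f \<longleftrightarrow> smooth_on UNIV f"
  by (simp add: smooth_map_def smooth_on_def C_k_map_iff_Ck_on)

lemma has_derivative_cong_open:
  assumes "open S" "x \<in> S" "\<And>y. y \<in> S \<Longrightarrow> f y = g y"
  shows "(f has_derivative D) (at x) \<longleftrightarrow> (g has_derivative D) (at x)"
proof
  assume "(f has_derivative D) (at x)"
  then show "(g has_derivative D) (at x)"
    by (rule has_derivative_transform_within_open[OF _ assms(1,2)]) (simp add: assms(3))
next
  assume "(g has_derivative D) (at x)"
  then show "(f has_derivative D) (at x)"
    by (rule has_derivative_transform_within_open[OF _ assms(1,2)]) (simp add: assms(3))
qed

lemma Ck_on_cong:
  assumes "open S" "\<And>y. y \<in> S \<Longrightarrow> f y = g y"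
  shows "Ck_on k S f \<longleftrightarrow> Ck_on k S g"
  using assms(2)
proof (induction k arbitrary: f g)
  case 0
  then show ?case by (simp cong: continuous_on_cong)
next
  case (Suc k)
  have "Ck_on k S (\<lambda>x. frechet_derivative f (at x) v) \<longleftrightarrow> Ck_on k S (\<lambda>x. frechet_derivative g (at x) v)" for v
    by (rule Suc.IH) (simp add: frechet_derivative_def has_derivative_cong_open[OF assms(1) _ Suc.prems])
  moreover have "(\<forall>x\<in>S. f differentiable (at x)) \<longleftrightarrow> (\<forall>x\<in>S. g differentiable (at x))"
    by (simp add: differentiable_def has_derivative_cong_open[OF assms(1) _ Suc.prems])
  ultimately show ?case by simp
qed

text \<open>\<open>Ck_on\<close> differentiates at points rather than within \<open>S\<close>, so
  only continuity has to be glued, and this is where openness of both sets enters.\<close>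

lemma Ck_on_Un:
  assumes "open S" "open T" "Ck_on k S f" "Ck_on k T f"
  shows "Ck_on k (S \<union> T) f"
  using assms(3,4)
  by (induction k arbitrary: f) (auto intro: continuous_on_open_Un assms)

lemma Ck_on_SucI:
  assumes "open S" "\<And>x. x \<in> S \<Longrightarrow> (f has_derivative D x) (at x)"
    and "\<And>v. Ck_on k S (\<lambda>x. D x v)"
  shows "Ck_on (Suc k) S f"
proof -
  have "frechet_derivative f (at x) = D x" if "x \<in> S" for x
    using frechet_derivative_at[OF assms(2)[OF that]] by simp
  then have "Ck_on k S (\<lambda>x. frechet_derivative f (at x) v)" for v
    using Ck_on_cong[OF assms(1), of "\<lambda>x. frechet_derivative f (at x) v" "\<lambda>x. D x v"] assms(3) by simp
  then show ?thesis using assms(2) by (auto simp: differentiable_def)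
qed

lemma Ck_on_SucD:
  assumes "Ck_on (Suc k) S f"
  shows "\<And>x. x \<in> S \<Longrightarrow> (f has_derivative frechet_derivative f (at x)) (at x)"
    and "\<And>v. Ck_on k S (\<lambda>x. frechet_derivative f (at x) v)"
  using assms by (auto simp: frechet_derivative_works)

lemma Ck_on_Suc_imp: "Ck_on (Suc k) S f \<Longrightarrow> Ck_on k S f"
proof (induction k arbitrary: f)
  case 0
  have "f differentiable (at x within S)" if "x \<in> S" for x
    by (rule differentiable_at_withinI) (use 0 that in simp)
  then have "f differentiable_on S"
    by (simp add: differentiable_on_def)
  then show ?case by (simp add: differentiable_imp_continuous_on)
next
  case (Suc k)
  have "Ck_on k S (\<lambda>x. frechet_derivative f (at x) v)" for v
    by (rule Suc.IH) (use Suc.prems Ck_on.simps(2)[of "Suc k" S f] in blast)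
  then show ?case
    using Suc.prems Ck_on.simps(2)[of "Suc k" S f] Ck_on.simps(2)[of k S f] by blast
qed

lemma Ck_on_const: "Ck_on k S (\<lambda>x. c)"
proof (induction k arbitrary: c)
  case (Suc k)
  have "frechet_derivative (\<lambda>_::'a. c) (at x) = (\<lambda>_. 0)" for x
    by (rule frechet_derivative_at[symmetric]) simp
  then show ?case using Suc by simp
qed simp

lemma Ck_on_bounded_linear:
  assumes "bounded_linear f" shows "Ck_on k S f"
proof (cases k)
  case 0
  then show ?thesis using assms linear_continuous_on by simp blast
next
  case (Suc k')
  have "frechet_derivative f (at x) = f" for x
    by (rule frechet_derivative_at[symmetric]) (rule bounded_linear_imp_has_derivative[OF assms])
  then show ?thesis using bounded_linear_imp_differentiable[OF assms] by (simp add: Suc Ck_on_const[of k' S])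
qed

lemma Ck_on_add:
  assumes "open S" "Ck_on k S f" "Ck_on k S g"
  shows "Ck_on k S (\<lambda>x. f x + g x)"
  using assms(2,3)
proof (induction k arbitrary: f g)
  case 0
  then show ?case by (simp add: continuous_on_add)
next
  case (Suc k)
  show ?case
    by (rule Ck_on_SucI[OF assms(1) has_derivative_add[OF Ck_on_SucD(1)[OF Suc.prems(1)] Ck_on_SucD(1)[OF Suc.prems(2)]]
          Suc.IH[OF Ck_on_SucD(2)[OF Suc.prems(1)] Ck_on_SucD(2)[OF Suc.prems(2)]]])
qed

lemma Ck_on_sum:
  assumes "open S" "\<And>i. i \<in> I \<Longrightarrow> Ck_on k S (f i)"
  shows "Ck_on k S (\<lambda>x. \<Sum>i\<in>I. f i x)"
proof (cases "finite I")
  case True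
  then show ?thesis using assms(2)
    by (induction I) (auto intro!: Ck_on_const Ck_on_add assms(1))
qed (simp add: Ck_on_const)

lemma Ck_on_bounded_bilinear:
  assumes "bounded_bilinear prd" "open S" "Ck_on k S f" "Ck_on k S g"
  shows "Ck_on k S (\<lambda>x. prd (f x) (g x))"
  using assms(3,4)
proof (induction k arbitrary: f g)
  case 0
  then show ?case by (simp add: bounded_bilinear.continuous_on[OF assms(1)])
next
  case (Suc k)
  show ?case
  proof (rule Ck_on_SucI[OF assms(2)])
    show "((\<lambda>x. prd (f x) (g x)) has_derivative (\<lambda>h. prd (f x) (frechet_derivative g (at x) h) + 
        prd (frechet_derivative f (at x) h) (g x))) (at x)" if "x \<in> S" for x
      by (rule bounded_bilinear.FDERIV[OF assms(1) Ck_on_SucD(1)[OF Suc.prems(1) that] 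
          Ck_on_SucD(1)[OF Suc.prems(2) that]])
  next
    show "Ck_on k S (\<lambda>x. prd (f x) (frechet_derivative g (at x) v) + 
        prd (frechet_derivative f (at x) v) (g x))" for v
      by (rule Ck_on_add[OF assms(2) Suc.IH[OF Ck_on_Suc_imp[OF Suc.prems(1)] Ck_on_SucD(2)[OF Suc.prems(2)]]
          Suc.IH[OF Ck_on_SucD(2)[OF Suc.prems(1)] Ck_on_Suc_imp[OF Suc.prems(2)]]])
  qed
qed

text \<open>The derivative of the composite is \<open>?Dg (f x) (?Df x v)\<close>, whose direction
  varies with \<open>x\<close>, out of reach of the induction hypothesis. Expanding the direction in
  a basis gives a finite sum of products in which every derivative of \<open>g\<close> has a fixed
  direction; this is why the intermediate space is Euclidean.\<close>

lemma Ck_on_compose: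
  fixes f :: "'a::real_normed_vector \<Rightarrow> 'b::euclidean_space"
  assumes "open S" "open T" "Ck_on k S f" "Ck_on k T g" "f ` S \<subseteq> T"
  shows "Ck_on k S (\<lambda>x. g (f x))"
  using assms(3,4)
proof (induction k arbitrary: g)
  case 0
  then show ?case using assms(5) continuous_on_compose2[of T g S f] by auto
next
  case (Suc k)
  have inT: "f x \<in> T" if "x \<in> S" for x using assms(5) that by auto
  let ?Df = "\<lambda>x. frechet_derivative f (at x)" and ?Dg = "\<lambda>y. frechet_derivative g (at y)"
  have der: "((\<lambda>x. g (f x)) has_derivative (\<lambda>h. ?Dg (f x) (?Df x h))) (at x)" if "x \<in> S" for x
    using has_derivative_compose[OF Ck_on_SucD(1)[OF Suc.prems(1) that]
        Ck_on_SucD(1)[OF Suc.prems(2) inT[OF that]]] .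
  have exp: "?Dg (f x) w = (\<Sum>b\<in>Basis. (w \<bullet> b) *\<^sub>R ?Dg (f x) b)" if "x \<in> S" for x w
  proof -
    have lin: "linear (?Dg (f x))"
      using Ck_on_SucD(1)[OF Suc.prems(2) inT[OF that]] has_derivative_linear by blast
    have "?Dg (f x) w = ?Dg (f x) (\<Sum>b\<in>Basis. (w \<bullet> b) *\<^sub>R b)" by (simp add: euclidean_representation)
    also have "\<dots> = (\<Sum>b\<in>Basis. (w \<bullet> b) *\<^sub>R ?Dg (f x) b)"
      by (simp add: linear_sum[OF lin] linear_scale[OF lin])
    finally show ?thesis .
  qed
  have fk: "Ck_on k S f" using Suc.prems(1) Ck_on_Suc_imp by blast
  have "Ck_on k S (\<lambda>x. ?Dg (f x) (?Df x v))" for v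
  proof -
    have "Ck_on k S (\<lambda>x. \<Sum>b\<in>Basis. (?Df x v \<bullet> b) *\<^sub>R ?Dg (f x) b)"
    proof (intro Ck_on_sum assms(1) Ck_on_bounded_bilinear[OF bounded_bilinear_scaleR])
      show "Ck_on k S (\<lambda>x. ?Dg (f x) b)" for b
        by (rule Suc.IH[OF fk Ck_on_SucD(2)[OF Suc.prems(2)]])
      show "Ck_on k S (\<lambda>x. ?Df x v \<bullet> b)" for b
        by (rule Ck_on_bounded_bilinear[OF bounded_bilinear_inner assms(1) 
            Ck_on_SucD(2)[OF Suc.prems(1)] Ck_on_const])
    qed
    moreover have "Ck_on k S (\<lambda>x. ?Dg (f x) (?Df x v)) \<longleftrightarrow> 
        Ck_on k S (\<lambda>x. \<Sum>b\<in>Basis. (?Df x v \<bullet> b) *\<^sub>R ?Dg (f x) b)"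
      by (rule Ck_on_cong[OF assms(1) exp])
    ultimately show ?thesis by blast
  qed
  then show ?case by (intro Ck_on_SucI[OF assms(1) der]) auto
qed

lemma smooth_on_cong:
  "open S \<Longrightarrow> (\<And>y. y \<in> S \<Longrightarrow> f y = g y) \<Longrightarrow> smooth_on S f \<longleftrightarrow> smooth_on S g"
  unfolding smooth_on_def using Ck_on_cong by blast

lemma smooth_on_Un: "open S \<Longrightarrow> open T \<Longrightarrow> smooth_on S f \<Longrightarrow> smooth_on T f \<Longrightarrow> smooth_on (S \<union> T) f"
  unfolding smooth_on_def using Ck_on_Un by blast

lemma smooth_on_const: "smooth_on S (\<lambda>x. c)"
  by (simp add: smooth_on_def Ck_on_const)

lemma smooth_on_bounded_linear: "bounded_linear f \<Longrightarrow> smooth_on S f"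
  by (simp add: smooth_on_def Ck_on_bounded_linear)

lemma smooth_on_id: "smooth_on S (\<lambda>x. x)"
  by (simp add: smooth_on_bounded_linear)

lemma smooth_on_add: "open S \<Longrightarrow> smooth_on S f \<Longrightarrow> smooth_on S g \<Longrightarrow> smooth_on S (\<lambda>x. f x + g x)"
  by (simp add: smooth_on_def Ck_on_add)

lemma smooth_on_sum:
  "open S \<Longrightarrow> (\<And>i. i \<in> I \<Longrightarrow> smooth_on S (f i)) \<Longrightarrow> smooth_on S (\<lambda>x. \<Sum>i\<in>I. f i x)"
  by (simp add: smooth_on_def Ck_on_sum)

lemma smooth_on_bounded_bilinear:
  "bounded_bilinear prd \<Longrightarrow> open S \<Longrightarrow> smooth_on S f \<Longrightarrow> smooth_on S g \<Longrightarrow> smooth_on S (\<lambda>x. prd (f x) (g x))"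
  by (simp add: smooth_on_def Ck_on_bounded_bilinear)

lemma smooth_on_compose:
  fixes f :: "'a::real_normed_vector \<Rightarrow> 'b::euclidean_space"
  shows "smooth_on T g \<Longrightarrow> open S \<Longrightarrow> open T \<Longrightarrow> smooth_on S f \<Longrightarrow> (\<And>x. x \<in> S \<Longrightarrow> f x \<in> T)
    \<Longrightarrow> smooth_on S (\<lambda>x. g (f x))"
  unfolding smooth_on_def by (rule allI, rule Ck_on_compose[of S T]) auto

lemmas smooth_on_scaleR = smooth_on_bounded_bilinear[OF bounded_bilinear_scaleR]
lemmas smooth_on_mult = smooth_on_bounded_bilinear[OF bounded_bilinear_mult]
lemmas smooth_on_inner = smooth_on_bounded_bilinear[OF bounded_bilinear_inner]

lemma smooth_on_linear_compose:
  fixes f :: "'a::real_normed_vector \<Rightarrow> 'b::euclidean_space"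
  shows "bounded_linear L \<Longrightarrow> open S \<Longrightarrow> smooth_on S f \<Longrightarrow> smooth_on S (\<lambda>x. L (f x))"
  by (rule smooth_on_compose[OF smooth_on_bounded_linear[of _ UNIV]]) simp_all

lemma smooth_on_minus:
  fixes f :: "'a::real_normed_vector \<Rightarrow> 'b::real_normed_vector"
  shows "open S \<Longrightarrow> smooth_on S f \<Longrightarrow> smooth_on S (\<lambda>x. - f x)"
  using smooth_on_scaleR[OF _ smooth_on_const, of S f "-1"] by simp

lemma smooth_on_diff: 
  fixes f :: "'a::real_normed_vector \<Rightarrow> 'b::real_normed_vector"
  shows "open S \<Longrightarrow> smooth_on S f \<Longrightarrow> smooth_on S g \<Longrightarrow> smooth_on S (\<lambda>x. f x - g x)"
  using smooth_on_add[of S f "\<lambda>x. - g x"] smooth_on_minus[of S g] by simp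

lemma smooth_on_Pair:
  fixes f :: "'a::real_normed_vector \<Rightarrow> 'b::euclidean_space" and g :: "'a \<Rightarrow> 'c::euclidean_space"
  assumes "open S" "smooth_on S f" "smooth_on S g"
  shows "smooth_on S (\<lambda>x. (f x, g x))"
proof -
  have "bounded_linear (\<lambda>a::'b. (a, 0::'c))" "bounded_linear (\<lambda>a::'c. (0::'b, a))"
    using bounded_linear_Pair[OF bounded_linear_ident bounded_linear_zero]
      bounded_linear_Pair[OF bounded_linear_zero bounded_linear_ident] by blast+
  from smooth_on_add[OF assms(1) smooth_on_linear_compose[OF this(1) assms(1,2)]
      smooth_on_linear_compose[OF this(2) assms(1,3)]]
  show ?thesis by simp
qed

lemma smooth_on_fst:
  fixes f :: "'a::real_normed_vector \<Rightarrow> 'b::euclidean_space \<times> 'c::euclidean_space"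
  shows "open S \<Longrightarrow> smooth_on S f \<Longrightarrow> smooth_on S (\<lambda>x. fst (f x))"
  by (rule smooth_on_linear_compose[OF bounded_linear_fst])

lemma smooth_on_snd:
  fixes f :: "'a::real_normed_vector \<Rightarrow> 'b::euclidean_space \<times> 'c::euclidean_space"
  shows "open S \<Longrightarrow> smooth_on S f \<Longrightarrow> smooth_on S (\<lambda>x. snd (f x))"
  by (rule smooth_on_linear_compose[OF bounded_linear_snd])

section \<open>Elementary smooth functions and cutoffs\<close>

lemma Ck_on_SucI_real:
  fixes f :: "real \<Rightarrow> real"
  assumes "open S" "\<And>x. x \<in> S \<Longrightarrow> (f has_field_derivative D x) (at x)" "Ck_on k S D"
  shows "Ck_on (Suc k) S f"
proof (rule Ck_on_SucI[OF assms(1)])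
  show "(f has_derivative (*) (D x)) (at x)" if "x \<in> S" for x
    using assms(2)[OF that] by (simp add: has_field_derivative_def)
  show "Ck_on k S (\<lambda>x. D x * v)" for v
    by (intro Ck_on_bounded_bilinear[OF bounded_bilinear_mult] assms Ck_on_const)
qed

lemma smooth_on_sin_cos:
  "smooth_on UNIV (sin :: real \<Rightarrow> real)" "smooth_on UNIV (cos :: real \<Rightarrow> real)"
proof -
  have "Ck_on k UNIV (sin :: real \<Rightarrow> real) \<and> Ck_on k UNIV (cos :: real \<Rightarrow> real)" for k
  proof (induction k)
    case (Suc k)
    have "Ck_on k UNIV (\<lambda>x::real. - sin x)"
      using Ck_on_bounded_bilinear[OF bounded_bilinear_scaleR open_UNIV Ck_on_const[of k UNIV "-1"], of "sin :: real \<Rightarrow> real"] Suc by simp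
    then show ?case using Suc Ck_on_SucI_real[OF open_UNIV DERIV_sin] Ck_on_SucI_real[OF open_UNIV DERIV_cos] by blast
  qed (auto intro!: continuous_intros)
  then show "smooth_on UNIV (sin :: real \<Rightarrow> real)" "smooth_on UNIV (cos :: real \<Rightarrow> real)"
    by (auto simp: smooth_on_def)
qed

lemma smooth_on_inverse: "smooth_on (- {0}) (inverse :: real \<Rightarrow> real)"
proof -
  have "Ck_on k (- {0}) (inverse :: real \<Rightarrow> real)" for k
  proof (induction k)
    case (Suc k)
    have C: "Ck_on k (- {0}) (\<lambda>x::real. (-1) * (inverse x * inverse x))"
      by (rule Ck_on_bounded_bilinear[OF bounded_bilinear_mult _ Ck_on_const
            Ck_on_bounded_bilinear[OF bounded_bilinear_mult _ Suc Suc]]) auto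
    have D: "(inverse has_field_derivative (-1) * (inverse x * inverse x)) (at x)" if "x \<in> - {0}" for x :: real
      using DERIV_inverse'[OF DERIV_ident, of x UNIV] that by simp
    show ?case by (rule Ck_on_SucI_real[OF _ D C]) auto
  qed (auto intro!: continuous_intros)
  then show ?thesis by (simp add: smooth_on_def)
qed

lemma smooth_on_sqrt: "smooth_on {0<..} sqrt"
proof -
  have "Ck_on k {0<..} sqrt" for k
  proof (induction k)
    case (Suc k)
    have inv: "Ck_on k (- {0}) (inverse :: real \<Rightarrow> real)"
      using smooth_on_inverse by (simp add: smooth_on_def)
    have C: "Ck_on k {0<..} (\<lambda>x. inverse (sqrt x) * (1/2))"
      by (rule Ck_on_bounded_bilinear[OF bounded_bilinear_mult _ 
            Ck_on_compose[OF _ _ Suc inv] Ck_on_const]) auto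
    have D: "(sqrt has_field_derivative inverse (sqrt x) * (1/2)) (at x)" if "x \<in> {0<..}" for x :: real
      using DERIV_real_sqrt[of x] that by simp
    show ?case by (rule Ck_on_SucI_real[OF _ D C]) auto
  qed (auto intro!: continuous_intros)
  then show ?thesis by (simp add: smooth_on_def)
qed

text \<open>Products of a polynomial in \<open>1/x\<close> with \<open>exp (-1/x)\<close> are closed under differentiation.\<close>

definition flat_exp :: "real poly \<Rightarrow> real \<Rightarrow> real" where
  "flat_exp P x = (if x > 0 then poly P (1/x) * exp (- 1/x) else 0)"

text \<open>With \<open>y = 1/x\<close> this is the growth of the exponential against a polynomial
  at infinity.\<close>

lemma flat_exp_tendsto: "((\<lambda>x. poly P (1/x) * exp (- 1/x)) \<longlongrightarrow> 0) (at_right (0::real))"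
proof -
  have "((\<lambda>y. poly P y / exp y) \<longlongrightarrow> 0) at_top"
  proof (induction P)
    case (pCons a P)
    have "((\<lambda>y::real. y ^ 1 / exp y) \<longlongrightarrow> 0) at_top" by (rule tendsto_power_div_exp_0)
    moreover have "((\<lambda>y::real. poly P y * y / exp y) \<longlongrightarrow> 0) at_top"
    proof -
      have "((\<lambda>y::real. \<Sum>i\<le>Polynomial.degree P. Polynomial.coeff P i * (y ^ (Suc i) / exp y)) \<longlongrightarrow> (\<Sum>i\<le>Polynomial.degree P. Polynomial.coeff P i * 0)) at_top"
        by (intro tendsto_sum tendsto_mult tendsto_const tendsto_power_div_exp_0)
      moreover have "(\<Sum>i\<le>Polynomial.degree P. Polynomial.coeff P i * (y ^ (Suc i) / exp y)) = poly P y * y / exp y" for y :: real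
        by (simp add: poly_altdef sum_distrib_right sum_distrib_left sum_divide_distrib mult_ac)
      ultimately show ?thesis by simp
    qed
    moreover have "((\<lambda>y::real. a * (y ^ 0 / exp y)) \<longlongrightarrow> a * 0) at_top"
      by (intro tendsto_mult tendsto_const tendsto_power_div_exp_0)
    ultimately have "((\<lambda>y::real. a * (y ^ 0 / exp y) + poly P y * y / exp y) \<longlongrightarrow> 0 + 0) at_top"
      by (intro tendsto_add) auto
    then show ?case by (simp add: add_divide_distrib mult.commute)
  qed simp
  then have "((\<lambda>x. poly P (inverse x) / exp (inverse x)) \<longlongrightarrow> 0) (at_right (0::real))"
    using filterlim_compose[OF _ filterlim_inverse_at_top_right] by blast
  then show ?thesis by (simp add: exp_minus divide_inverse)
qed

text \<open>By the chain rule, the inner derivative of \<open>1/x\<close> being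
  \<open>- (1/x)^2\<close>; the factor \<open>[:0, 0, 1:]\<close> is the square of the
  indeterminate.\<close>

definition flat_exp_deriv :: "real poly \<Rightarrow> real poly" where
  "flat_exp_deriv P = [:0, 0, 1:] * (P - pderiv P)"

lemma flat_exp_has_derivative:
  "(flat_exp P has_field_derivative flat_exp (flat_exp_deriv P) x) (at x)"
proof -
  consider "x < 0" | "x > 0" | "x = 0" by linarith
  then show ?thesis
  proof cases
    case 1
    have "((\<lambda>_. 0) has_field_derivative flat_exp (flat_exp_deriv P) x) (at x)"
      using 1 by (simp add: flat_exp_def)
    then show ?thesis
      by (rule has_field_derivative_transform_within_open[where S = "{..<0}"]) (use 1 in \<open>auto simp: flat_exp_def\<close>)
  next
    case 2
    have d: "((\<lambda>x. 1/x) has_field_derivative - ((1/x)\<^sup>2)) (at x)"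
      using 2 by (auto intro!: derivative_eq_intros simp: power2_eq_square)
    have "((\<lambda>x. poly P (1/x) * exp (- (1/x))) has_field_derivative
        poly (pderiv P) (1/x) * - ((1/x)\<^sup>2) * exp (- (1/x)) + exp (- (1/x)) * - (- ((1/x)\<^sup>2)) * poly P (1/x)) (at x)"
      by (rule DERIV_mult[OF DERIV_chain2[OF poly_DERIV d] DERIV_chain2[OF DERIV_exp DERIV_minus[OF d]]])
    moreover have "poly (flat_exp_deriv P) y = y\<^sup>2 * (poly P y - poly (pderiv P) y)" for y
      by (simp add: flat_exp_deriv_def power2_eq_square)
    moreover have "p' * - s * e + e * - (- s) * p = s * (p - p') * e" for p p' s e :: real
      by (simp add: algebra_simps)
    ultimately have "((\<lambda>x. poly P (1/x) * exp (- 1/x)) has_field_derivative flat_exp (flat_exp_deriv P) x) (at x)"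
      using 2 by (simp only: flat_exp_def if_True minus_divide_left)
    then show ?thesis
      by (rule has_field_derivative_transform_within_open[where S = "{0<..}"]) (use 2 in \<open>auto simp: flat_exp_def\<close>)
  next
    case 3
    have "((\<lambda>y. (flat_exp P y - flat_exp P 0) / (y - 0)) \<longlongrightarrow> 0) (at 0)"
    proof (rule filterlim_split_at)
      show "((\<lambda>y. (flat_exp P y - flat_exp P 0) / (y - 0)) \<longlongrightarrow> 0) (at_left 0)"
        by (rule tendsto_eventually) (auto simp: flat_exp_def eventually_at_filter)
      \<comment> \<open>Dividing by \<open>y\<close> multiplies a polynomial in \<open>1/y\<close>
        by its indeterminate, which gives \<open>pCons 0 P\<close>.\<close>
      have "((\<lambda>x. poly (pCons 0 P) (1/x) * exp (- 1/x)) \<longlongrightarrow> 0) (at_right (0::real))"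
        by (rule flat_exp_tendsto)
      moreover have "\<forall>\<^sub>F y in at_right 0. poly (pCons 0 P) (1/y) * exp (- 1/y) = (flat_exp P y - flat_exp P 0) / (y - 0)"
        by (auto simp: flat_exp_def eventually_at_filter)
      ultimately show "((\<lambda>y. (flat_exp P y - flat_exp P 0) / (y - 0)) \<longlongrightarrow> 0) (at_right 0)"
        by (rule Lim_transform_eventually)
    qed
    then show ?thesis using 3 by (simp add: has_field_derivative_iff flat_exp_def)
  qed
qed

lemma smooth_on_flat_exp: "smooth_on UNIV (flat_exp P)"
proof -
  have "Ck_on k UNIV (flat_exp P)" for k
  proof (induction k arbitrary: P)
    case 0
    show ?case using flat_exp_has_derivative DERIV_continuous_on by (metis Ck_on.simps(1) DERIV_subset subset_UNIV)
  next
    case (Suc k)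
    show ?case by (rule Ck_on_SucI_real[OF open_UNIV flat_exp_has_derivative Suc])
  qed
  then show ?thesis by (simp add: smooth_on_def)
qed

text \<open>For \<open>a < b\<close> the usual smooth step, falling from 1 on
  \<open>t \<le> a\<close> to 0 on \<open>b \<le> t\<close>; \<open>flat_exp 1\<close> is exp (-1/x)
  continued by zero.\<close>

definition cutoff :: "real \<Rightarrow> real \<Rightarrow> real \<Rightarrow> real" where
  "cutoff a b t = flat_exp 1 (b - t) * inverse (flat_exp 1 (b - t) + flat_exp 1 (t - a))"

lemma cutoff_eq_1: "a < b \<Longrightarrow> t \<le> a \<Longrightarrow> cutoff a b t = 1"
  by (simp add: cutoff_def flat_exp_def)

lemma cutoff_eq_0: "b \<le> t \<Longrightarrow> cutoff a b t = 0"
  by (simp add: cutoff_def flat_exp_def)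

lemma flat_exp_nonneg: "0 \<le> flat_exp 1 t"
  by (simp add: flat_exp_def)

lemma cutoff_denominator_pos: "a < b \<Longrightarrow> 0 < flat_exp 1 (b - t) + flat_exp 1 (t - a)"
  using flat_exp_nonneg[of "b - t"] flat_exp_nonneg[of "t - a"] by (cases "t < b") (auto simp: flat_exp_def intro: add_pos_pos)

lemma cutoff_bounds: "a < b \<Longrightarrow> 0 \<le> cutoff a b t \<and> cutoff a b t \<le> 1"
  using cutoff_denominator_pos[of a b t] flat_exp_nonneg[of "b - t"] flat_exp_nonneg[of "t - a"]
  by (simp add: cutoff_def divide_simps flip: divide_inverse)

lemma smooth_on_cutoff:
  assumes "a < b" shows "smooth_on UNIV (cutoff a b)"
proof -
  have lin: "smooth_on UNIV (\<lambda>t. flat_exp 1 (b - t))" "smooth_on UNIV (\<lambda>t. flat_exp 1 (t - a))"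
    by (auto intro!: smooth_on_compose[OF smooth_on_flat_exp[of 1] open_UNIV open_UNIV] 
        smooth_on_diff[OF open_UNIV] smooth_on_const smooth_on_id)
  show ?thesis unfolding cutoff_def
    by (rule smooth_on_mult[OF open_UNIV lin(1) smooth_on_compose[OF smooth_on_inverse open_UNIV _
            smooth_on_add[OF open_UNIV lin]]])
      (use cutoff_denominator_pos[OF assms] in \<open>auto simp: less_le\<close>)
qed

section \<open>The standard torus and the spinning construction\<close>

named_theorems smooth_intros

declare smooth_on_const[smooth_intros] smooth_on_id[smooth_intros] smooth_on_add[smooth_intros]
  smooth_on_minus[smooth_intros] smooth_on_diff[smooth_intros] smooth_on_scaleR[smooth_intros]
  smooth_on_mult[smooth_intros] smooth_on_inner[smooth_intros] smooth_on_fst[smooth_intros]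
  smooth_on_snd[smooth_intros] smooth_on_sum[smooth_intros]

lemma smooth_on_proj [smooth_intros]:
  "smooth_on S (fst :: 'a::real_normed_vector \<times> 'b::real_normed_vector \<Rightarrow> 'a)"
  "smooth_on S (snd :: 'a::real_normed_vector \<times> 'b::real_normed_vector \<Rightarrow> 'b)"
  by (intro smooth_on_bounded_linear bounded_linear_fst bounded_linear_snd)+

lemma smooth_on_power2 [smooth_intros]:
  fixes f :: "'a::real_normed_vector \<Rightarrow> 'b::real_normed_algebra_1"
  shows "open S \<Longrightarrow> smooth_on S f \<Longrightarrow> smooth_on S (\<lambda>x. (f x)\<^sup>2)"
  by (simp add: power2_eq_square smooth_on_mult)

lemma smooth_on_divide [smooth_intros]:
  fixes f :: "'a::real_normed_vector \<Rightarrow> real"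
  shows "open S \<Longrightarrow> smooth_on S f \<Longrightarrow> smooth_on S (\<lambda>x. f x / c)"
  unfolding divide_inverse by (intro smooth_intros)

lemma smooth_on_Re [smooth_intros]: "open S \<Longrightarrow> smooth_on S f \<Longrightarrow> smooth_on S (\<lambda>x. Re (f x))"
  and smooth_on_Im [smooth_intros]: "open S \<Longrightarrow> smooth_on S f \<Longrightarrow> smooth_on S (\<lambda>x. Im (f x))"
  and smooth_on_cnj [smooth_intros]: "open S \<Longrightarrow> smooth_on S f \<Longrightarrow> smooth_on S (\<lambda>x. cnj (f x))"
  by (rule smooth_on_linear_compose; simp add: bounded_linear_Re bounded_linear_Im bounded_linear_cnj)+

lemma smooth_on_of_real [smooth_intros]:
  fixes f :: "'a::real_normed_vector \<Rightarrow> real"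
  shows "open S \<Longrightarrow> smooth_on S f \<Longrightarrow> smooth_on S (\<lambda>x. complex_of_real (f x))"
  by (rule smooth_on_linear_compose[OF bounded_linear_of_real])

lemma smooth_on_Complex [smooth_intros]:
  assumes "open S" "smooth_on S f" "smooth_on S g"
  shows "smooth_on S (\<lambda>x. Complex (f x) (g x))"
  unfolding Complex_eq by (intro smooth_intros assms)

lemma smooth_on_cis [smooth_intros]:
  assumes "open S" "smooth_on S f"
  shows "smooth_on S (\<lambda>x. cis (f x))"
proof -
  have "cis t = Complex (cos t) (sin t)" for t by (simp add: complex_eq_iff)
  then show ?thesis
    using smooth_on_Complex[OF assms(1) smooth_on_compose[OF smooth_on_sin_cos(2) assms(1) open_UNIV assms(2)]
        smooth_on_compose[OF smooth_on_sin_cos(1) assms(1) open_UNIV assms(2)]] by simp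
qed

lemma smooth_on_cutoff_compose [smooth_intros]:
  "open S \<Longrightarrow> a < b \<Longrightarrow> smooth_on S f \<Longrightarrow> smooth_on S (\<lambda>x. cutoff a b (f x))"
  by (rule smooth_on_compose[OF smooth_on_cutoff]) simp_all

lemma smooth_on_sqrt_compose:
  assumes "open S" "smooth_on S f" "\<And>x. x \<in> S \<Longrightarrow> 0 < f x"
  shows "smooth_on S (\<lambda>x. sqrt (f x))"
  by (rule smooth_on_compose[OF smooth_on_sqrt assms(1) _ assms(2)]) (use assms(3) in auto)

lemma smooth_on_cmod:
  assumes "open S" "smooth_on S f" "\<And>x. x \<in> S \<Longrightarrow> f x \<noteq> 0"
  shows "smooth_on S (\<lambda>x. cmod (f x))"
  unfolding cmod_def
  by (rule smooth_on_sqrt_compose) (use assms in \<open>auto intro!: smooth_intros simp: complex_eq_iff sum_power2_gt_zero_iff\<close>)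

lemma smooth_on_sgn:
  fixes f :: "'a::real_normed_vector \<Rightarrow> complex"
  assumes "open S" "smooth_on S f" "\<And>x. x \<in> S \<Longrightarrow> f x \<noteq> 0"
  shows "smooth_on S (\<lambda>x. sgn (f x))"
proof -
  have "smooth_on S (\<lambda>x. inverse (cmod (f x)))"
    by (rule smooth_on_compose[OF smooth_on_inverse assms(1) _ smooth_on_cmod[OF assms]])
      (use assms(3) in auto)
  then show ?thesis unfolding sgn_div_norm by (intro smooth_on_scaleR assms)
qed

lemma smooth_on_uncurry:
  fixes H :: "'b::euclidean_space \<Rightarrow> 'c::euclidean_space \<Rightarrow> 'd::real_normed_vector"
    and u :: "'a::real_normed_vector \<Rightarrow> 'b"
  assumes "smooth_on UNIV (\<lambda>z. H (fst z) (snd z))" "open S" "smooth_on S u" "smooth_on S y"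
  shows "smooth_on S (\<lambda>x. H (u x) (y x))"
  using smooth_on_compose[OF assms(1,2) open_UNIV smooth_on_Pair[OF assms(2-4)]] by simp

section \<open>Coordinates and the standard torus in a fixed frame\<close>

locale frame =
  fixes \<epsilon> :: "nat \<Rightarrow> 'a::euclidean_space" and p :: nat
  assumes frame_bij: "bij_betw \<epsilon> {1..p+2} (Basis :: 'a set)"
begin

lemma frame_Basis: "i \<in> {1..p+2} \<Longrightarrow> \<epsilon> i \<in> Basis"
  using frame_bij unfolding bij_betw_def by blast

lemma frame_inner:
  assumes "i \<in> {1..p+2}" "j \<in> {1..p+2}"
  shows "\<epsilon> i \<bullet> \<epsilon> j = (if i = j then 1 else 0)"
proof -
  have "\<epsilon> i = \<epsilon> j \<longleftrightarrow> i = j"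
    using frame_bij assms unfolding bij_betw_def by (blast dest: inj_onD)
  then show ?thesis using inner_Basis[OF frame_Basis[OF assms(1)] frame_Basis[OF assms(2)]] by simp
qed

lemma frame_eqI:
  assumes "\<And>k. k \<in> {1..p+2} \<Longrightarrow> x \<bullet> \<epsilon> k = y \<bullet> \<epsilon> k" shows "x = y"
proof (rule euclidean_eqI)
  fix b :: 'a assume "b \<in> Basis"
  then obtain k where "k \<in> {1..p+2}" "b = \<epsilon> k"
    using frame_bij unfolding bij_betw_def by blast
  then show "x \<bullet> b = y \<bullet> b" using assms by simp
qed

lemma inner_frame: "x \<bullet> x = (\<Sum>k=1..p+2. (x \<bullet> \<epsilon> k)\<^sup>2)"
proof -
  have "x \<bullet> x = (\<Sum>b\<in>Basis. (x \<bullet> b)\<^sup>2)" by (subst euclidean_inner) (simp add: power2_eq_square)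
  also have "\<dots> = (\<Sum>k=1..p+2. (x \<bullet> \<epsilon> k)\<^sup>2)"
    by (rule sum.reindex_bij_betw[OF frame_bij, symmetric])
  finally show ?thesis .
qed

text \<open>On such pairs of coordinates plane rotations, reflections and the exchange of two
  circles all become complex arithmetic.\<close>

definition coord2 :: "nat \<Rightarrow> nat \<Rightarrow> 'a \<Rightarrow> complex" where
  "coord2 i j x = Complex (x \<bullet> \<epsilon> i) (x \<bullet> \<epsilon> j)"

definition upd2 :: "nat \<Rightarrow> nat \<Rightarrow> complex \<Rightarrow> 'a \<Rightarrow> 'a" where
  "upd2 i j z x = x + (Re z - x \<bullet> \<epsilon> i) *\<^sub>R \<epsilon> i + (Im z - x \<bullet> \<epsilon> j) *\<^sub>R \<epsilon> j"

lemma upd2_inner: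
  assumes "i \<in> {1..p+2}" "j \<in> {1..p+2}" "i \<noteq> j" "k \<in> {1..p+2}"
  shows "upd2 i j z x \<bullet> \<epsilon> k = (if k = i then Re z else if k = j then Im z else x \<bullet> \<epsilon> k)"
  using assms by (simp add: upd2_def inner_add_left frame_inner)

lemma Re_coord2 [simp]: "Re (coord2 i j x) = x \<bullet> \<epsilon> i" and Im_coord2 [simp]: "Im (coord2 i j x) = x \<bullet> \<epsilon> j"
  by (simp_all add: coord2_def)

lemma coord2_upd2:
  assumes "i \<in> {1..p+2}" "j \<in> {1..p+2}" "i \<noteq> j"
  shows "coord2 i j (upd2 i j z x) = z"
    and "k \<in> {1..p+2} \<Longrightarrow> l \<in> {1..p+2} \<Longrightarrow> {k, l} \<inter> {i, j} = {} \<Longrightarrow> coord2 k l (upd2 i j z x) = coord2 k l x"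
  using assms by (auto simp: complex_eq_iff upd2_inner)

lemma smooth_on_coord2 [smooth_intros]:
  "open S \<Longrightarrow> smooth_on S f \<Longrightarrow> smooth_on S (\<lambda>x. coord2 i j (f x))"
  unfolding coord2_def by (intro smooth_intros)

lemma smooth_on_upd2 [smooth_intros]:
  "open S \<Longrightarrow> smooth_on S z \<Longrightarrow> smooth_on S f \<Longrightarrow> smooth_on S (\<lambda>x. upd2 i j (z x) (f x))"
  unfolding upd2_def by (intro smooth_intros)

lemma plane_rotation_eq_upd2:
  "plane_rotation (\<epsilon> i) (\<epsilon> j) t x = upd2 i j (cis t * coord2 i j x) x"
  by (simp add: plane_rotation_def upd2_def algebra_simps)

text \<open>Angles replace points of the torus: integer matrices then act linearly, and
  \<open>Arg\<close> disappears because the embedding depends on it only through sine and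
  cosine.\<close>

definition torus_pt :: "nat \<Rightarrow> (nat \<Rightarrow> real) \<Rightarrow> 'a" where
  "torus_pt q \<theta> = std_embedding \<epsilon> q (\<lambda>i\<in>{..<q}. cis (\<theta> i))"

lemma torus_pt_0 [simp]: "torus_pt 0 \<theta> = 0"
  by (simp add: torus_pt_def)

text \<open>The two facts are proved together: the formula for the next torus needs its new
  coordinate to vanish on the old one. The coordinate along \<open>\<epsilon> 1\<close> is always 0;
  this is the free direction used by the half turns.\<close>

lemma torus_pt_inner_0:
  "q \<le> p \<Longrightarrow> k \<in> {1..p+2} \<Longrightarrow> k = 1 \<or> q + 2 < k \<Longrightarrow> torus_pt q \<theta> \<bullet> \<epsilon> k = 0"
  and torus_pt_Suc:
  "q < p \<Longrightarrow> torus_pt (Suc q) \<theta> = upd2 2 (q + 3) (cis (\<theta> q) * of_real (1/2 + torus_pt q \<theta> \<bullet> \<epsilon> 2 / 4))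
     ((1/4) *\<^sub>R torus_pt q \<theta>)"
proof -
  have R: "{..<Suc q} \<inter> {..<q} = {..<q}" for q
    by auto
  have cisArg: "cis (Arg (cis t)) = cis t" for t by (simp add: cis_Arg)
  have *: "torus_pt (Suc q) \<theta> = upd2 2 (q + 3) (cis (\<theta> q) * of_real (1/2 + torus_pt q \<theta> \<bullet> \<epsilon> 2 / 4))
     ((1/4) *\<^sub>R torus_pt q \<theta>)" if "q < p" and 0: "torus_pt q \<theta> \<bullet> \<epsilon> (q + 3) = 0" for q
  proof -
    have "torus_pt (Suc q) \<theta> = upd2 2 (q + 3) (cis (\<theta> q) * coord2 2 (q + 3) ((1/2) *\<^sub>R \<epsilon> 2 + (1/4) *\<^sub>R torus_pt q \<theta>))
       ((1/2) *\<^sub>R \<epsilon> 2 + (1/4) *\<^sub>R torus_pt q \<theta>)"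
      by (simp add: torus_pt_def R plane_rotation_eq_upd2 cisArg numeral_3_eq_3)
    also have "coord2 2 (q + 3) ((1/2) *\<^sub>R \<epsilon> 2 + (1/4) *\<^sub>R torus_pt q \<theta>) = of_real (1/2 + torus_pt q \<theta> \<bullet> \<epsilon> 2 / 4)"
      using that by (simp add: complex_eq_iff inner_add_left frame_inner)
    also have "upd2 2 (q + 3) z ((1/2) *\<^sub>R \<epsilon> 2 + (1/4) *\<^sub>R torus_pt q \<theta>) = upd2 2 (q + 3) z ((1/4) *\<^sub>R torus_pt q \<theta>)" for z
      using that by (intro frame_eqI) (auto simp: upd2_inner inner_add_left frame_inner)
    finally show ?thesis .
  qed
  have **: "torus_pt q \<theta> \<bullet> \<epsilon> k = 0" if "q \<le> p" "k \<in> {1..p+2}" "k = 1 \<or> q + 2 < k" for q k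
    using that
  proof (induction q arbitrary: k)
    case (Suc q)
    have "torus_pt q \<theta> \<bullet> \<epsilon> (q + 3) = 0" using Suc by simp
    with Suc show ?case by (auto simp: * upd2_inner)
  qed simp
  show "q \<le> p \<Longrightarrow> k \<in> {1..p+2} \<Longrightarrow> k = 1 \<or> q + 2 < k \<Longrightarrow> torus_pt q \<theta> \<bullet> \<epsilon> k = 0"
    by (rule **)
  show "q < p \<Longrightarrow> torus_pt (Suc q) \<theta> = upd2 2 (q + 3) (cis (\<theta> q) * of_real (1/2 + torus_pt q \<theta> \<bullet> \<epsilon> 2 / 4))
     ((1/4) *\<^sub>R torus_pt q \<theta>)"
    by (rule *) (auto intro: **)
qed

lemma torus_pt_Suc_inner:
  assumes "q < p" "k \<in> {1..p+2}"
  shows "torus_pt (Suc q) \<theta> \<bullet> \<epsilon> k = (if k = 2 then cos (\<theta> q) * (1/2 + torus_pt q \<theta> \<bullet> \<epsilon> 2 / 4)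
    else if k = q + 3 then sin (\<theta> q) * (1/2 + torus_pt q \<theta> \<bullet> \<epsilon> 2 / 4) else torus_pt q \<theta> \<bullet> \<epsilon> k / 4)"
  using assms by (simp add: torus_pt_Suc upd2_inner)

lemma torus_pt_cong: "(\<And>i. i < q \<Longrightarrow> \<theta> i = \<theta>' i) \<Longrightarrow> torus_pt q \<theta> = torus_pt q \<theta>'"
  unfolding torus_pt_def by (rule arg_cong[of _ _ "std_embedding \<epsilon> q"]) (auto simp: restrict_def)

definition sqnorm :: "nat \<Rightarrow> 'a \<Rightarrow> real" where
  "sqnorm q x = (\<Sum>k=1..q+2. (x \<bullet> \<epsilon> k)\<^sup>2)"

lemma smooth_on_sqnorm [smooth_intros]:
  "open S \<Longrightarrow> smooth_on S f \<Longrightarrow> smooth_on S (\<lambda>x. sqnorm q (f x))"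
  unfolding sqnorm_def by (intro smooth_intros)

lemma sqnorm_ge: "k \<in> {1..q+2} \<Longrightarrow> (x \<bullet> \<epsilon> k)\<^sup>2 \<le> sqnorm q x"
  unfolding sqnorm_def by (rule member_le_sum) auto

lemma sqnorm_coord2_Suc:
  "sqnorm (Suc q) x = (cmod (coord2 2 (q + 3) x))\<^sup>2 + (\<Sum>k\<in>{1..q+2}-{2}. (x \<bullet> \<epsilon> k)\<^sup>2)"
proof -
  have "sqnorm (Suc q) x = sqnorm q x + (x \<bullet> \<epsilon> (q + 3))\<^sup>2"
    by (simp add: sqnorm_def numeral_3_eq_3)
  moreover have "sqnorm q x = (x \<bullet> \<epsilon> 2)\<^sup>2 + (\<Sum>k\<in>{1..q+2}-{2}. (x \<bullet> \<epsilon> k)\<^sup>2)"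
    unfolding sqnorm_def by (rule sum.remove) auto
  ultimately show ?thesis by (simp add: cmod_power2)
qed

text \<open>2/3 is the fixed point of \<open>t = 1/2 + t/4\<close>: each inductive step carries the
  ball of radius 2/3 about the origin into itself.\<close>

lemma torus_pt_sqnorm: "q \<le> p \<Longrightarrow> sqnorm q (torus_pt q \<theta>) \<le> 4/9"
proof (induction q)
  case (Suc q)
  let ?x = "torus_pt q \<theta>"
  define m where "m = (\<Sum>k\<in>{1..q+2}-{2}. (?x \<bullet> \<epsilon> k)\<^sup>2)"
  have q: "sqnorm q ?x = (?x \<bullet> \<epsilon> 2)\<^sup>2 + m"
    unfolding sqnorm_def m_def by (rule sum.remove) auto
  have "coord2 2 (q + 3) (torus_pt (Suc q) \<theta>) = cis (\<theta> q) * of_real (1/2 + ?x \<bullet> \<epsilon> 2 / 4)"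
    using Suc by (simp add: complex_eq_iff torus_pt_Suc_inner)
  then have "(cmod (coord2 2 (q + 3) (torus_pt (Suc q) \<theta>)))\<^sup>2 = (1/2 + ?x \<bullet> \<epsilon> 2 / 4)\<^sup>2"
    by (simp only: norm_mult norm_cis norm_of_real mult_1 power2_abs)
  moreover have "(\<Sum>k\<in>{1..q+2}-{2}. (torus_pt (Suc q) \<theta> \<bullet> \<epsilon> k)\<^sup>2) = m / 16"
    unfolding m_def sum_divide_distrib
    by (rule sum.cong) (use Suc in \<open>auto simp: torus_pt_Suc_inner power2_eq_square\<close>)
  ultimately have "sqnorm (Suc q) (torus_pt (Suc q) \<theta>) = (1/2 + ?x \<bullet> \<epsilon> 2 / 4)\<^sup>2 + m / 16"
    by (simp add: sqnorm_coord2_Suc)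
  also have "\<dots> = 1/4 + (?x \<bullet> \<epsilon> 2) / 4 + sqnorm q ?x / 16"
    unfolding q by (simp add: power2_eq_square algebra_simps)
  also have "\<dots> \<le> 1/4 + (2/3) / 4 + (4/9) / 16"
  proof -
    have "(?x \<bullet> \<epsilon> 2)\<^sup>2 \<le> (2/3)\<^sup>2" using Suc sqnorm_ge[of 2 q ?x] by (simp add: power2_eq_square)
    then have "?x \<bullet> \<epsilon> 2 \<le> 2/3" by (rule power2_le_imp_le) simp
    with Suc show ?thesis by simp
  qed
  finally show ?case by simp
qed (simp add: sqnorm_def)

lemma torus_pt_inner_bound: 
  assumes "q \<le> p" shows "\<bar>torus_pt q \<theta> \<bullet> \<epsilon> 2\<bar> \<le> 2/3"
proof -
  have "(torus_pt q \<theta> \<bullet> \<epsilon> 2)\<^sup>2 \<le> (2/3)\<^sup>2"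
    using torus_pt_sqnorm[OF assms, of \<theta>] sqnorm_ge[of 2 q "torus_pt q \<theta>"] by (simp add: power2_eq_square)
  then have "\<bar>torus_pt q \<theta> \<bullet> \<epsilon> 2\<bar> \<le> \<bar>2/3\<bar>" by (simp only: abs_le_square_iff)
  then show ?thesis by simp
qed

end

section \<open>Slices around an axis and spinning\<close>

context frame begin

text \<open>A point off the axis is rotated into the half space where coordinate \<open>n\<close> is
  0 and coordinate 2 is positive; then the affine map of the inductive step of
  \<open>std_embedding\<close> is undone. The forgotten angle is \<open>sgn (coord2 2 n x)\<close>,
  and \<open>unslice\<close> puts it back.\<close>

definition slice :: "nat \<Rightarrow> 'a \<Rightarrow> 'a" where
  "slice n x = 4 *\<^sub>R upd2 2 n (of_real (cmod (coord2 2 n x) - 1/2)) x"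

definition unslice :: "nat \<Rightarrow> complex \<Rightarrow> 'a \<Rightarrow> 'a" where
  "unslice n u w = upd2 2 n (u * of_real (1/2 + w \<bullet> \<epsilon> 2 / 4)) ((1/4) *\<^sub>R w)"

text \<open>The complement of the axis is a circle of slices, and \<open>H u\<close> acts on the
  slice at angle \<open>u\<close>. Only unit \<open>u\<close> occur here, but \<open>H\<close> takes
  every complex \<open>u\<close> so that its smoothness can be stated on an open set.\<close>

definition spin :: "nat \<Rightarrow> (complex \<Rightarrow> 'a \<Rightarrow> 'a) \<Rightarrow> 'a \<Rightarrow> 'a" where
  "spin n H x = (let z = coord2 2 n x in if z = 0 then x else unslice n (sgn z) (H (sgn z) (slice n x)))"

text \<open>The maps below act on the slices \<open>{y. y \<bullet> \<epsilon> n = 0 \<and> y \<bullet> \<epsilon> 2 > -2}\<close>, which sweep out the complement of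
  the axis of the rotation; being the identity near the boundary \<open>y \<bullet> \<epsilon> 2 = -2\<close> makes \<open>spin\<close> smooth along
  the axis.\<close>

definition slice_map :: "nat \<Rightarrow> (complex \<Rightarrow> 'a \<Rightarrow> 'a) \<Rightarrow> bool" where
  "slice_map n H \<longleftrightarrow> (\<forall>u y. cmod u = 1 \<longrightarrow> y \<bullet> \<epsilon> n = 0 \<longrightarrow>
     H u y \<bullet> \<epsilon> n = 0 \<and> (y \<bullet> \<epsilon> 2 > -2 \<longrightarrow> H u y \<bullet> \<epsilon> 2 > -2) \<and> (y \<bullet> \<epsilon> 2 \<le> -7/4 \<longrightarrow> H u y = y))"

lemma torus_pt_Suc_unslice: "q < p \<Longrightarrow> torus_pt (Suc q) \<theta> = unslice (q + 3) (cis (\<theta> q)) (torus_pt q \<theta>)"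
  by (simp add: torus_pt_Suc unslice_def)

context
  fixes n :: nat
  assumes n: "n \<in> {3..p+2}"
begin

lemma n_range: "2 \<in> {1..p+2}" "n \<in> {1..p+2}" "2 \<noteq> n"
  using n by auto

lemma slice_inner: "k \<in> {1..p+2} \<Longrightarrow> slice n x \<bullet> \<epsilon> k =
    (if k = 2 then 4 * cmod (coord2 2 n x) - 2 else if k = n then 0 else 4 * (x \<bullet> \<epsilon> k))"
  using n_range by (simp add: slice_def upd2_inner)

lemma unslice_inner: "k \<in> {1..p+2} \<Longrightarrow> unslice n u w \<bullet> \<epsilon> k =
    (if k = 2 then Re u * (1/2 + w \<bullet> \<epsilon> 2 / 4) else if k = n then Im u * (1/2 + w \<bullet> \<epsilon> 2 / 4) else (w \<bullet> \<epsilon> k) / 4)"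
  using n_range by (simp add: unslice_def upd2_inner)

lemma coord2_unslice: "coord2 2 n (unslice n u w) = u * of_real (1/2 + w \<bullet> \<epsilon> 2 / 4)"
  using n_range by (simp add: complex_eq_iff unslice_inner)

lemma unslice_polar:
  assumes "cmod u = 1" "w \<bullet> \<epsilon> 2 > -2"
  shows "coord2 2 n (unslice n u w) \<noteq> 0" "sgn (coord2 2 n (unslice n u w)) = u"
    "cmod (coord2 2 n (unslice n u w)) = 1/2 + w \<bullet> \<epsilon> 2 / 4"
proof -
  have pos: "1/2 + w \<bullet> \<epsilon> 2 / 4 > 0" using assms by simp
  then show "coord2 2 n (unslice n u w) \<noteq> 0" using assms by (auto simp: coord2_unslice simp del: of_real_add)
  show "cmod (coord2 2 n (unslice n u w)) = 1/2 + w \<bullet> \<epsilon> 2 / 4"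
    using pos assms by (simp only: coord2_unslice norm_mult norm_of_real) simp
  show "sgn (coord2 2 n (unslice n u w)) = u"
    using pos assms by (simp only: coord2_unslice sgn_mult sgn_of_real) (simp add: sgn_div_norm)
qed

lemma slice_unslice:
  assumes "cmod u = 1" "w \<bullet> \<epsilon> 2 > -2" "w \<bullet> \<epsilon> n = 0"
  shows "slice n (unslice n u w) = w"
proof (rule frame_eqI)
  fix k assume k: "k \<in> {1..p+2}"
  show "slice n (unslice n u w) \<bullet> \<epsilon> k = w \<bullet> \<epsilon> k"
    using k assms unslice_polar(3)[OF assms(1,2)] by (simp add: slice_inner unslice_inner)
qed

lemma unslice_slice:
  assumes "coord2 2 n x \<noteq> 0"
  shows "unslice n (sgn (coord2 2 n x)) (slice n x) = x"
proof (rule frame_eqI)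
  fix k assume k: "k \<in> {1..p+2}"
  have "sgn z * of_real (cmod z) = z" if "z \<noteq> 0" for z
    using that by (simp add: sgn_div_norm scaleR_conv_of_real)
  from this[OF assms] have "Re (sgn (coord2 2 n x)) * cmod (coord2 2 n x) = x \<bullet> \<epsilon> 2"
    "Im (sgn (coord2 2 n x)) * cmod (coord2 2 n x) = x \<bullet> \<epsilon> n"
    by (simp_all add: complex_eq_iff)
  moreover have "1/2 + (4 * N - 2) / 4 = N" for N :: real by (simp add: field_simps)
  ultimately show "unslice n (sgn (coord2 2 n x)) (slice n x) \<bullet> \<epsilon> k = x \<bullet> \<epsilon> k"
    using k n_range by (simp only: slice_inner unslice_inner if_True) simp
qed

lemma slice_props:
  assumes "coord2 2 n x \<noteq> 0"
  shows "slice n x \<bullet> \<epsilon> n = 0" "slice n x \<bullet> \<epsilon> 2 > -2"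
  using n_range assms by (simp_all add: slice_inner)

lemma spin_inverse:
  assumes "slice_map n H" "\<And>u y. cmod u = 1 \<Longrightarrow> H' u (H u y) = y"
  shows "spin n H' (spin n H x) = x"
proof (cases "coord2 2 n x = 0")
  case False
  let ?u = "sgn (coord2 2 n x)" and ?w = "H (sgn (coord2 2 n x)) (slice n x)"
  have u: "cmod ?u = 1" using False by (simp add: norm_sgn)
  have w: "?w \<bullet> \<epsilon> n = 0" "?w \<bullet> \<epsilon> 2 > -2"
    using assms(1) u slice_props[OF False] unfolding slice_map_def by blast+
  have "spin n H' (spin n H x) = unslice n ?u (H' ?u ?w)"
    using False unslice_polar[OF u w(2)] slice_unslice[OF u w(2,1)] by (simp add: spin_def Let_def)
  also have "\<dots> = x" using assms(2)[OF u] unslice_slice[OF False] by simp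
  finally show ?thesis .
qed (simp add: spin_def)

text \<open>Radius 1/16 corresponds to the slice coordinate 4/16 - 2 = -7/4, the threshold in
  \<open>slice_map\<close>.\<close>

lemma spin_near_axis:
  assumes "slice_map n H" "cmod (coord2 2 n x) \<le> 1/16"
  shows "spin n H x = x"
proof (cases "coord2 2 n x = 0")
  case False
  let ?u = "sgn (coord2 2 n x)"
  have "slice n x \<bullet> \<epsilon> 2 \<le> -7/4" using assms(2) n_range by (simp add: slice_inner)
  then have "H ?u (slice n x) = slice n x"
    using assms(1) slice_props[OF False] False unfolding slice_map_def by (simp add: norm_sgn)
  then show ?thesis using False by (simp add: spin_def unslice_slice)
qed (simp add: spin_def)

text \<open>Polar coordinates are smooth away from the axis and the map is the identity near it; the
  two open sets cover the space.\<close>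

lemma smooth_on_spin:
  assumes "slice_map n H" "smooth_on UNIV (\<lambda>z. H (fst z) (snd z))"
  shows "smooth_on UNIV (spin n H)"
proof -
  let ?S = "{x. coord2 2 n x \<noteq> 0}" and ?T = "{x. cmod (coord2 2 n x) < 1/16}"
  have cont: "continuous_on UNIV (\<lambda>x. coord2 2 n x)"
    using smooth_on_coord2[OF open_UNIV smooth_on_id, of 2 n] unfolding smooth_on_def
    by (metis Ck_on.simps(1))
  have S: "open ?S" by (intro open_Collect_neq cont continuous_on_const)
  have T: "open ?T" by (intro open_Collect_less continuous_on_norm cont continuous_on_const)
  have sg: "smooth_on ?S (\<lambda>x. sgn (coord2 2 n x))"
    by (rule smooth_on_sgn[OF S]) (auto intro: smooth_intros S)
  have cm: "smooth_on ?S (\<lambda>x. cmod (coord2 2 n x))"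
    by (rule smooth_on_cmod[OF S]) (auto intro: smooth_intros S)
  have sl: "smooth_on ?S (\<lambda>x. slice n x)"
    unfolding slice_def by (intro smooth_intros S cm)
  have HS: "smooth_on ?S (\<lambda>x. H (sgn (coord2 2 n x)) (slice n x))"
    by (rule smooth_on_uncurry[OF assms(2) S sg sl])
  have "smooth_on ?S (\<lambda>x. unslice n (sgn (coord2 2 n x)) (H (sgn (coord2 2 n x)) (slice n x)))"
    unfolding unslice_def by (intro smooth_intros S sg HS)
  then have 1: "smooth_on ?S (spin n H)"
    by (subst smooth_on_cong[OF S, of "spin n H"]) (auto simp: spin_def Let_def)
  have 2: "smooth_on ?T (spin n H)"
    by (subst smooth_on_cong[OF T, of "spin n H" "\<lambda>x. x"]) (auto simp: spin_near_axis[OF assms(1)] smooth_on_id)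
  have "?S \<union> ?T = UNIV" by auto
  then show ?thesis using smooth_on_Un[OF S T 1 2] by simp
qed

lemma spin_unslice:
  assumes "cmod u = 1" "w \<bullet> \<epsilon> 2 > -2" "w \<bullet> \<epsilon> n = 0"
  shows "spin n H (unslice n u w) = unslice n u (H u w)"
  using unslice_polar[OF assms(1,2)] slice_unslice[OF assms] by (simp add: spin_def)

end

text \<open>The bound \<open>3 < 4\<close> keeps all supports inside the ball of radius \<open>2\<close>, which the map \<open>y \<mapsto> \<epsilon> 2 / 2 + y / 4\<close>
  takes off the axis; it is reproduced by spinning.\<close>

definition family :: "nat \<Rightarrow> (complex \<Rightarrow> 'a \<Rightarrow> 'a) \<Rightarrow> (complex \<Rightarrow> 'a \<Rightarrow> 'a) \<Rightarrow> bool" where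
  "family q H H' \<longleftrightarrow> smooth_on UNIV (\<lambda>z. H (fst z) (snd z)) \<and>
     (\<forall>u x. cmod u = 1 \<longrightarrow> H' u (H u x) = x \<and> (sqnorm q x \<ge> 3 \<longrightarrow> H u x = x) \<and>
       (\<forall>k. q + 2 < k \<longrightarrow> k \<le> p + 2 \<longrightarrow> H u x \<bullet> \<epsilon> k = x \<bullet> \<epsilon> k))"

text \<open>A moved point cannot land where \<open>sqnorm q\<close> is at least 3, since points
  there are fixed and \<open>H u\<close> is injective; so its image has
  \<open>\<epsilon> 2\<close>-coordinate of square less than 4. The threshold -7/4 works because
  (7/4)^2 = 49/16 exceeds 3.\<close>

lemma family_slice_map:
  assumes "q < p" "family q H H'"
  shows "slice_map (q + 3) H"
  unfolding slice_map_def
proof (intro allI impI)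
  fix u y assume u: "cmod u = 1" and y: "y \<bullet> \<epsilon> (q + 3) = 0"
  have fam: "H' u (H u x) = x" "sqnorm q x \<ge> 3 \<Longrightarrow> H u x = x" for x
    using assms(2) u unfolding family_def by blast+
  have "H u y \<bullet> \<epsilon> 2 > -2" if "y \<bullet> \<epsilon> 2 > -2"
  proof (cases "sqnorm q (H u y) \<ge> 3")
    case True
    then have "H u (H u y) = H u y" by (rule fam)
    then have "H u y = y" by (metis fam(1))
    then show ?thesis using that by simp
  next
    case False
    then have "(H u y \<bullet> \<epsilon> 2)\<^sup>2 < 2\<^sup>2" using sqnorm_ge[of 2 q "H u y"] by simp
    then show ?thesis using abs_square_less_1[of "H u y \<bullet> \<epsilon> 2 / 2"] by (simp add: power_divide)
  qed
  moreover have "H u y = y" if "y \<bullet> \<epsilon> 2 \<le> -7/4"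
  proof (rule fam(2))
    have "(7/4)\<^sup>2 \<le> (- (y \<bullet> \<epsilon> 2))\<^sup>2" using that by (intro power_mono) auto
    then show "sqnorm q y \<ge> 3" using sqnorm_ge[of 2 q y] by (simp add: power2_eq_square)
  qed
  moreover have "H u y \<bullet> \<epsilon> (q + 3) = 0"
    using assms u y unfolding family_def by auto
  ultimately show "H u y \<bullet> \<epsilon> (q + 3) = 0 \<and> (y \<bullet> \<epsilon> 2 > -2 \<longrightarrow> H u y \<bullet> \<epsilon> 2 > -2) \<and> (y \<bullet> \<epsilon> 2 \<le> -7/4 \<longrightarrow> H u y = y)"
    by blast
qed

text \<open>Points moved within a slice lie in a ball of radius sqrt 3 of the first
  \<open>q + 2\<close> coordinates. The affine map of the inductive step carries it into a ball of
  radius 1/2 + sqrt 3 / 4 < sqrt 3, so the same bound holds one dimension higher.\<close>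

lemma family_spin:
  assumes "q < p" "family q H H'"
  shows "family (Suc q) (\<lambda>_. spin (q + 3) H) (\<lambda>_. spin (q + 3) H')"
proof -
  have n: "q + 3 \<in> {3..p+2}" using assms(1) by auto
  note sm = family_slice_map[OF assms]
  have fam: "H' u (H u x) = x" "sqnorm q x \<ge> 3 \<Longrightarrow> H u x = x"
     "q + 2 < k \<Longrightarrow> k \<le> p + 2 \<Longrightarrow> H u x \<bullet> \<epsilon> k = x \<bullet> \<epsilon> k" if "cmod u = 1" for x u k
    using assms(2) that unfolding family_def by blast+
  have smooth: "smooth_on UNIV (spin (q + 3) H)"
    using smooth_on_spin[OF n sm] assms(2) unfolding family_def by blast
  have id: "spin (q + 3) H x = x" if "sqnorm (Suc q) x \<ge> 3" for x
  proof (cases "coord2 2 (q + 3) x = 0")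
    case False
    let ?N = "cmod (coord2 2 (q + 3) x)" and ?y = "slice (q + 3) x"
    define m where "m = (\<Sum>k\<in>{1..q+2}-{2}. (x \<bullet> \<epsilon> k)\<^sup>2)"
    have "sqnorm q ?y = (?y \<bullet> \<epsilon> 2)\<^sup>2 + (\<Sum>k\<in>{1..q+2}-{2}. (?y \<bullet> \<epsilon> k)\<^sup>2)"
      unfolding sqnorm_def by (rule sum.remove) auto
    also have "(\<Sum>k\<in>{1..q+2}-{2}. (?y \<bullet> \<epsilon> k)\<^sup>2) = 16 * m"
      unfolding m_def sum_distrib_left
      by (rule sum.cong) (use assms(1) in \<open>auto simp: slice_inner[OF n] power2_eq_square\<close>)
    also have "?y \<bullet> \<epsilon> 2 = 4 * ?N - 2" using assms(1) by (simp add: slice_inner[OF n])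
    finally have y: "sqnorm q ?y = 16 * (?N\<^sup>2 + m - ?N + 1/4)"
      by (simp add: power2_eq_square algebra_simps)
    have N: "?N\<^sup>2 + m \<ge> 3" using that by (simp add: sqnorm_coord2_Suc m_def)
    have m: "m \<ge> 0" unfolding m_def by (rule sum_nonneg) simp
    \<comment> \<open>The term \<open>- ?N\<close> is absorbed by the bound 3 if
      \<open>?N \<le> 2\<close>, and by \<open>?N\<^sup>2\<close> otherwise.\<close>
    have "sqnorm q ?y \<ge> 3"
    proof (cases "?N \<le> 2")
      case True then show ?thesis using N y by simp
    next
      case False
      then have "?N * ?N \<ge> 2 * ?N" by (intro mult_right_mono) auto
      then show ?thesis using False m y by (simp add: power2_eq_square)
    qed
    then have "H (sgn (coord2 2 (q + 3) x)) ?y = ?y"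
      using False by (intro fam) (simp add: norm_sgn)
    then show ?thesis using False unslice_slice[OF n False] by (simp add: spin_def)
  qed (simp add: spin_def)
  have inert: "spin (q + 3) H x \<bullet> \<epsilon> k = x \<bullet> \<epsilon> k" if "Suc q + 2 < k" "k \<le> p + 2" for x k
  proof (cases "coord2 2 (q + 3) x = 0")
    case False
    then show ?thesis
      using that by (simp add: spin_def Let_def unslice_inner[OF n] slice_inner[OF n] fam(3) norm_sgn)
  qed (simp add: spin_def)
  show ?thesis
    unfolding family_def
    using smooth_on_compose[OF smooth open_UNIV open_UNIV smooth_on_snd[OF open_UNIV smooth_on_id]]
      spin_inverse[OF n sm] fam(1) id inert by auto
qed

text \<open>\<open>T\<close> is the action on angles; under spinning its parameter becomes the angle of the new factor.\<close>

definition extends :: "nat \<Rightarrow> (real \<Rightarrow> (nat \<Rightarrow> real) \<Rightarrow> (nat \<Rightarrow> real)) \<Rightarrow> bool" where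
  "extends q T \<longleftrightarrow> (\<exists>H H'. family q H H' \<and> family q H' H \<and>
     (\<forall>\<phi> \<theta>. H (cis \<phi>) (torus_pt q \<theta>) = torus_pt q (T \<phi> \<theta>)))"

text \<open>The slice of the larger torus at angle \<open>\<theta> q\<close> is the smaller torus,
  on which the parameter takes the value \<open>\<theta> q\<close>. The smaller torus does not see
  what \<open>T\<close> does to coordinate \<open>q\<close>; the update makes this coordinate
  fixed.\<close>

lemma extends_spin:
  assumes "q < p" "extends q T"
  shows "extends (Suc q) (\<lambda>_ \<theta>. (T (\<theta> q) \<theta>)(q := \<theta> q))"
proof -
  obtain H H' where H: "family q H H'" "family q H' H"
    "\<And>\<phi> \<theta>. H (cis \<phi>) (torus_pt q \<theta>) = torus_pt q (T \<phi> \<theta>)"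
    using assms(2) unfolding extends_def by blast
  have n: "q + 3 \<in> {3..p+2}" using assms(1) by auto
  have "spin (q + 3) H (torus_pt (Suc q) \<theta>) = torus_pt (Suc q) ((T (\<theta> q) \<theta>)(q := \<theta> q))" for \<theta>
  proof -
    have "spin (q + 3) H (torus_pt (Suc q) \<theta>) = unslice (q + 3) (cis (\<theta> q)) (H (cis (\<theta> q)) (torus_pt q \<theta>))"
      unfolding torus_pt_Suc_unslice[OF assms(1)]
      by (rule spin_unslice[OF n]) (use assms(1) torus_pt_inner_bound[of q \<theta>] in \<open>auto simp: torus_pt_inner_0\<close>)
    also have "\<dots> = unslice (q + 3) (cis (\<theta> q)) (torus_pt q ((T (\<theta> q) \<theta>)(q := \<theta> q)))"
      unfolding H(3) by (rule arg_cong[of _ _ "unslice _ _"], rule torus_pt_cong) simp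
    finally show ?thesis by (simp add: torus_pt_Suc_unslice[OF assms(1)])
  qed
  then show ?thesis
    unfolding extends_def using family_spin[OF assms(1) H(1)] family_spin[OF assms(1) H(2)] by blast
qed

lemma extends_const:
  assumes "extends q T" shows "extends q (\<lambda>_. T \<phi>)"
proof -
  obtain H H' where H: "family q H H'" "family q H' H"
    "\<And>\<phi> \<theta>. H (cis \<phi>) (torus_pt q \<theta>) = torus_pt q (T \<phi> \<theta>)"
    using assms unfolding extends_def by blast
  have "family q (\<lambda>_. A (cis \<phi>)) (\<lambda>_. B (cis \<phi>))" if "family q A B" for A B
    using that smooth_on_uncurry[of A UNIV "\<lambda>_. cis \<phi>" snd] smooth_on_const[of UNIV "cis \<phi>"]
      smooth_on_snd[OF open_UNIV smooth_on_id]
    unfolding family_def by auto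
  from this[OF H(1)] this[OF H(2)] H(3) show ?thesis unfolding extends_def by blast
qed

lemma family_compose:
  assumes "family q A A'" "family q B B'"
  shows "family q (\<lambda>u x. A u (B u x)) (\<lambda>u x. B' u (A' u x))"
  using assms smooth_on_uncurry[of A UNIV fst "\<lambda>z. B (fst z) (snd z)"]
    smooth_on_fst[OF open_UNIV smooth_on_id]
  unfolding family_def by auto

lemma extends_compose:
  assumes "extends q (\<lambda>_. T)" "extends q (\<lambda>_. U)" shows "extends q (\<lambda>_ \<theta>. T (U \<theta>))"
proof -
  obtain A A' where A: "family q A A'" "family q A' A"
    "\<And>\<phi> \<theta>. A (cis \<phi>) (torus_pt q \<theta>) = torus_pt q (T \<theta>)"
    using assms unfolding extends_def by blast
  obtain B B' where B: "family q B B'" "family q B' B"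
    "\<And>\<phi> \<theta>. B (cis \<phi>) (torus_pt q \<theta>) = torus_pt q (U \<theta>)"
    using assms unfolding extends_def by blast
  have "family q (\<lambda>u x. B' u (A' u x)) (\<lambda>u x. A u (B u x))"
    by (rule family_compose[OF B(2) A(2)])
  with family_compose[OF A(1) B(1)] show ?thesis unfolding extends_def
    by (intro exI[of _ "\<lambda>u x. A u (B u x)"] exI[of _ "\<lambda>u x. B' u (A' u x)"]) (simp add: A(3) B(3))
qed

lemma extends_cong:
  assumes "extends q T" "\<And>\<phi> \<theta> i. i < q \<Longrightarrow> T \<phi> \<theta> i = U \<phi> \<theta> i" shows "extends q U"
  using assms torus_pt_cong[of q "T _ _" "U _ _"] unfolding extends_def by metis

end

section \<open>The basic extendable families\<close>

text \<open>Flattening the torus leaves two circle coordinates of modulus \<open>1/2\<close> and \<open>sqrt t\<close>, where \<open>sqrt t\<close> varies in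
  \<open>[1/12, 1/6]\<close>; multiplying the first by \<open>stretch t\<close> makes the moduli equal.\<close>

definition stretch :: "real \<Rightarrow> real" where
  "stretch t = 1 + (1 - cutoff (1/169) (1/144) t) * (2 * sqrt t - 1)"

lemma smooth_on_stretch: "smooth_on UNIV stretch"
proof -
  have 1: "smooth_on {..<1/169} stretch"
    by (subst smooth_on_cong[where g = "\<lambda>_. 1"]) (auto simp: stretch_def cutoff_eq_1 smooth_on_const)
  have "smooth_on {0<..} stretch"
    unfolding stretch_def by (intro smooth_intros smooth_on_sqrt) auto
  moreover have "{..<1/169} \<union> {0<..} = (UNIV :: real set)"
  proof -
    have "x \<in> {..<1/169} \<union> {0<..}" for x :: real by (cases "x > 0") auto
    then show ?thesis by blast
  qed
  ultimately show ?thesis using smooth_on_Un[OF _ _ 1, of "{0<..}"] by simp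
qed

text \<open>Up to 1/169 the value is 1; beyond, it is a convex combination of 1 and
  \<open>2 * sqrt t\<close>, both at least 2/13. The explicit bound limits how much
  \<open>flatten\<close> can shrink, which is used in \<open>flatten_sqnorm\<close>.\<close>

lemma stretch_lower: assumes "t < 1/16" shows "2/13 \<le> stretch t"
proof (cases "t \<le> 1/169")
  case True
  then show ?thesis by (simp add: stretch_def cutoff_eq_1)
next
  case False
  have "sqrt ((1/13)\<^sup>2) \<le> sqrt t" by (intro real_sqrt_le_mono) (use False in \<open>simp add: power2_eq_square\<close>)
  then have s: "2/13 \<le> 2 * sqrt t" by simp
  define c where "c = cutoff (1/169) (1/144) t"
  have c: "0 \<le> c" "c \<le> 1" using cutoff_bounds[of "1/169" "1/144" t] by (auto simp: c_def)
  have "2/13 = c * (2/13) + (1 - c) * (2/13)" by (simp add: field_simps)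
  also have "\<dots> \<le> c * 1 + (1 - c) * (2 * sqrt t)"
    using c s by (intro add_mono mult_left_mono) auto
  also have "\<dots> = stretch t" by (simp add: stretch_def c_def algebra_simps)
  finally show ?thesis .
qed

lemma stretch_pos: "0 < stretch t"
proof (cases "t < 1/16")
  case True then show ?thesis using stretch_lower by fastforce
next
  case False
  then have "cutoff (1/169) (1/144) t = 0" by (intro cutoff_eq_0) simp
  moreover have "0 < sqrt t" using False by simp
  ultimately show ?thesis by (simp add: stretch_def)
qed

lemma stretch_eq: "1/144 \<le> t \<Longrightarrow> stretch t = 2 * sqrt t"
  by (simp add: stretch_def cutoff_eq_0)

section \<open>Reflections of a circle\<close>

context frame begin

definition upd1 :: "nat \<Rightarrow> real \<Rightarrow> 'a \<Rightarrow> 'a" where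
  "upd1 i c x = x + (c - x \<bullet> \<epsilon> i) *\<^sub>R \<epsilon> i"

lemma upd1_inner: "i \<in> {1..p+2} \<Longrightarrow> k \<in> {1..p+2} \<Longrightarrow> upd1 i c x \<bullet> \<epsilon> k = (if k = i then c else x \<bullet> \<epsilon> k)"
  by (simp add: upd1_def inner_add_left frame_inner)

lemma smooth_on_upd1 [smooth_intros]:
  "open S \<Longrightarrow> smooth_on S c \<Longrightarrow> smooth_on S f \<Longrightarrow> smooth_on S (\<lambda>x. upd1 i (c x) (f x))"
  unfolding upd1_def by (intro smooth_intros)

text \<open>In the presence of the extra direction \<open>\<epsilon> 1\<close>, the reflection of the circle in the line spanned by \<open>u\<close>
  is a half turn about that line.\<close>

definition circle_flip :: "real \<Rightarrow> complex \<Rightarrow> 'a \<Rightarrow> 'a" where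
  "circle_flip s u x = (let \<omega> = cnj u * coord2 2 3 x;
     v = cis (s * (pi * cutoff (1/4) 1 (sqnorm 1 x))) * Complex (Im \<omega>) (x \<bullet> \<epsilon> 1)
     in upd1 1 (Im v) (upd2 2 3 (u * Complex (Re \<omega>) (Re v)) x))"

text \<open>The angle of rotation depends only on the norm of the first three coordinates, which the
  rotation preserves; so the rotation with the opposite sign undoes it.\<close>

lemma circle_flip_family:
  assumes "1 \<le> p" shows "family 1 (circle_flip s) (circle_flip (- s))"
proof -
  note [simp del] = One_nat_def
  have sq: "sqnorm 1 x = (cmod (coord2 2 3 x))\<^sup>2 + (x \<bullet> \<epsilon> 1)\<^sup>2" for x
  proof -
    have "{1..0 + 2} - {2} = {1::nat}" by auto
    then show ?thesis using sqnorm_coord2_Suc[of 0 x] unfolding One_nat_def[symmetric] by simp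
  qed
  have inner: "circle_flip s u x \<bullet> \<epsilon> k = (let \<omega> = cnj u * coord2 2 3 x;
     v = cis (s * (pi * cutoff (1/4) 1 (sqnorm 1 x))) * Complex (Im \<omega>) (x \<bullet> \<epsilon> 1);
     z = u * Complex (Re \<omega>) (Re v) in
     if k = 1 then Im v else if k = 2 then Re z else if k = 3 then Im z else x \<bullet> \<epsilon> k)"
    if "k \<in> {1..p+2}" for s u x k
    using that assms unfolding circle_flip_def Let_def by (simp add: upd1_inner upd2_inner)
  have u1: "cnj u * (u * z) = z" "u * (cnj u * z) = z" if "cmod u = 1" for u z
  proof -
    have "u * cnj u = 1" using that by (metis complex_norm_square mult_cancel_right2 of_real_1 power_one)
    then show "cnj u * (u * z) = z" "u * (cnj u * z) = z" by (metis mult.assoc mult.commute mult_1)+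
  qed
  have smooth: "smooth_on UNIV (\<lambda>z. circle_flip s (fst z) (snd z))"
    unfolding circle_flip_def Let_def by (intro smooth_intros) auto
  have inv: "circle_flip (- s) u (circle_flip s u x) = x" if u: "cmod u = 1" for u x
  proof -
    define \<omega> where "\<omega> = cnj u * coord2 2 3 x"
    define a where "a = s * (pi * cutoff (1/4) 1 (sqnorm 1 x))"
    define v where "v = cis a * Complex (Im \<omega>) (x \<bullet> \<epsilon> 1)"
    define x' where "x' = circle_flip s u x"
    have x': "coord2 2 3 x' = u * Complex (Re \<omega>) (Re v)" "x' \<bullet> \<epsilon> 1 = Im v"
      "\<And>k. k \<in> {1..p+2} - {1,2,3} \<Longrightarrow> x' \<bullet> \<epsilon> k = x \<bullet> \<epsilon> k"
      using assms by (auto simp: x'_def complex_eq_iff inner \<omega>_def v_def a_def Let_def)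
    have "(cmod (u * Complex (Re \<omega>) (Re v)))\<^sup>2 + (Im v)\<^sup>2 = (Re \<omega>)\<^sup>2 + (cmod v)\<^sup>2"
      by (simp add: norm_mult u cmod_power2)
    also have "\<dots> = (cmod \<omega>)\<^sup>2 + (x \<bullet> \<epsilon> 1)\<^sup>2"
      by (simp add: v_def norm_mult cmod_power2)
    also have "\<dots> = sqnorm 1 x" unfolding sq \<omega>_def by (simp add: norm_mult u)
    finally have sq': "sqnorm 1 x' = sqnorm 1 x" unfolding sq[of x'] x'(1,2) .
    have w': "cnj u * coord2 2 3 x' = Complex (Re \<omega>) (Re v)" by (simp add: x' u1[OF u])
    have v': "cis (- s * (pi * cutoff (1/4) 1 (sqnorm 1 x'))) * Complex (Re v) (x' \<bullet> \<epsilon> 1)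
        = Complex (Im \<omega>) (x \<bullet> \<epsilon> 1)"
    proof -
      have "- s * (pi * cutoff (1/4) 1 (sqnorm 1 x')) = - a" unfolding sq' a_def by simp
      moreover have "Complex (Re v) (x' \<bullet> \<epsilon> 1) = v" by (simp add: x')
      moreover have "cis (- a) * v = Complex (Im \<omega>) (x \<bullet> \<epsilon> 1)"
        by (simp add: v_def cis_mult flip: mult.assoc)
      ultimately show ?thesis by simp
    qed
    have uw: "u * Complex (Re \<omega>) (Im \<omega>) = coord2 2 3 x"
      unfolding complex_surj by (simp add: \<omega>_def u1[OF u])
    show ?thesis
      unfolding x'_def[symmetric]
    proof (rule frame_eqI)
      fix k assume k: "k \<in> {1..p+2}"
      show "circle_flip (- s) u x' \<bullet> \<epsilon> k = x \<bullet> \<epsilon> k"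
        unfolding inner[OF k] w' complex.sel v' Let_def uw using k x'(3)[of k] by auto
    qed
  qed
  have id: "circle_flip s u x = x" if u: "cmod u = 1" and "sqnorm 1 x \<ge> 3" for u x
  proof (rule frame_eqI)
    fix k assume k: "k \<in> {1..p+2}"
    have c: "cutoff (1/4) 1 (sqnorm 1 x) = 0" using that by (intro cutoff_eq_0) simp
    show "circle_flip s u x \<bullet> \<epsilon> k = x \<bullet> \<epsilon> k"
      unfolding inner[OF k] c Let_def mult_zero_right cis_zero mult_1 complex.sel complex_surj u1[OF u] by simp
  qed
  show ?thesis
    unfolding family_def using smooth inv id assms by (auto simp: inner)
qed

lemma extends_circle_flip:
  assumes "1 \<le> p" shows "extends 1 (\<lambda>\<phi> \<theta>. \<theta>(0 := 2 * \<phi> - \<theta> 0))"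
proof -
  note [simp del] = One_nat_def
  have p0: "0 < p" using assms by simp
  have pt: "torus_pt 1 \<theta> \<bullet> \<epsilon> k = (if k = 2 then cos (\<theta> 0) / 2 else if k = 3 then sin (\<theta> 0) / 2 else 0)"
    if "k \<in> {1..p+2}" for k \<theta>
    using torus_pt_Suc_inner[OF _ that, of 0 \<theta>, OF p0] unfolding One_nat_def[symmetric] by simp
  have crd: "coord2 2 3 (torus_pt 1 \<theta>) = of_real (1/2) * cis (\<theta> 0)" for \<theta>
    using assms by (simp add: complex_eq_iff pt)
  have sq: "sqnorm 1 (torus_pt 1 \<theta>) = 1/4" for \<theta>
  proof -
    have "{1..0 + 2} - {2} = {1::nat}" by auto
    then have "sqnorm 1 (torus_pt 1 \<theta>) = (cmod (of_real (1/2) * cis (\<theta> 0)))\<^sup>2 + (torus_pt 1 \<theta> \<bullet> \<epsilon> 1)\<^sup>2"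
      using sqnorm_coord2_Suc[of 0 "torus_pt 1 \<theta>"] crd unfolding One_nat_def[symmetric] by simp
    then show ?thesis using assms by (simp only: norm_mult norm_cis) (simp add: pt power2_eq_square)
  qed
  have "circle_flip 1 (cis \<phi>) (torus_pt 1 \<theta>) = torus_pt 1 (\<theta>(0 := 2 * \<phi> - \<theta> 0))" for \<phi> \<theta>
  proof (rule frame_eqI)
    fix k assume k: "k \<in> {1..p+2}"
    \<comment> \<open>The circle has squared radius 1/4, where \<open>cutoff (1/4) 1\<close> is
      still 1, so the turn is by exactly \<open>pi\<close>.\<close>
    have c: "cis (1 * (pi * cutoff (1/4) 1 (sqnorm 1 (torus_pt 1 \<theta>)))) = -1"
      by (simp add: sq cutoff_eq_1)
    have w: "cnj (cis \<phi>) * coord2 2 3 (torus_pt 1 \<theta>) = of_real (1/2) * cis (\<theta> 0 - \<phi>)"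
      by (simp add: crd cis_cnj cis_mult) 
    have z: "cis \<phi> * Complex (Re (of_real (1/2) * cis (\<theta> 0 - \<phi>))) (Re (- 1 * Complex (Im (of_real (1/2) * cis (\<theta> 0 - \<phi>))) 0))
        = of_real (1/2) * cis (2 * \<phi> - \<theta> 0)"
    proof -
      have "Complex (Re (of_real (1/2) * cis (\<theta> 0 - \<phi>))) (Re (- 1 * Complex (Im (of_real (1/2) * cis (\<theta> 0 - \<phi>))) 0))
         = of_real (1/2) * cis (\<phi> - \<theta> 0)"
        by (simp add: complex_eq_iff cos_diff sin_diff field_simps)
      then show ?thesis by (simp add: cis_mult algebra_simps)
    qed
    have t1: "torus_pt 1 \<theta> \<bullet> \<epsilon> 1 = 0" by (simp add: pt)
    show "circle_flip 1 (cis \<phi>) (torus_pt 1 \<theta>) \<bullet> \<epsilon> k = torus_pt 1 (\<theta>(0 := 2 * \<phi> - \<theta> 0)) \<bullet> \<epsilon> k"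
      using k assms unfolding circle_flip_def c w t1 Let_def z by (simp add: upd1_inner upd2_inner pt)
  qed
  with circle_flip_family[OF assms, of 1] circle_flip_family[OF assms, of "-1"]
  show ?thesis unfolding extends_def by auto
qed

end

section \<open>Flattening two circle factors and exchanging them\<close>

context frame begin

declare One_nat_def [simp del]

text \<open>A quarter turn in the plane spanned by \<open>\<epsilon> 2\<close> and \<open>\<epsilon> 1\<close>, cut off away from the origin. Spun
  about the axis, it moves all the tori of the family at once to tori on which \<open>coord2 2 n\<close> has
  modulus \<open>1/2\<close>.\<close>

definition tilt :: "real \<Rightarrow> 'a \<Rightarrow> 'a" where
  "tilt s y = upd2 2 1 (cis (s * (pi/2 * cutoff (4/9) 1 ((y \<bullet> \<epsilon> 2)\<^sup>2 + (y \<bullet> \<epsilon> 1)\<^sup>2))) * coord2 2 1 y) y"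

lemma tilt_inner: "k \<in> {1..p+2} \<Longrightarrow> k \<noteq> 1 \<Longrightarrow> k \<noteq> 2 \<Longrightarrow> tilt s y \<bullet> \<epsilon> k = y \<bullet> \<epsilon> k"
  by (simp add: tilt_def upd2_inner)

lemma coord2_tilt: "coord2 2 1 (tilt s y) =
    cis (s * (pi/2 * cutoff (4/9) 1 ((y \<bullet> \<epsilon> 2)\<^sup>2 + (y \<bullet> \<epsilon> 1)\<^sup>2))) * coord2 2 1 y"
  unfolding complex_eq_iff Re_coord2 Im_coord2 by (simp add: tilt_def upd2_inner)

lemma tilt_norm: "(tilt s y \<bullet> \<epsilon> 2)\<^sup>2 + (tilt s y \<bullet> \<epsilon> 1)\<^sup>2 = (y \<bullet> \<epsilon> 2)\<^sup>2 + (y \<bullet> \<epsilon> 1)\<^sup>2"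
proof -
  have A: "(z \<bullet> \<epsilon> 2)\<^sup>2 + (z \<bullet> \<epsilon> 1)\<^sup>2 = (cmod (coord2 2 1 z))\<^sup>2" for z by (simp add: cmod_power2)
  show ?thesis unfolding A coord2_tilt by (simp only: norm_mult norm_cis mult_1)
qed

lemma frame_eqI_coord2:
  assumes "coord2 i j x = coord2 i j y" "\<And>k. k \<in> {1..p+2} \<Longrightarrow> k \<noteq> i \<Longrightarrow> k \<noteq> j \<Longrightarrow> x \<bullet> \<epsilon> k = y \<bullet> \<epsilon> k"
  shows "x = y"
proof (rule frame_eqI)
  fix k assume "k \<in> {1..p+2}"
  then show "x \<bullet> \<epsilon> k = y \<bullet> \<epsilon> k"
    using assms(2)[of k] arg_cong[OF assms(1), of Re] arg_cong[OF assms(1), of Im] by (cases "k = i"; cases "k = j") auto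
qed

lemma tilt_tilt: "tilt (- s) (tilt s y) = y"
  by (rule frame_eqI_coord2[of 2 1])
    (simp_all add: coord2_tilt tilt_norm tilt_inner cis_mult flip: mult.assoc One_nat_def)

lemma tilt_eq: "1 \<le> (y \<bullet> \<epsilon> 2)\<^sup>2 + (y \<bullet> \<epsilon> 1)\<^sup>2 \<Longrightarrow> tilt s y = y"
  by (rule frame_eqI_coord2[of 2 1]) (simp_all add: coord2_tilt tilt_inner cutoff_eq_0 flip: One_nat_def)

lemma slice_map_tilt:
  assumes "n \<in> {3..p+2}" shows "slice_map n (\<lambda>_. tilt s)"
  unfolding slice_map_def
proof (intro allI impI conjI)
  fix u :: complex and y assume y: "y \<bullet> \<epsilon> n = 0"
  show "tilt s y \<bullet> \<epsilon> n = 0" using assms y by (simp add: tilt_inner)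
  show "tilt s y = y" if "y \<bullet> \<epsilon> 2 \<le> -7/4"
  proof (rule tilt_eq)
    have "1\<^sup>2 \<le> (- (y \<bullet> \<epsilon> 2))\<^sup>2" by (rule power_mono) (use that in auto)
    then have "1 \<le> (y \<bullet> \<epsilon> 2)\<^sup>2" by simp
    then show "1 \<le> (y \<bullet> \<epsilon> 2)\<^sup>2 + (y \<bullet> \<epsilon> 1)\<^sup>2" using zero_le_power2[of "y \<bullet> \<epsilon> 1"] by linarith
  qed
  show "tilt s y \<bullet> \<epsilon> 2 > -2" if "y \<bullet> \<epsilon> 2 > -2"
  proof (cases "1 \<le> (y \<bullet> \<epsilon> 2)\<^sup>2 + (y \<bullet> \<epsilon> 1)\<^sup>2")
    case True then show ?thesis using that by (simp add: tilt_eq)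
  next
    case False
    then have "(tilt s y \<bullet> \<epsilon> 2)\<^sup>2 < 1"
      using tilt_norm[of s y] zero_le_power2[of "tilt s y \<bullet> \<epsilon> 1"] by linarith
    then have "\<bar>tilt s y \<bullet> \<epsilon> 2\<bar> < 1" by (simp add: abs_square_less_1)
    then show ?thesis by simp
  qed
qed

lemma smooth_on_tilt: "smooth_on UNIV (\<lambda>z. (\<lambda>_. tilt s) (fst z) (snd z))"
  unfolding tilt_def by (intro smooth_intros) auto

text \<open>The directions \<open>r + 3\<close> and \<open>r + 4\<close> are those introduced with
  the angles \<open>\<theta> r\<close> and \<open>\<theta> (Suc r)\<close>. The factor depends only
  on coordinates that stay unchanged, so the reciprocal factor gives the inverse.\<close>

definition stretch_map :: "nat \<Rightarrow> (real \<Rightarrow> real) \<Rightarrow> 'a \<Rightarrow> 'a" where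
  "stretch_map r g x = upd2 2 (r + 4) (of_real (g ((x \<bullet> \<epsilon> 1)\<^sup>2 + (x \<bullet> \<epsilon> (r + 3))\<^sup>2)) * coord2 2 (r + 4) x) x"

text \<open>The orthogonal involution \<open>(\<zeta>, \<eta>) \<mapsto> (u * cnj \<eta>, u * cnj \<zeta>)\<close> of \<open>\<complex>\<^sup>2\<close> is a half turn in the real plane of
  its antifixed vectors, so it can be rotated back to the identity. On the flattened torus
  \<open>sqnorm\<close> is at most \<open>1/18 + 1/576 = 33/576\<close>.\<close>

definition torus_swap :: "nat \<Rightarrow> real \<Rightarrow> complex \<Rightarrow> 'a \<Rightarrow> 'a" where
  "torus_swap r s u x = (let \<zeta> = coord2 2 (r + 4) x; \<eta> = coord2 1 (r + 3) x;
     E = cis (s * (pi * cutoff (33/576) (1/16) (sqnorm (Suc (Suc r)) x)));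
     k = \<zeta> + u * cnj \<eta>; d = E * (\<zeta> - u * cnj \<eta>)
     in upd2 2 (r + 4) (of_real (1/2) * (k + d)) (upd2 1 (r + 3) (u * cnj (of_real (1/2) * (k - d))) x))"

text \<open>This is a change of coordinates and need not be the identity far away; conjugating
  \<open>torus_swap\<close> by it still gives the required support, by
  \<open>flatten_sqnorm\<close>.\<close>

definition flatten :: "nat \<Rightarrow> 'a \<Rightarrow> 'a" where
  "flatten r x = stretch_map r stretch (spin (r + 4) (\<lambda>_. tilt 1) x)"

definition unflatten :: "nat \<Rightarrow> 'a \<Rightarrow> 'a" where
  "unflatten r x = spin (r + 4) (\<lambda>_. tilt (-1)) (stretch_map r (\<lambda>t. inverse (stretch t)) x)"

context
  fixes r :: nat
  assumes r: "r + 2 \<le> p"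
begin

lemma ranges: "1 \<in> {1..p+2}" "2 \<in> {1..p+2}" "r + 3 \<in> {1..p+2}" "r + 4 \<in> {1..p+2}" "r + 4 \<in> {3..p+2}"
  using r by auto

lemma stretch_map_inner: "k \<in> {1..p+2} \<Longrightarrow> k \<noteq> 2 \<Longrightarrow> k \<noteq> r + 4 \<Longrightarrow> stretch_map r g x \<bullet> \<epsilon> k = x \<bullet> \<epsilon> k"
  using ranges by (simp add: stretch_map_def upd2_inner)

lemma coord2_stretch_map:
  "coord2 2 (r + 4) (stretch_map r g x) = of_real (g ((x \<bullet> \<epsilon> 1)\<^sup>2 + (x \<bullet> \<epsilon> (r + 3))\<^sup>2)) * coord2 2 (r + 4) x"
  unfolding complex_eq_iff Re_coord2 Im_coord2 using ranges by (simp add: stretch_map_def upd2_inner)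

lemma stretch_map_inverse:
  assumes "\<And>t. h t * g t = 1"
  shows "stretch_map r h (stretch_map r g x) = x"
proof (rule frame_eqI_coord2[of 2 "r + 4"])
  have "coord2 2 (r + 4) (stretch_map r h (stretch_map r g x)) =
     of_real (h t * g t) * coord2 2 (r + 4) x" if "t = (x \<bullet> \<epsilon> 1)\<^sup>2 + (x \<bullet> \<epsilon> (r + 3))\<^sup>2" for t
    using ranges unfolding coord2_stretch_map by (simp add: stretch_map_inner that)
  then show "coord2 2 (r + 4) (stretch_map r h (stretch_map r g x)) = coord2 2 (r + 4) x"
    by (simp add: assms)
qed (simp add: stretch_map_inner)

lemma smooth_on_stretch_map:
  assumes "smooth_on UNIV g" shows "smooth_on UNIV (stretch_map r g)"
proof -
  have "smooth_on UNIV (\<lambda>x. g ((x \<bullet> \<epsilon> 1)\<^sup>2 + (x \<bullet> \<epsilon> (r + 3))\<^sup>2))"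
    by (rule smooth_on_compose[OF assms]) (auto intro!: smooth_intros)
  then show ?thesis
    unfolding stretch_map_def by (intro smooth_intros) auto
qed

lemma flatten_unflatten: "flatten r (unflatten r x) = x" and unflatten_flatten: "unflatten r (flatten r x) = x"
proof -
  have g: "stretch t * inverse (stretch t) = 1" "inverse (stretch t) * stretch t = 1" for t
    using stretch_pos[of t] by auto
  show "unflatten r (flatten r x) = x"
    unfolding unflatten_def flatten_def stretch_map_inverse[of "\<lambda>t. inverse (stretch t)" stretch, OF g(2)]
    by (rule spin_inverse[OF ranges(5) slice_map_tilt[OF ranges(5)] tilt_tilt])
  have "spin (r + 4) (\<lambda>_. tilt 1) (spin (r + 4) (\<lambda>_. tilt (-1)) y) = y" for y
    using spin_inverse[OF ranges(5) slice_map_tilt[OF ranges(5)], of "\<lambda>_. tilt 1" "-1"] tilt_tilt[of "-1"] by simp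
  then show "flatten r (unflatten r x) = x"
    unfolding unflatten_def flatten_def by (simp add: stretch_map_inverse[of stretch "\<lambda>t. inverse (stretch t)", OF g(1)])
qed

lemma smooth_on_flatten: "smooth_on UNIV (flatten r)" and smooth_on_unflatten: "smooth_on UNIV (unflatten r)"
proof -
  have spin: "smooth_on UNIV (spin (r + 4) (\<lambda>_. tilt s))" for s
    by (rule smooth_on_spin[OF ranges(5) slice_map_tilt[OF ranges(5)] smooth_on_tilt])
  have "smooth_on UNIV (\<lambda>t. inverse (stretch t))"
    by (rule smooth_on_compose[OF smooth_on_inverse _ _ smooth_on_stretch])
      (auto simp: less_imp_neq[OF stretch_pos, symmetric])
  then show "smooth_on UNIV (unflatten r)" unfolding unflatten_def
    by (intro smooth_on_compose[OF spin _ _ smooth_on_stretch_map]) auto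
  show "smooth_on UNIV (flatten r)" unfolding flatten_def
    by (intro smooth_on_compose[OF smooth_on_stretch_map[OF smooth_on_stretch] _ _ spin]) auto
qed

lemma spin_tilt_inner:
  assumes "k \<in> {1..p+2}" "k \<noteq> 1" "k \<noteq> 2" "k \<noteq> r + 4"
  shows "spin (r + 4) (\<lambda>_. tilt s) x \<bullet> \<epsilon> k = x \<bullet> \<epsilon> k"
  using assms by (simp add: spin_def Let_def unslice_inner[OF ranges(5)] slice_inner[OF ranges(5)] tilt_inner)

lemma flatten_inner:
  assumes "k \<in> {1..p+2}" "k \<noteq> 1" "k \<noteq> 2" "k \<noteq> r + 4"
  shows "flatten r x \<bullet> \<epsilon> k = x \<bullet> \<epsilon> k"
  using assms by (simp add: flatten_def stretch_map_inner spin_tilt_inner)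

lemma unflatten_inner:
  assumes "k \<in> {1..p+2}" "k \<noteq> 1" "k \<noteq> 2" "k \<noteq> r + 4"
  shows "unflatten r x \<bullet> \<epsilon> k = x \<bullet> \<epsilon> k"
  using assms by (simp add: unflatten_def stretch_map_inner spin_tilt_inner)

text \<open>\<open>tilt\<close> moves only points whose coordinates along
  \<open>\<epsilon> 2\<close> and \<open>\<epsilon> 1\<close> have square sum below 1. In the slice
  these coordinates are \<open>4 * cmod (coord2 2 (r + 4) x) - 2\<close> and
  \<open>4 * (x \<bullet> \<epsilon> 1)\<close>, whence 3/4 and 1/4.\<close>

lemma spin_tilt_cases:
  "spin (r + 4) (\<lambda>_. tilt s) x = x \<or> cmod (coord2 2 (r + 4) x) < 3/4 \<and> \<bar>x \<bullet> \<epsilon> 1\<bar> < 1/4"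
proof (cases "coord2 2 (r + 4) x = 0")
  case False
  let ?y = "slice (r + 4) x"
  show ?thesis
  proof (cases "1 \<le> (?y \<bullet> \<epsilon> 2)\<^sup>2 + (?y \<bullet> \<epsilon> 1)\<^sup>2")
    case True
    then show ?thesis using False unslice_slice[OF ranges(5) False] by (simp add: spin_def tilt_eq)
  next
    case F: False
    have "(?y \<bullet> \<epsilon> 2)\<^sup>2 < 1" "(?y \<bullet> \<epsilon> 1)\<^sup>2 < 1"
      using F zero_le_power2[of "?y \<bullet> \<epsilon> 1"] zero_le_power2[of "?y \<bullet> \<epsilon> 2"] by linarith+
    then have "\<bar>?y \<bullet> \<epsilon> 2\<bar> < 1" "\<bar>?y \<bullet> \<epsilon> 1\<bar> < 1" by (simp_all only: abs_square_less_1)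
    moreover have "?y \<bullet> \<epsilon> 2 = 4 * cmod (coord2 2 (r + 4) x) - 2" "?y \<bullet> \<epsilon> 1 = 4 * (x \<bullet> \<epsilon> 1)"
      using ranges by (simp_all add: slice_inner[OF ranges(5)])
    ultimately show ?thesis by linarith
  qed
qed (simp add: spin_def)

lemma sqnorm_split:
  "sqnorm (Suc (Suc r)) x = (cmod (coord2 2 (r + 4) x))\<^sup>2 + (cmod (coord2 1 (r + 3) x))\<^sup>2 + (\<Sum>k=3..r+2. (x \<bullet> \<epsilon> k)\<^sup>2)"
proof -
  have S: "{1..Suc r + 2} - {2} = insert 1 (insert (r + 3) {3..r+2})" by auto
  have N: "Suc r + 3 = r + 4" by simp
  show ?thesis unfolding sqnorm_coord2_Suc[of "Suc r"] S N by (simp add: cmod_power2)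
qed

text \<open>\<open>torus_swap\<close> moves only points with \<open>sqnorm\<close> below 1/16, and
  this bounds their preimages. If the spun tilt fixes \<open>x\<close>, the only shrinking is by
  \<open>stretch\<close>, at worst by 2/13, so \<open>sqnorm\<close> of \<open>x\<close> is below
  (169/4) / 16 = 169/64 < 3. If it moves \<open>x\<close>, the affected coordinates were small
  already and contribute at most 1 each.\<close>

lemma flatten_sqnorm:
  assumes "sqnorm (Suc (Suc r)) (flatten r x) < 1/16" shows "sqnorm (Suc (Suc r)) x < 3"
proof -
  define y where "y = spin (r + 4) (\<lambda>_. tilt 1) x"
  define W where "W = (\<Sum>k=3..r+2. (x \<bullet> \<epsilon> k)\<^sup>2)"
  define t where "t = (cmod (coord2 1 (r + 3) y))\<^sup>2"
  define N where "N = (cmod (coord2 2 (r + 4) y))\<^sup>2"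
  have W0: "W \<ge> 0" unfolding W_def by (rule sum_nonneg) simp
  have yk: "y \<bullet> \<epsilon> k = x \<bullet> \<epsilon> k" if "k \<in> {3..r+3}" for k
    unfolding y_def by (rule spin_tilt_inner) (use that r in auto)
  have fl: "coord2 1 (r + 3) (flatten r x) = coord2 1 (r + 3) y"
    unfolding complex_eq_iff Re_coord2 Im_coord2 flatten_def y_def[symmetric] using ranges by (simp add: stretch_map_inner)
  have "coord2 2 (r + 4) (flatten r x) = of_real (stretch t) * coord2 2 (r + 4) y"
    unfolding flatten_def y_def[symmetric] coord2_stretch_map t_def by (simp add: cmod_power2)
  then have A: "(cmod (coord2 2 (r + 4) (flatten r x)))\<^sup>2 = (stretch t)\<^sup>2 * N"
    by (simp add: norm_mult power_mult_distrib N_def)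
  have B: "(\<Sum>k=3..r+2. (flatten r x \<bullet> \<epsilon> k)\<^sup>2) = W"
    unfolding W_def by (rule sum.cong) (use r in \<open>auto simp: flatten_inner\<close>)
  have sum: "(stretch t)\<^sup>2 * N + t + W < 1/16"
    using assms unfolding sqnorm_split fl t_def[symmetric] A B .
  have t0: "t \<ge> 0" and N0: "N \<ge> 0" by (simp_all add: t_def N_def)
  have "t < 1/16" using sum W0 N0 zero_le_power2[of "stretch t"] mult_nonneg_nonneg[of "(stretch t)\<^sup>2" N] by linarith
  then have "(2/13)\<^sup>2 \<le> (stretch t)\<^sup>2" by (intro power_mono stretch_lower) auto
  then have "(2/13)\<^sup>2 * N \<le> (stretch t)\<^sup>2 * N" using N0 by (rule mult_right_mono)
  then have NtW: "(4/169) * N + t + W < 1/16" using sum by (simp add: power2_eq_square)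
  consider "y = x" | "cmod (coord2 2 (r + 4) x) < 3/4" "\<bar>x \<bullet> \<epsilon> 1\<bar> < 1/4"
    using spin_tilt_cases[of 1 x] unfolding y_def by blast
  then show ?thesis
  proof cases
    case 1
    then have "sqnorm (Suc (Suc r)) x = N + t + W" by (simp add: sqnorm_split N_def t_def W_def)
    then show ?thesis using NtW t0 W0 by linarith
  next
    case 2
    have "(cmod (coord2 2 (r + 4) x))\<^sup>2 \<le> (3/4)\<^sup>2" using 2(1) by (intro power_mono) auto
    then have "(cmod (coord2 2 (r + 4) x))\<^sup>2 \<le> 1" by (simp add: power2_eq_square)
    moreover have "\<bar>x \<bullet> \<epsilon> 1\<bar>\<^sup>2 \<le> (1/4)\<^sup>2" using 2(2) by (intro power_mono) auto
    then have "(x \<bullet> \<epsilon> 1)\<^sup>2 \<le> 1" by (simp add: power2_eq_square)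
    moreover have "(x \<bullet> \<epsilon> (r + 3))\<^sup>2 \<le> t" using yk[of "r + 3"] by (simp add: t_def cmod_power2)
    moreover have "sqnorm (Suc (Suc r)) x = (cmod (coord2 2 (r + 4) x))\<^sup>2 + ((x \<bullet> \<epsilon> 1)\<^sup>2 + (x \<bullet> \<epsilon> (r + 3))\<^sup>2) + W"
      unfolding sqnorm_split cmod_power2[of "coord2 1 _ _"] Re_coord2 Im_coord2 W_def ..
    ultimately show ?thesis using NtW N0 t0 W0 by linarith
  qed
qed

lemma torus_swap_inner:
  assumes "k \<in> {1..p+2}" "k \<noteq> 1" "k \<noteq> 2" "k \<noteq> r + 3" "k \<noteq> r + 4"
  shows "torus_swap r s u x \<bullet> \<epsilon> k = x \<bullet> \<epsilon> k"
  using assms ranges by (simp add: torus_swap_def Let_def upd2_inner)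

lemma coord2_torus_swap:
  fixes s u x
  defines "\<zeta> \<equiv> coord2 2 (r + 4) x" and "\<eta> \<equiv> coord2 1 (r + 3) x"
    and "E \<equiv> cis (s * (pi * cutoff (33/576) (1/16) (sqnorm (Suc (Suc r)) x)))"
  shows "coord2 2 (r + 4) (torus_swap r s u x) = of_real (1/2) * ((\<zeta> + u * cnj \<eta>) + E * (\<zeta> - u * cnj \<eta>))"
    and "coord2 1 (r + 3) (torus_swap r s u x) = u * cnj (of_real (1/2) * ((\<zeta> + u * cnj \<eta>) - E * (\<zeta> - u * cnj \<eta>)))"
  using ranges unfolding assms torus_swap_def Let_def by (simp_all only: coord2_upd2) (simp_all add: coord2_upd2)

lemma cmod_1_mult_cnj: "cmod u = 1 \<Longrightarrow> u * cnj u = 1"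
  by (metis complex_norm_square of_real_1 power_one)

text \<open>Up to a factor, \<open>\<zeta> + u * cnj \<eta>\<close> and
  \<open>\<zeta> - u * cnj \<eta>\<close> are the parts fixed and negated by the involution. The map
  only multiplies the second by the unit number \<open>E\<close>, and the parallelogram law turns
  this into preservation of the norm.\<close>

lemma torus_swap_sqnorm:
  assumes u: "cmod u = 1"
  shows "sqnorm (Suc (Suc r)) (torus_swap r s u x) = sqnorm (Suc (Suc r)) x"
proof -
  let ?\<zeta> = "coord2 2 (r + 4) x" and ?\<eta> = "coord2 1 (r + 3) x"
  let ?E = "cis (s * (pi * cutoff (33/576) (1/16) (sqnorm (Suc (Suc r)) x)))"
  have par': "(cmod (a + b))\<^sup>2 + (cmod (a - b))\<^sup>2 = 2 * ((cmod a)\<^sup>2 + (cmod b)\<^sup>2)" for a b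
    unfolding cmod_power2 by (simp add: power2_eq_square algebra_simps)
  have par: "(cmod (of_real (1/2) * (a + b)))\<^sup>2 + (cmod (of_real (1/2) * (a - b)))\<^sup>2 = ((cmod a)\<^sup>2 + (cmod b)\<^sup>2) / 2" for a b
  proof -
    have h: "(cmod (of_real (1/2) * c))\<^sup>2 = (cmod c)\<^sup>2 / 4" for c by (simp add: norm_mult power_divide)
    show ?thesis unfolding h using par'[of a b] by simp
  qed
  have "(cmod (coord2 2 (r + 4) (torus_swap r s u x)))\<^sup>2 + (cmod (coord2 1 (r + 3) (torus_swap r s u x)))\<^sup>2
    = ((cmod (?\<zeta> + u * cnj ?\<eta>))\<^sup>2 + (cmod (?E * (?\<zeta> - u * cnj ?\<eta>)))\<^sup>2) / 2"
    unfolding coord2_torus_swap norm_mult[of u] complex_mod_cnj u mult_1 par ..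
  also have "\<dots> = ((cmod (?\<zeta> + u * cnj ?\<eta>))\<^sup>2 + (cmod (?\<zeta> - u * cnj ?\<eta>))\<^sup>2) / 2"
    by (simp add: norm_mult)
  also have "\<dots> = (cmod ?\<zeta>)\<^sup>2 + (cmod ?\<eta>)\<^sup>2" unfolding par' by (simp add: norm_mult u)
  finally have *: "(cmod (coord2 2 (r + 4) (torus_swap r s u x)))\<^sup>2 + (cmod (coord2 1 (r + 3) (torus_swap r s u x)))\<^sup>2
    = (cmod ?\<zeta>)\<^sup>2 + (cmod ?\<eta>)\<^sup>2" .
  have "(\<Sum>k=3..r+2. (torus_swap r s u x \<bullet> \<epsilon> k)\<^sup>2) = (\<Sum>k=3..r+2. (x \<bullet> \<epsilon> k)\<^sup>2)"
    by (rule sum.cong) (use r in \<open>auto simp: torus_swap_inner\<close>)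
  with * show ?thesis unfolding sqnorm_split by simp
qed

text \<open>The angle of the turn depends on \<open>sqnorm\<close> alone, which is preserved; so the
  second map multiplies \<open>d\<close> by the conjugate of the same \<open>E\<close>.\<close>

lemma torus_swap_inverse:
  assumes u: "cmod u = 1"
  shows "torus_swap r (- s) u (torus_swap r s u x) = x"
proof -
  define y where "y = torus_swap r s u x"
  define \<zeta> \<eta> where "\<zeta> = coord2 2 (r + 4) x" and "\<eta> = coord2 1 (r + 3) x"
  define E where "E = cis (s * (pi * cutoff (33/576) (1/16) (sqnorm (Suc (Suc r)) x)))"
  have E': "cis (- s * (pi * cutoff (33/576) (1/16) (sqnorm (Suc (Suc r)) y))) = cnj E"
    unfolding y_def torus_swap_sqnorm[OF u] E_def by (simp add: cis_cnj)
  have EE: "cnj E * E = 1" by (simp add: E_def cis_cnj cis_mult)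
  note uu = cmod_1_mult_cnj[OF u]
  define k d where "k = \<zeta> + u * cnj \<eta>" and "d = E * (\<zeta> - u * cnj \<eta>)"
  have y2: "coord2 2 (r + 4) y = of_real (1/2) * (k + d)"
    and y1: "coord2 1 (r + 3) y = u * cnj (of_real (1/2) * (k - d))"
    unfolding y_def coord2_torus_swap k_def d_def \<zeta>_def \<eta>_def E_def by (rule refl)+
  have uy: "u * cnj (coord2 1 (r + 3) y) = of_real (1/2) * (k - d)"
  proof -
    have "u * cnj (coord2 1 (r + 3) y) = (u * cnj u) * (of_real (1/2) * (k - d))"
      unfolding y1 by simp
    then show ?thesis by (simp add: uu)
  qed
  have sum: "coord2 2 (r + 4) y + u * cnj (coord2 1 (r + 3) y) = k"
    "coord2 2 (r + 4) y - u * cnj (coord2 1 (r + 3) y) = d"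
    unfolding y2 uy by (simp_all add: field_simps)
  have d: "cnj E * d = \<zeta> - u * cnj \<eta>" unfolding d_def mult.assoc[symmetric] EE by simp
  have half: "of_real (1/2) * (k + (\<zeta> - u * cnj \<eta>)) = \<zeta>" "of_real (1/2) * (k - (\<zeta> - u * cnj \<eta>)) = u * cnj \<eta>"
    unfolding k_def by (simp_all add: field_simps)
  show ?thesis
    unfolding y_def[symmetric]
  proof (rule frame_eqI_coord2[of 2 "r + 4"])
    show "coord2 2 (r + 4) (torus_swap r (- s) u y) = coord2 2 (r + 4) x"
      unfolding coord2_torus_swap E' sum d half \<zeta>_def[symmetric] ..
    fix j assume j: "j \<in> {1..p+2}" "j \<noteq> 2" "j \<noteq> r + 4"
    have "u * cnj (u * cnj \<eta>) = \<eta>" using uu by (simp add: mult.assoc[symmetric])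
    then have c: "coord2 1 (r + 3) (torus_swap r (- s) u y) = coord2 1 (r + 3) x"
      unfolding coord2_torus_swap E' sum d half \<eta>_def[symmetric] .
    show "torus_swap r (- s) u y \<bullet> \<epsilon> j = x \<bullet> \<epsilon> j"
      using j torus_swap_inner[of j] arg_cong[OF c, of Re] arg_cong[OF c, of Im]
      unfolding y_def Re_coord2 Im_coord2 by (cases "j = 1"; cases "j = r + 3") auto
  qed
qed

lemma torus_swap_id:
  assumes "cmod u = 1" "1/16 \<le> sqnorm (Suc (Suc r)) x" shows "torus_swap r s u x = x"
proof (rule frame_eqI_coord2[of 2 "r + 4"])
  have c: "cutoff (33/576) (1/16) (sqnorm (Suc (Suc r)) x) = 0" by (rule cutoff_eq_0[OF assms(2)])
  show "coord2 2 (r + 4) (torus_swap r s u x) = coord2 2 (r + 4) x"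
    unfolding coord2_torus_swap c by (simp add: field_simps)
  have "u * cnj (u * cnj (coord2 1 (r + 3) x)) = coord2 1 (r + 3) x"
    using cmod_1_mult_cnj[OF assms(1)] by (simp add: mult.assoc[symmetric])
  then have c1: "coord2 1 (r + 3) (torus_swap r s u x) = coord2 1 (r + 3) x"
    unfolding coord2_torus_swap c by (simp add: field_simps)
  fix j assume j: "j \<in> {1..p+2}" "j \<noteq> 2" "j \<noteq> r + 4"
  show "torus_swap r s u x \<bullet> \<epsilon> j = x \<bullet> \<epsilon> j"
    using j torus_swap_inner[of j] arg_cong[OF c1, of Re] arg_cong[OF c1, of Im]
    unfolding Re_coord2 Im_coord2 by (cases "j = 1"; cases "j = r + 3") auto
qed

lemma smooth_on_torus_swap: "smooth_on UNIV (\<lambda>z. torus_swap r s (fst z) (snd z))"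
  unfolding torus_swap_def Let_def by (intro smooth_intros) auto

lemma torus_swap_family:
  "family (Suc (Suc r)) (\<lambda>u x. unflatten r (torus_swap r s u (flatten r x)))
     (\<lambda>u x. unflatten r (torus_swap r (- s) u (flatten r x)))"
proof -
  have 1: "smooth_on UNIV (\<lambda>z :: complex \<times> 'a. flatten r (snd z))"
    by (rule smooth_on_compose[OF smooth_on_flatten]) (auto intro!: smooth_intros)
  have 2: "smooth_on UNIV (\<lambda>z. torus_swap r s (fst z) (flatten r (snd z)))"
    by (rule smooth_on_uncurry[OF smooth_on_torus_swap open_UNIV _ 1]) (auto intro!: smooth_intros)
  have smooth: "smooth_on UNIV (\<lambda>z. unflatten r (torus_swap r s (fst z) (flatten r (snd z))))"
    by (rule smooth_on_compose[OF smooth_on_unflatten _ _ 2]) auto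
  have id: "unflatten r (torus_swap r s u (flatten r x)) = x"
    if u: "cmod u = 1" and x: "3 \<le> sqnorm (Suc (Suc r)) x" for u x
  proof -
    have "1/16 \<le> sqnorm (Suc (Suc r)) (flatten r x)" using flatten_sqnorm[of x] x by linarith
    then show ?thesis by (simp add: torus_swap_id[OF u] unflatten_flatten)
  qed
  have inert: "unflatten r (torus_swap r s u (flatten r x)) \<bullet> \<epsilon> k = x \<bullet> \<epsilon> k"
    if "Suc (Suc r) + 2 < k" "k \<le> p + 2" for u x k
    using that by (simp add: unflatten_inner torus_swap_inner flatten_inner)
  show ?thesis
    unfolding family_def using smooth id inert by (auto simp: flatten_unflatten unflatten_flatten torus_swap_inverse)
qed

text \<open>The flattened torus: over each point of the scaled \<open>r\<close>-torus two circles of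
  the same radius \<open>c\<close>, which lies between 1/12 and 1/6. Equal radii let the two angles
  be exchanged.\<close>

definition flat_pt :: "(nat \<Rightarrow> real) \<Rightarrow> 'a" where
  "flat_pt \<theta> = (let c = of_real ((1/2 + torus_pt r \<theta> \<bullet> \<epsilon> 2 / 4) / 4) in
     upd2 2 (r + 4) (c * cis (\<theta> (Suc r))) (upd2 1 (r + 3) (c * cis (\<theta> r)) ((1/16) *\<^sub>R torus_pt r \<theta>)))"

text \<open>Before the last spin the circle of angle \<open>\<theta> r\<close> lies in the plane of
  coordinates 2 and \<open>r + 3\<close>. The quarter turn moves it to coordinates 1 and
  \<open>r + 3\<close> and leaves coordinate 2 equal to 0, so that the last circle gets the constant
  radius 1/2. Stretching then turns 1/2 into \<open>R/4\<close>, the radius of the other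
  circle.\<close>

lemma flatten_torus_pt: "flatten r (torus_pt (Suc (Suc r)) \<theta>) = flat_pt \<theta>"
proof -
  define R where "R = 1/2 + torus_pt r \<theta> \<bullet> \<epsilon> 2 / 4"
  have R: "1/3 \<le> R" "R \<le> 2/3" using torus_pt_inner_bound[of r \<theta>] r by (auto simp: R_def)
  define K where "K = torus_pt (Suc r) \<theta>"
  define y where "y = unslice (r + 4) (cis (\<theta> (Suc r))) (tilt 1 K)"
  have Kk: "K \<bullet> \<epsilon> k = (if k = 2 then cos (\<theta> r) * R else if k = r + 3 then sin (\<theta> r) * R else torus_pt r \<theta> \<bullet> \<epsilon> k / 4)"
    if "k \<in> {1..p+2}" for k
    unfolding K_def R_def by (rule torus_pt_Suc_inner) (use r that in auto)
  have K1: "K \<bullet> \<epsilon> 1 = 0" unfolding K_def by (rule torus_pt_inner_0) (use r in auto)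
  have K2: "K \<bullet> \<epsilon> 2 = cos (\<theta> r) * R" using Kk[of 2] ranges by simp
  have Kn: "K \<bullet> \<epsilon> (r + 4) = 0" unfolding K_def by (rule torus_pt_inner_0) (use r in auto)
  \<comment> \<open>The bound 2/3 keeps \<open>K\<close> where \<open>tilt\<close> is a full quarter
    turn, since the cutoff of \<open>tilt\<close> begins at 4/9.\<close>
  have "\<bar>cos (\<theta> r)\<bar> * \<bar>R\<bar> \<le> 1 * (2/3)" by (rule mult_mono) (use R in auto)
  then have "\<bar>K \<bullet> \<epsilon> 2\<bar> \<le> 2/3" by (simp add: K2 abs_mult)
  then have "\<bar>K \<bullet> \<epsilon> 2\<bar>\<^sup>2 \<le> (2/3)\<^sup>2" by (intro power_mono) auto
  then have "(K \<bullet> \<epsilon> 2)\<^sup>2 + (K \<bullet> \<epsilon> 1)\<^sup>2 \<le> 4/9" by (simp add: K1 power2_eq_square)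
  then have "cutoff (4/9) 1 ((K \<bullet> \<epsilon> 2)\<^sup>2 + (K \<bullet> \<epsilon> 1)\<^sup>2) = 1" by (simp add: cutoff_eq_1)
  then have "coord2 2 1 (tilt 1 K) = \<i> * coord2 2 1 K" by (simp add: coord2_tilt)
  then have t2: "tilt 1 K \<bullet> \<epsilon> 2 = 0" and t1: "tilt 1 K \<bullet> \<epsilon> 1 = cos (\<theta> r) * R"
    by (simp_all add: complex_eq_iff K1 K2)
  have sp: "spin (r + 4) (\<lambda>_. tilt 1) (torus_pt (Suc (Suc r)) \<theta>) = y"
  proof -
    have "torus_pt (Suc (Suc r)) \<theta> = unslice (r + 4) (cis (\<theta> (Suc r))) K"
      using torus_pt_Suc_unslice[of "Suc r" \<theta>] r by (simp add: K_def add.commute)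
    moreover have "K \<bullet> \<epsilon> 2 > -2" using \<open>\<bar>K \<bullet> \<epsilon> 2\<bar> \<le> 2/3\<close> by simp
    ultimately show ?thesis
      unfolding y_def using spin_unslice[OF ranges(5), of "cis (\<theta> (Suc r))" K] Kn by simp
  qed
  have cy: "coord2 2 (r + 4) y = of_real (1/2) * cis (\<theta> (Suc r))"
    unfolding y_def coord2_unslice[OF ranges(5)] t2 by simp
  have yk: "y \<bullet> \<epsilon> k = (if k = 1 then cos (\<theta> r) * R / 4 else if k = r + 3 then sin (\<theta> r) * R / 4
     else torus_pt r \<theta> \<bullet> \<epsilon> k / 16)" if "k \<in> {1..p+2}" "k \<noteq> 2" "k \<noteq> r + 4" for k
    using that r unfolding y_def by (simp add: unslice_inner[OF ranges(5)] t1 tilt_inner Kk)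
  have st: "stretch ((y \<bullet> \<epsilon> 1)\<^sup>2 + (y \<bullet> \<epsilon> (r + 3))\<^sup>2) = R / 2"
  proof -
    have "(y \<bullet> \<epsilon> 1)\<^sup>2 + (y \<bullet> \<epsilon> (r + 3))\<^sup>2 = (R/4)\<^sup>2 * ((cos (\<theta> r))\<^sup>2 + (sin (\<theta> r))\<^sup>2)"
    proof -
      have y1: "y \<bullet> \<epsilon> 1 = cos (\<theta> r) * R / 4" and y2: "y \<bullet> \<epsilon> (r + 3) = sin (\<theta> r) * R / 4"
        using ranges yk[of 1] yk[of "r + 3"] by simp_all
      have "(c * R / 4)\<^sup>2 + (s * R / 4)\<^sup>2 = (R/4)\<^sup>2 * (c\<^sup>2 + s\<^sup>2)" for c s :: real
        by (simp add: power2_eq_square algebra_simps)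
      then show ?thesis unfolding y1 y2 .
    qed
    then have eq: "(y \<bullet> \<epsilon> 1)\<^sup>2 + (y \<bullet> \<epsilon> (r + 3))\<^sup>2 = (R/4)\<^sup>2" by simp
    \<comment> \<open>\<open>1/3 \<le> R\<close> puts the radius into the range where
      \<open>stretch t\<close> is \<open>2 * sqrt t\<close>.\<close>
    have "(1/12)\<^sup>2 \<le> (R/4)\<^sup>2" by (rule power_mono) (use R in auto)
    then have "1/144 \<le> (R/4)\<^sup>2" by (simp add: power2_eq_square)
    then show ?thesis unfolding eq using R by (simp add: stretch_eq)
  qed
  have A: "coord2 2 (r + 4) (flatten r (torus_pt (Suc (Suc r)) \<theta>)) = of_real (R/4) * cis (\<theta> (Suc r))"
    unfolding flatten_def sp coord2_stretch_map st cy by simp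
  have inner: "flatten r (torus_pt (Suc (Suc r)) \<theta>) \<bullet> \<epsilon> k = (if k = 1 then cos (\<theta> r) * R / 4 else if k = r + 3
     then sin (\<theta> r) * R / 4 else torus_pt r \<theta> \<bullet> \<epsilon> k / 16)" if "k \<in> {1..p+2}" "k \<noteq> 2" "k \<noteq> r + 4" for k
    unfolding flatten_def sp using that by (simp add: stretch_map_inner yk)
  show ?thesis
    using ranges A unfolding flat_pt_def Let_def R_def[symmetric]
    by (intro frame_eqI_coord2[of 2 "r + 4"]) (simp_all add: coord2_upd2 upd2_inner inner)
qed

lemma torus_swap_flat_pt:
  "torus_swap r 1 (cis \<phi>) (flat_pt \<theta>) = flat_pt (\<theta>(r := \<phi> - \<theta> (Suc r), Suc r := \<phi> - \<theta> r))"
proof -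
  define J where "J = torus_pt r \<theta>"
  define c where "c = (1/2 + J \<bullet> \<epsilon> 2 / 4) / 4"
  define \<theta>' where "\<theta>' = \<theta>(r := \<phi> - \<theta> (Suc r), Suc r := \<phi> - \<theta> r)"
  have "torus_pt r \<theta>' = J" unfolding \<theta>'_def J_def by (rule torus_pt_cong) simp
  then have pt': "flat_pt \<theta>' = upd2 2 (r + 4) (of_real c * cis (\<phi> - \<theta> r))
      (upd2 1 (r + 3) (of_real c * cis (\<phi> - \<theta> (Suc r))) ((1/16) *\<^sub>R J))"
    by (simp add: flat_pt_def c_def Let_def \<theta>'_def)
  have pt: "flat_pt \<theta> = upd2 2 (r + 4) (of_real c * cis (\<theta> (Suc r))) (upd2 1 (r + 3) (of_real c * cis (\<theta> r)) ((1/16) *\<^sub>R J))"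
    by (simp add: flat_pt_def J_def c_def Let_def)
  have c2: "coord2 2 (r + 4) (flat_pt \<theta>) = of_real c * cis (\<theta> (Suc r))"
    and c1: "coord2 1 (r + 3) (flat_pt \<theta>) = of_real c * cis (\<theta> r)"
    and ck: "\<And>k. k \<in> {1..p+2} - {1, 2, r + 3, r + 4} \<Longrightarrow> flat_pt \<theta> \<bullet> \<epsilon> k = J \<bullet> \<epsilon> k / 16"
    unfolding pt using ranges by (simp_all add: coord2_upd2 upd2_inner)
  have "sqnorm (Suc (Suc r)) (flat_pt \<theta>) \<le> 33/576"
  proof -
    have "\<bar>J \<bullet> \<epsilon> 2\<bar> \<le> 2/3" unfolding J_def by (rule torus_pt_inner_bound) (use r in simp)
    then have "\<bar>c\<bar>\<^sup>2 \<le> (1/6)\<^sup>2" by (intro power_mono) (auto simp: c_def)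
    then have "c\<^sup>2 \<le> 1/36" by (simp add: power2_eq_square)
    moreover have "(\<Sum>k=3..r+2. (flat_pt \<theta> \<bullet> \<epsilon> k)\<^sup>2) = (\<Sum>k=3..r+2. (J \<bullet> \<epsilon> k)\<^sup>2) / 256"
      unfolding sum_divide_distrib by (rule sum.cong) (use r in \<open>auto simp: ck power2_eq_square\<close>)
    moreover have "(\<Sum>k=3..r+2. (J \<bullet> \<epsilon> k)\<^sup>2) \<le> sqnorm r J" unfolding sqnorm_def by (rule sum_mono2) auto
    moreover have "sqnorm r J \<le> 4/9" unfolding J_def by (rule torus_pt_sqnorm) (use r in simp)
    ultimately show ?thesis
      unfolding sqnorm_split c2 c1 by (simp only: norm_mult norm_cis norm_of_real mult_1_right power2_abs)
  qed
  then have cut: "cis (1 * (pi * cutoff (33/576) (1/16) (sqnorm (Suc (Suc r)) (flat_pt \<theta>)))) = -1"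
    by (simp add: cutoff_eq_1)
  have u1: "cis \<phi> * cnj (of_real c * cis (\<theta> r)) = of_real c * cis (\<phi> - \<theta> r)"
    and u2: "cis \<phi> * cnj (of_real c * cis (\<theta> (Suc r))) = of_real c * cis (\<phi> - \<theta> (Suc r))"
    by (simp_all add: cis_cnj cis_mult)
  \<comment> \<open>With \<open>E = -1\<close> the general formula becomes the involution
    itself.\<close>
  have half: "of_real (1/2) * ((a + b) + - 1 * (a - b)) = b" "of_real (1/2) * ((a + b) - - 1 * (a - b)) = a" for a b :: complex
    by (simp_all add: field_simps)
  show ?thesis
    unfolding \<theta>'_def[symmetric]
  proof (rule frame_eqI_coord2[of 2 "r + 4"])
    show "coord2 2 (r + 4) (torus_swap r 1 (cis \<phi>) (flat_pt \<theta>)) = coord2 2 (r + 4) (flat_pt \<theta>')"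
      unfolding coord2_torus_swap cut half c1 u1 pt' using ranges by (simp add: coord2_upd2)
    have c: "coord2 1 (r + 3) (torus_swap r 1 (cis \<phi>) (flat_pt \<theta>)) = coord2 1 (r + 3) (flat_pt \<theta>')"
      unfolding coord2_torus_swap cut half c2 u2 pt' using ranges by (simp add: coord2_upd2)
    fix j assume j: "j \<in> {1..p+2}" "j \<noteq> 2" "j \<noteq> r + 4"
    show "torus_swap r 1 (cis \<phi>) (flat_pt \<theta>) \<bullet> \<epsilon> j = flat_pt \<theta>' \<bullet> \<epsilon> j"
    proof (cases "j = 1 \<or> j = r + 3")
      case True
      then show ?thesis using arg_cong[OF c, of Re] arg_cong[OF c, of Im] unfolding Re_coord2 Im_coord2 by auto
    next
      case False
      then show ?thesis using j ranges unfolding pt' by (simp add: torus_swap_inner ck upd2_inner)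
    qed
  qed
qed

lemma extends_torus_swap:
  "extends (Suc (Suc r)) (\<lambda>\<phi> \<theta>. \<theta>(r := \<phi> - \<theta> (Suc r), Suc r := \<phi> - \<theta> r))"
proof -
  have "unflatten r (torus_swap r 1 (cis \<phi>) (flatten r (torus_pt (Suc (Suc r)) \<theta>))) =
     torus_pt (Suc (Suc r)) (\<theta>(r := \<phi> - \<theta> (Suc r), Suc r := \<phi> - \<theta> r))" for \<phi> \<theta>
    using unflatten_flatten[of "torus_pt (Suc (Suc r)) (\<theta>(r := \<phi> - \<theta> (Suc r), Suc r := \<phi> - \<theta> r))"]
    by (simp only: flatten_torus_pt torus_swap_flat_pt)
  then show ?thesis
    unfolding extends_def using torus_swap_family[of 1] torus_swap_family[of "-1"] by auto
qed

end
end

section \<open>Reduction of integer matrices with odd column sums\<close>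

text \<open>\<open>G\<close> stands for extendability over the \<open>p\<close>-torus, so that the
  reduction becomes pure algebra. \<open>G_neg_0\<close> and \<open>G_adjacent\<close> are the two
  families at \<phi> = 0; in \<open>G_double\<close> and \<open>G_triple\<close> spinning has
  replaced \<phi> by the next angle.\<close>

locale torus_moves =
  fixes p :: nat and G :: "((nat \<Rightarrow> real) \<Rightarrow> (nat \<Rightarrow> real)) \<Rightarrow> bool"
  assumes G_comp: "G T \<Longrightarrow> G U \<Longrightarrow> G (\<lambda>\<theta>. T (U \<theta>))"
    and G_cong: "G T \<Longrightarrow> (\<And>\<theta> i. i < p \<Longrightarrow> T \<theta> i = U \<theta> i) \<Longrightarrow> G U"
    and G_neg_0: "0 < p \<Longrightarrow> G (\<lambda>\<theta>. \<theta>(0 := - \<theta> 0))"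
    and G_double: "1 < p \<Longrightarrow> G (\<lambda>\<theta>. \<theta>(0 := 2 * \<theta> 1 - \<theta> 0))"
    and G_adjacent: "Suc k < p \<Longrightarrow> G (\<lambda>\<theta>. \<theta>(k := - \<theta> (Suc k), Suc k := - \<theta> k))"
    and G_triple: "2 < p \<Longrightarrow> G (\<lambda>\<theta>. \<theta>(0 := \<theta> 2 - \<theta> 1, 1 := \<theta> 2 - \<theta> 0))"
begin

lemma G_id: "0 < p \<Longrightarrow> G (\<lambda>\<theta>. \<theta>)"
  using G_comp[OF G_neg_0 G_neg_0] by (rule G_cong) auto

text \<open>Conjugation by the signed exchange \<open>G_adjacent\<close> carries a sign change to
  the next coordinate.\<close>

lemma G_neg: "k < p \<Longrightarrow> G (\<lambda>\<theta>. \<theta>(k := - \<theta> k))"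
proof (induction k)
  case 0 then show ?case by (rule G_neg_0)
next
  case (Suc k)
  have "G (\<lambda>\<theta>. \<theta>(k := - \<theta> k))" by (rule Suc.IH) (use Suc.prems in simp)
  from G_comp[OF G_adjacent[OF Suc.prems] G_comp[OF this G_adjacent[OF Suc.prems]]]
  show ?case by (rule G_cong) auto
qed

lemma G_transpose_adjacent: "Suc k < p \<Longrightarrow> G (\<lambda>\<theta> i. \<theta> (Transposition.transpose k (Suc k) i))"
  by (rule G_cong[OF G_comp[OF G_adjacent G_comp[OF G_neg[of k] G_neg[of "Suc k"]]]])
    (auto simp: Transposition.transpose_def)

lemma G_transpose_add: "k + Suc d < p \<Longrightarrow> G (\<lambda>\<theta> i. \<theta> (Transposition.transpose k (k + Suc d) i))"
proof (induction d)
  case 0 then show ?case using G_transpose_adjacent[of k] by simp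
next
  case (Suc d)
  then have 1: "G (\<lambda>\<theta> i. \<theta> (Transposition.transpose k (k + Suc d) i))" by simp
  have 2: "G (\<lambda>\<theta> i. \<theta> (Transposition.transpose (k + Suc d) (Suc (k + Suc d)) i))" 
    using Suc.prems by (intro G_transpose_adjacent) simp
  show ?case by (rule G_cong[OF G_comp[OF 2 G_comp[OF 1 2]]]) (auto simp: Transposition.transpose_def)
qed

lemma G_transpose: assumes "i < p" "j < p" shows "G (\<lambda>\<theta> l. \<theta> (Transposition.transpose i j l))"
proof (cases i j rule: linorder_cases)
  case less
  then obtain d where "j = i + Suc d" using less_iff_Suc_add by auto
  then show ?thesis using G_transpose_add[of i d] assms by simp
next
  case equal
  then show ?thesis using G_cong[OF G_id] assms by simp
next
  case greater
  then obtain d where "i = j + Suc d" using less_iff_Suc_add by auto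
  then show ?thesis using G_transpose_add[of j d] assms by (simp add: Transposition.transpose_commute)
qed

text \<open>The inverse is recorded because \<open>G_conj\<close> uses it and closure of
  \<open>G\<close> under inverses is not among the axioms.\<close>

definition G_perm :: "(nat \<Rightarrow> nat) \<Rightarrow> bool" where
  "G_perm \<pi> \<longleftrightarrow> bij \<pi> \<and> G (\<lambda>\<theta> i. \<theta> (\<pi> i)) \<and> G (\<lambda>\<theta> i. \<theta> (inv_into UNIV \<pi> i))"

lemma G_perm_transpose: "i < p \<Longrightarrow> j < p \<Longrightarrow> G_perm (Transposition.transpose i j)"
  by (simp add: G_perm_def G_transpose)

lemma G_perm_comp:
  assumes "G_perm \<pi>" "G_perm \<sigma>" shows "G_perm (\<lambda>i. \<pi> (\<sigma> i))"
proof -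
  have b: "bij \<pi>" "bij \<sigma>" using assms by (auto simp: G_perm_def)
  then have "inv_into UNIV (\<lambda>i. \<pi> (\<sigma> i)) = (\<lambda>i. inv_into UNIV \<sigma> (inv_into UNIV \<pi> i))"
    using o_inv_distrib[OF b] by (simp add: o_def)
  moreover have "bij (\<lambda>i. \<pi> (\<sigma> i))" using bij_comp[OF b(2,1)] by (simp add: o_def)
  ultimately show ?thesis
    using assms G_comp[of "\<lambda>\<theta> i. \<theta> (\<sigma> i)" "\<lambda>\<theta> i. \<theta> (\<pi> i)"]
      G_comp[of "\<lambda>\<theta> i. \<theta> (inv_into UNIV \<pi> i)" "\<lambda>\<theta> i. \<theta> (inv_into UNIV \<sigma> i)"] by (simp add: G_perm_def)
qed

text \<open>Composing with one transposition corrects the value at \<open>n\<close> and disturbs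
  only the argument that was sent to \<open>l\<close>. Repeated use prescribes the values at 0, 1
  and 2, to which the basic moves are then conjugated.\<close>

lemma G_perm_extend:
  assumes "G_perm \<pi>" "\<pi> n < p" "l < p"
  obtains \<sigma> where "G_perm \<sigma>" "\<sigma> n = l" "\<And>m. m \<noteq> n \<Longrightarrow> \<pi> m \<noteq> l \<Longrightarrow> \<sigma> m = \<pi> m"
    "\<And>m. m < p \<Longrightarrow> \<pi> m < p \<Longrightarrow> \<sigma> m < p"
proof
  show "G_perm (\<lambda>i. Transposition.transpose (\<pi> n) l (\<pi> i))"
    by (rule G_perm_comp[OF G_perm_transpose assms(1)]) (use assms in auto)
  show "Transposition.transpose (\<pi> n) l (\<pi> m) = \<pi> m" if "m \<noteq> n" "\<pi> m \<noteq> l" for m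
  proof -
    have "inj \<pi>" using assms(1) by (simp add: G_perm_def bij_is_inj)
    then have "\<pi> m \<noteq> \<pi> n" using that(1) by (simp add: inj_eq)
    then show ?thesis using that by (simp add: Transposition.transpose_def)
  qed
  show "Transposition.transpose (\<pi> n) l (\<pi> m) < p" if "m < p" "\<pi> m < p" for m
    using that assms by (auto simp: Transposition.transpose_def)
qed simp

lemma G_perm_1:
  assumes "i < p"
  obtains \<pi> where "G_perm \<pi>" "\<pi> 0 = i" "\<And>m. m < p \<Longrightarrow> \<pi> m < p"
proof
  show "G_perm (Transposition.transpose 0 i)" using assms by (intro G_perm_transpose) auto
qed (use assms in \<open>auto simp: Transposition.transpose_def\<close>)

lemma G_perm_2:
  assumes "i < p" "j < p" "i \<noteq> j"
  obtains \<pi> where "G_perm \<pi>" "\<pi> 0 = i" "\<pi> 1 = j" "\<And>m. m < p \<Longrightarrow> \<pi> m < p"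
proof -
  obtain \<pi> where \<pi>: "G_perm \<pi>" "\<pi> 0 = i" "\<And>m. m < p \<Longrightarrow> \<pi> m < p" using G_perm_1[OF assms(1)] by blast
  have "1 < p" using assms by linarith
  then obtain \<sigma> where \<sigma>: "G_perm \<sigma>" "\<sigma> 1 = j" "\<And>m. m \<noteq> 1 \<Longrightarrow> \<pi> m \<noteq> j \<Longrightarrow> \<sigma> m = \<pi> m"
    "\<And>m. m < p \<Longrightarrow> \<pi> m < p \<Longrightarrow> \<sigma> m < p"
    using G_perm_extend[OF \<pi>(1) \<pi>(3) assms(2)] by blast
  show ?thesis by (rule that[OF \<sigma>(1) _ \<sigma>(2)]) (use \<sigma>(3)[of 0] \<sigma>(4) \<pi> assms in auto)
qed

lemma G_perm_3:
  assumes "i < p" "j < p" "l < p" "i \<noteq> j" "i \<noteq> l" "j \<noteq> l"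
  obtains \<pi> where "G_perm \<pi>" "\<pi> 0 = i" "\<pi> 1 = j" "\<pi> 2 = l"
proof -
  obtain \<pi> where \<pi>: "G_perm \<pi>" "\<pi> 0 = i" "\<pi> 1 = j" "\<And>m. m < p \<Longrightarrow> \<pi> m < p"
    using G_perm_2[OF assms(1,2,4)] by blast
  have "2 < p" using assms by linarith
  then obtain \<sigma> where \<sigma>: "G_perm \<sigma>" "\<sigma> 2 = l" "\<And>m. m \<noteq> 2 \<Longrightarrow> \<pi> m \<noteq> l \<Longrightarrow> \<sigma> m = \<pi> m"
    using G_perm_extend[OF \<pi>(1) \<pi>(4) assms(3)] by blast
  show ?thesis by (rule that[OF \<sigma>(1) _ _ \<sigma>(2)]) (use \<sigma>(3)[of 0] \<sigma>(3)[of 1] \<pi> assms in auto)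
qed

lemma G_conj: "G_perm \<pi> \<Longrightarrow> G T \<Longrightarrow> G (\<lambda>\<theta> i. T (\<lambda>j. \<theta> (\<pi> j)) (inv_into UNIV \<pi> i))"
  using G_comp[OF _ G_comp[of T "\<lambda>\<theta> i. \<theta> (\<pi> i)"], of "\<lambda>\<theta> i. \<theta> (inv_into UNIV \<pi> i)"] by (simp add: G_perm_def)

lemma G_perm_inv: "G_perm \<pi> \<Longrightarrow> inv_into UNIV \<pi> i = j \<longleftrightarrow> i = \<pi> j" and G_perm_surj: "G_perm \<pi> \<Longrightarrow> \<pi> (inv_into UNIV \<pi> i) = i"
  by (auto simp: G_perm_def bij_is_inj bij_is_surj surj_f_inv_f)

lemma G_sign:
  assumes "i < p" "s = 1 \<or> s = (-1::int)" shows "G (\<lambda>\<theta>. \<theta>(i := of_int s * \<theta> i))"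
  using assms(2)
proof
  assume "s = 1"
  show ?thesis by (rule G_cong[OF G_id]) (use assms \<open>s = 1\<close> in auto)
next
  assume "s = -1"
  then show ?thesis using G_neg[OF assms(1)] by simp
qed

text \<open>Negating the first angle and then applying \<open>G_double\<close> shifts it by twice
  the second. Conjugation by a sign change gives the other sign, conjugation by a permutation the
  other indices.\<close>

lemma G_add2:
  assumes "i < p" "k < p" "i \<noteq> k" "s = 1 \<or> s = (-1::int)"
  shows "G (\<lambda>\<theta>. \<theta>(i := \<theta> i + 2 * of_int s * \<theta> k))"
proof -
  obtain \<pi> where \<pi>: "G_perm \<pi>" "\<pi> 0 = i" "\<pi> 1 = k" using G_perm_2[OF assms(1-3)] by blast
  have p: "0 < p" "1 < p" using assms by linarith+
  define B :: "(nat \<Rightarrow> real) \<Rightarrow> nat \<Rightarrow> real" where "B = (\<lambda>\<theta>. \<theta>(0 := \<theta> 0 + 2 * \<theta> 1))"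
  define D :: "(nat \<Rightarrow> real) \<Rightarrow> nat \<Rightarrow> real" where "D = (\<lambda>\<theta>. \<theta>(0 := of_int s * \<theta> 0))"
  have B: "G B"
    by (rule G_cong[OF G_comp[OF G_double G_neg_0]]) (use p in \<open>auto simp: B_def\<close>)
  have D: "G D" unfolding D_def by (rule G_sign[OF p(1) assms(4)])
  have "G (\<lambda>\<theta>. \<theta>(0 := \<theta> 0 + 2 * of_int s * \<theta> 1))"
    by (rule G_cong[OF G_comp[OF D G_comp[OF B D]]]) (use assms in \<open>auto simp: B_def D_def\<close>)
  from G_conj[OF \<pi>(1) this] show ?thesis
    by (rule G_cong) (use \<pi> in \<open>auto simp: G_perm_inv G_perm_surj\<close>)
qed

text \<open>\<open>G_triple\<close> after \<open>G_adjacent\<close> exchanges the first two angles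
  twice and leaves a shift of both by the third; signs and indices again come from
  conjugation.\<close>

lemma G_add_pair:
  assumes "i < p" "j < p" "k < p" "i \<noteq> j" "i \<noteq> k" "j \<noteq> k" "s = 1 \<or> s = (-1::int)" "t = 1 \<or> t = (-1::int)"
  shows "G (\<lambda>\<theta>. \<theta>(i := \<theta> i + of_int s * \<theta> k, j := \<theta> j + of_int t * \<theta> k))"
proof -
  obtain \<pi> where \<pi>: "G_perm \<pi>" "\<pi> 0 = i" "\<pi> 1 = j" "\<pi> 2 = k" using G_perm_3[OF assms(1-6)] by blast
  have p: "0 < p" "1 < p" "2 < p" "Suc 0 < p" using assms by linarith+
  define B :: "(nat \<Rightarrow> real) \<Rightarrow> nat \<Rightarrow> real" where "B = (\<lambda>\<theta>. \<theta>(0 := \<theta> 0 + \<theta> 2, 1 := \<theta> 1 + \<theta> 2))"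
  define D :: "(nat \<Rightarrow> real) \<Rightarrow> nat \<Rightarrow> real" where "D = (\<lambda>\<theta>. \<theta>(0 := of_int s * \<theta> 0, 1 := of_int t * \<theta> 1))"
  have B: "G B"
    by (rule G_cong[OF G_comp[OF G_triple G_adjacent[of 0]]]) (use p in \<open>auto simp: B_def\<close>)
  have D: "G D"
    by (rule G_cong[OF G_comp[OF G_sign[of 0 s] G_sign[of 1 t]]]) (use p assms in \<open>auto simp: D_def\<close>)
  have "G (\<lambda>\<theta>. \<theta>(0 := \<theta> 0 + of_int s * \<theta> 2, 1 := \<theta> 1 + of_int t * \<theta> 2))"
    by (rule G_cong[OF G_comp[OF D G_comp[OF B D]]]) (use assms in \<open>auto simp: B_def D_def\<close>)
  from G_conj[OF \<pi>(1) this] show ?thesis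
    by (rule G_cong) (use \<pi> assms in \<open>auto simp: G_perm_inv G_perm_surj\<close>)
qed

section \<open>Row operations and the reduction\<close>

definition lin :: "(nat \<Rightarrow> nat \<Rightarrow> int) \<Rightarrow> (nat \<Rightarrow> real) \<Rightarrow> nat \<Rightarrow> real" where
  "lin A \<theta> i = (\<Sum>j<p. of_int (A i j) * \<theta> j)"

text \<open>Injectivity modulo every \<open>d\<close>: a form of invertibility that is visibly stable under row operations.\<close>

definition primitive :: "(nat \<Rightarrow> nat \<Rightarrow> int) \<Rightarrow> bool" where
  "primitive A \<longleftrightarrow> (\<forall>d x. (\<forall>i<p. d dvd (\<Sum>j<p. A i j * x j)) \<longrightarrow> (\<forall>j<p. d dvd x j))"

definition odd_columns :: "(nat \<Rightarrow> nat \<Rightarrow> int) \<Rightarrow> bool" where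
  "odd_columns A \<longleftrightarrow> (\<forall>j<p. odd (\<Sum>i<p. A i j))"

definition reduced :: "nat \<Rightarrow> (nat \<Rightarrow> nat \<Rightarrow> int) \<Rightarrow> bool" where
  "reduced k A \<longleftrightarrow> primitive A \<and> odd_columns A \<and> (\<forall>j<k. \<forall>i<p. A i j = (if i = j then 1 else 0))"

definition add_rows :: "(nat \<Rightarrow> int) \<Rightarrow> nat \<Rightarrow> (nat \<Rightarrow> nat \<Rightarrow> int) \<Rightarrow> (nat \<Rightarrow> nat \<Rightarrow> int)" where
  "add_rows c k A = (\<lambda>i l. A i l + c i * A k l)"

text \<open>\<open>G\<close> is required of the inverse operation, hence the minus sign:
  \<open>lin A\<close> is recovered from the matrix obtained by adding rows. The even sum of the
  \<open>c i\<close> preserves the parity of column sums.\<close>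

definition admissible :: "(nat \<Rightarrow> int) \<Rightarrow> nat \<Rightarrow> bool" where
  "admissible c k \<longleftrightarrow> k < p \<and> c k = 0 \<and> even (\<Sum>i<p. c i) \<and> G (\<lambda>\<theta> i. \<theta> i - of_int (c i) * \<theta> k)"

lemma admissible_single:
  assumes "i < p" "k < p" "i \<noteq> k" "s = 1 \<or> s = (-1::int)"
  shows "admissible (\<lambda>l. if l = i then 2 * s else 0) k"
proof -
  have "- s = 1 \<or> - s = -1" using assms(4) by auto
  from G_add2[OF assms(1-3) this] have "G (\<lambda>\<theta> l. \<theta> l - of_int (if l = i then 2 * s else 0) * \<theta> k)"
    by (rule G_cong) auto
  then show ?thesis using assms unfolding admissible_def by (auto simp: sum.delta)
qed

lemma admissible_pair:
  assumes "i < p" "j < p" "k < p" "i \<noteq> j" "i \<noteq> k" "j \<noteq> k" "s = 1 \<or> s = (-1::int)" "t = 1 \<or> t = (-1::int)"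
  shows "admissible (\<lambda>l. if l = i then s else if l = j then t else 0) k"
proof -
  have "- s = 1 \<or> - s = -1" "- t = 1 \<or> - t = -1" using assms by auto
  from G_add_pair[OF assms(1-6) this]
  have "G (\<lambda>\<theta> l. \<theta> l - of_int (if l = i then s else if l = j then t else 0) * \<theta> k)"
    by (rule G_cong) (use assms in auto)
  moreover have "(\<Sum>l<p. if l = i then s else if l = j then t else 0) = s + t"
  proof -
    have "(\<Sum>l<p. if l = i then s else if l = j then t else 0) = (\<Sum>l<p. (if l = i then s else 0) + (if l = j then t else 0))"
      by (rule sum.cong) (use assms in auto)
    then show ?thesis using assms by (simp add: sum.distrib sum.delta)
  qed
  ultimately show ?thesis using assms unfolding admissible_def by auto
qed

lemma add_rows_lin:
  assumes "admissible c k" "G (lin (add_rows c k A))" shows "G (lin A)"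
proof -
  have eq: "lin (add_rows c k A) \<theta> i = lin A \<theta> i + of_int (c i) * lin A \<theta> k" for \<theta> i
    by (simp add: lin_def add_rows_def sum_distrib_left sum.distrib algebra_simps)
  have c: "G (\<lambda>\<theta> i. \<theta> i - of_int (c i) * \<theta> k)" "c k = 0"
    using assms(1) by (auto simp: admissible_def)
  show ?thesis
    by (rule G_cong[OF G_comp[OF c(1) assms(2)]]) (simp add: eq c(2))
qed

lemma add_rows_reduced:
  assumes "admissible c k" "m \<le> k" "reduced m A" shows "reduced m (add_rows c k A)"
proof -
  have k: "k < p" "c k = 0" "even (\<Sum>i<p. c i)" using assms(1) by (auto simp: admissible_def)
  have "primitive (add_rows c k A)"
    unfolding primitive_def
  proof (intro allI impI)
    fix d x j assume d: "\<forall>i<p. d dvd (\<Sum>j<p. add_rows c k A i j * x j)" and j: "j < p"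
    have eq: "(\<Sum>j<p. add_rows c k A i j * x j) = (\<Sum>j<p. A i j * x j) + c i * (\<Sum>j<p. A k j * x j)" for i
      by (simp add: add_rows_def sum_distrib_left sum.distrib algebra_simps)
    have "d dvd (\<Sum>j<p. A k j * x j)" using d[rule_format, OF k(1)] eq[of k] k(2) by simp
    then have "d dvd (\<Sum>j<p. A i j * x j)" if "i < p" for i
      using d[rule_format, OF that] unfolding eq by (metis dvd_add_left_iff dvd_mult)
    then show "d dvd x j" using assms(3) j unfolding reduced_def primitive_def by blast
  qed
  moreover have "odd_columns (add_rows c k A)"
  proof -
    have "(\<Sum>i<p. add_rows c k A i j) = (\<Sum>i<p. A i j) + (\<Sum>i<p. c i) * A k j" for j
      by (simp add: add_rows_def sum.distrib sum_distrib_right)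
    then show ?thesis using assms(3) k(3) by (simp add: reduced_def odd_columns_def)
  qed
  \<comment> \<open>In a finished column \<open>j < m \<le> k\<close> the entry in row
    \<open>k\<close> is 0.\<close>
  moreover have "add_rows c k A i j = A i j" if "j < m" for i j
    using that assms k unfolding reduced_def add_rows_def by auto
  ultimately show ?thesis using assms(3) unfolding reduced_def by simp
qed

lemma swap_rows_lin:
  assumes "i < p" "j < p" "G (lin (\<lambda>l. A (Transposition.transpose i j l)))" shows "G (lin A)"
  by (rule G_cong[OF G_comp[OF G_transpose[OF assms(1,2)] assms(3)]]) (simp add: lin_def)

lemma swap_rows_reduced:
  assumes "i < p" "j < p" "m \<le> i" "m \<le> j" "reduced m A" shows "reduced m (\<lambda>l. A (Transposition.transpose i j l))"
proof -
  have tp: "Transposition.transpose i j l < p" if "l < p" for l using that assms by (auto simp: Transposition.transpose_def)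
  have "primitive (\<lambda>l. A (Transposition.transpose i j l))"
    unfolding primitive_def
  proof (intro allI impI)
    fix d x n assume d: "\<forall>l<p. d dvd (\<Sum>n<p. A (Transposition.transpose i j l) n * x n)" and n: "n < p"
    have "d dvd (\<Sum>n<p. A l n * x n)" if "l < p" for l
      using d[rule_format, OF tp[OF that]] by simp
    then show "d dvd x n" using assms(5) n unfolding reduced_def primitive_def by blast
  qed
  moreover have "(\<Sum>l<p. A (Transposition.transpose i j l) n) = (\<Sum>l<p. A l n)" for n
  proof (rule sum.reindex_bij_betw)
    show "bij_betw (Transposition.transpose i j) {..<p} {..<p}"
      by (rule bij_betw_byWitness[where f' = "Transposition.transpose i j"]) (use tp in auto)
  qed
  moreover have "A (Transposition.transpose i j l) n = (if l = n then 1 else 0)" if "n < m" "l < p" for l n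
    using that assms tp[OF that(2)] unfolding reduced_def by (auto simp: Transposition.transpose_def)
  ultimately show ?thesis using assms(5) by (simp add: reduced_def odd_columns_def)
qed

lemma neg_row_lin:
  assumes "i < p" "G (lin (A(i := \<lambda>l. - A i l)))" shows "G (lin A)"
  by (rule G_cong[OF G_comp[OF G_neg[OF assms(1)] assms(2)]]) (simp add: lin_def sum_negf)

lemma neg_row_reduced:
  assumes "i < p" "m \<le> i" "reduced m A" shows "reduced m (A(i := \<lambda>l. - A i l))"
proof -
  have "primitive (A(i := \<lambda>l. - A i l))"
    unfolding primitive_def
  proof (intro allI impI)
    fix d x n assume d: "\<forall>l<p. d dvd (\<Sum>n<p. (A(i := \<lambda>l. - A i l)) l n * x n)" and n: "n < p"
    have "d dvd (\<Sum>n<p. A l n * x n)" if "l < p" for l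
      using d[rule_format, OF that] by (cases "l = i") (auto simp: sum_negf)
    then show "d dvd x n" using assms(3) n unfolding reduced_def primitive_def by blast
  qed
  moreover have "odd (\<Sum>l<p. (A(i := \<lambda>l. - A i l)) l n) \<longleftrightarrow> odd (\<Sum>l<p. A l n)" for n
    using assms(1) by (simp add: sum.remove[of "{..<p}" i]) blast
  ultimately show ?thesis using assms unfolding reduced_def odd_columns_def by auto
qed

text \<open>With the pivot 1, entries above it are lowered in steps of 2 to absolute value at most
  1, and the remaining units are cleared in pairs. A single leftover unit cannot occur: together
  with the pivot it would make the column sum even.\<close>

lemma clear_above:
  assumes "k < p" and next_col: "\<And>A. reduced (Suc k) A \<Longrightarrow> G (lin A)"
  shows "reduced k A \<Longrightarrow> A k k = 1 \<Longrightarrow> (\<And>i. k < i \<Longrightarrow> i < p \<Longrightarrow> A i k = 0) \<Longrightarrow> G (lin A)"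
proof (induction "\<Sum>i<k. nat \<bar>A i k\<bar>" arbitrary: A rule: less_induct)
  case less
  have step: "G (lin A)" if "admissible c k" "\<And>l. k \<le> l \<Longrightarrow> c l = 0" "\<And>l. l < k \<Longrightarrow> \<bar>A l k + c l\<bar> \<le> \<bar>A l k\<bar>"
    "i < k" "\<bar>A i k + c i\<bar> < \<bar>A i k\<bar>" for c i
  proof (rule add_rows_lin[OF that(1)], rule less.hyps)
    have col: "add_rows c k A l k = A l k + c l" for l using less.prems by (simp add: add_rows_def)
    show "(\<Sum>l<k. nat \<bar>add_rows c k A l k\<bar>) < (\<Sum>l<k. nat \<bar>A l k\<bar>)"
      unfolding col
    proof (rule sum_strict_mono_ex1)
      show "finite {..<k}" by simp
      show "\<forall>l\<in>{..<k}. nat \<bar>A l k + c l\<bar> \<le> nat \<bar>A l k\<bar>" using that(3) by (intro ballI nat_mono) auto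
      show "\<exists>l\<in>{..<k}. nat \<bar>A l k + c l\<bar> < nat \<bar>A l k\<bar>"
        using that(4,5) by (intro bexI[of _ i]) (simp_all only: nat_less_eq_zless[OF abs_ge_zero] lessThan_iff atLeastLessThan_iff simp_thms)
    qed
    show "reduced k (add_rows c k A)" by (rule add_rows_reduced[OF that(1) _ less.prems(1)]) simp
    show "add_rows c k A k k = 1" "\<And>i. k < i \<Longrightarrow> i < p \<Longrightarrow> add_rows c k A i k = 0"
      unfolding col using less.prems that(2) by auto
  qed
  have total: "odd (\<Sum>i<p. A i k)" using less.prems(1) assms(1) by (simp add: reduced_def odd_columns_def)
  have split: "(\<Sum>i<p. A i k) = (\<Sum>i<k. A i k) + 1"
  proof -
    have "(\<Sum>i<p. A i k) = (\<Sum>i<Suc k. A i k)"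
      by (rule sum.mono_neutral_right) (use assms(1) less.prems(3) in auto)
    then show ?thesis using less.prems(2) by simp
  qed
  consider i where "i < k" "\<bar>A i k\<bar> \<ge> 2"
    | i j where "i < k" "j < k" "i \<noteq> j" "\<bar>A i k\<bar> = 1" "\<bar>A j k\<bar> = 1"
    | i where "i < k" "\<bar>A i k\<bar> = 1" "\<And>j. j < k \<Longrightarrow> j \<noteq> i \<Longrightarrow> A j k = 0"
    | "\<And>i. i < k \<Longrightarrow> A i k = 0"
  proof -
    have "\<bar>a\<bar> \<ge> 2 \<or> \<bar>a\<bar> = 1 \<or> a = 0" for a :: int by linarith
    then show thesis using that by metis
  qed
  then show ?case
  proof cases
    case 1
    define s :: int where "s = (if A i k > 0 then -1 else 1)"
    have s: "s = 1 \<or> s = -1" by (simp add: s_def)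
    show ?thesis
      by (rule step[OF admissible_single[of i k s, OF _ assms(1) _ s], of i]) (use 1 assms(1) in \<open>auto simp: s_def\<close>)
  next
    case 2
    have s: "- A i k = 1 \<or> - A i k = -1" and t: "- A j k = 1 \<or> - A j k = -1" using 2 by linarith+
    show ?thesis
      by (rule step[OF admissible_pair[OF _ _ assms(1) 2(3) _ _ s t], of i]) (use 2 assms(1) in auto)
  next
    case 3
    have "(\<Sum>l<k. A l k) = A i k" using 3 by (subst sum.remove[of _ i]) auto
    then have "even (\<Sum>i<p. A i k)" using split 3(2) by (auto simp: abs_if split: if_splits)
    with total show ?thesis by simp
  next
    case 4
    have "A i k = (if i = k then 1 else 0)" if "i < p" for i
      using 4[of i] less.prems(2,3) that by (cases i k rule: linorder_cases) auto
    then show ?thesis using less.prems(1) by (intro next_col) (auto simp: reduced_def less_Suc_eq)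
  qed
qed

text \<open>The vector \<open>x\<close> subtracts from column \<open>k\<close> the combination of
  earlier unit columns that cancels its upper entries. Its image is thus divisible by
  \<open>d\<close>, and primitivity gives \<open>d dvd x k = 1\<close>.\<close>

lemma primitive_column:
  assumes "k < p" "reduced k A" "\<And>i. k \<le> i \<Longrightarrow> i < p \<Longrightarrow> d dvd A i k"
  shows "d dvd 1"
proof -
  define x where "x = (\<lambda>j. if j < k then - A j k else if j = k then 1 else (0::int))"
  have "(\<Sum>j<p. A i j * x j) = (if i < k then 0 else A i k)" if "i < p" for i
  proof -
    have "(\<Sum>j<p. A i j * x j) = (\<Sum>j<Suc k. A i j * x j)"
      by (rule sum.mono_neutral_right) (use assms(1) in \<open>auto simp: x_def\<close>)
    also have "\<dots> = (\<Sum>j<k. (if i = j then 1 else 0) * x j) + A i k"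
      using assms(2) that by (simp add: reduced_def x_def)
    also have "(\<Sum>j<k. (if i = j then 1 else 0) * x j) = (\<Sum>j<k. if i = j then x j else 0)"
      by (rule sum.cong) auto
    also have "\<dots> = (if i < k then x i else 0)" by (simp add: sum.delta)
    finally show ?thesis by (simp add: x_def)
  qed
  then have "\<forall>i<p. d dvd (\<Sum>j<p. A i j * x j)" using assms(3) by auto
  then have "d dvd x k" using assms(1,2) unfolding reduced_def primitive_def by blast
  then show ?thesis by (simp add: x_def)
qed

text \<open>Once all entries below are \<open>0\<close> or \<open>\<plusminus>1\<close>, two nonzero ones are cleared with the help of a third row; such
  a row is missing only if the column sum is even.\<close>

lemma reduce_column:
  assumes "k < p" and next_col: "\<And>A. reduced (Suc k) A \<Longrightarrow> G (lin A)"
  shows "reduced k A \<Longrightarrow> G (lin A)"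
proof (induction "\<Sum>i\<in>{k..<p}. nat \<bar>A i k\<bar>" arbitrary: A rule: less_induct)
  case less
  let ?a = "\<lambda>i. A i k"
  have step: "G (lin A)" if "admissible c j" "k \<le> j" "\<And>l. k \<le> l \<Longrightarrow> l < p \<Longrightarrow> \<bar>?a l + c l * ?a j\<bar> \<le> \<bar>?a l\<bar>"
    "k \<le> i" "i < p" "\<bar>?a i + c i * ?a j\<bar> < \<bar>?a i\<bar>" for c i j
  proof (rule add_rows_lin[OF that(1)], rule less.hyps)
    have col: "add_rows c j A l k = ?a l + c l * ?a j" for l by (simp add: add_rows_def)
    show "(\<Sum>l\<in>{k..<p}. nat \<bar>add_rows c j A l k\<bar>) < (\<Sum>l\<in>{k..<p}. nat \<bar>A l k\<bar>)"
      unfolding col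
    proof (rule sum_strict_mono_ex1)
      show "finite {k..<p}" by simp
      show "\<forall>l\<in>{k..<p}. nat \<bar>?a l + c l * ?a j\<bar> \<le> nat \<bar>A l k\<bar>" using that(3) by (intro ballI nat_mono) auto
      show "\<exists>l\<in>{k..<p}. nat \<bar>?a l + c l * ?a j\<bar> < nat \<bar>A l k\<bar>"
        using that(4-6) by (intro bexI[of _ i]) (simp_all only: nat_less_eq_zless[OF abs_ge_zero] lessThan_iff atLeastLessThan_iff simp_thms)
    qed
    show "reduced k (add_rows c j A)" by (rule add_rows_reduced[OF that(1,2) less.prems])
  qed
  show ?case
  proof (cases "\<exists>i j. k \<le> i \<and> i < p \<and> k \<le> j \<and> j < p \<and> ?a j \<noteq> 0 \<and> \<bar>?a j\<bar> < \<bar>?a i\<bar>")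
    case True
    then obtain i j where ij: "k \<le> i" "i < p" "k \<le> j" "j < p" "?a j \<noteq> 0" "\<bar>?a j\<bar> < \<bar>?a i\<bar>" by blast
    define s :: int where "s = (if (?a i > 0) = (?a j > 0) then -1 else 1)"
    have s: "s = 1 \<or> s = -1" by (simp add: s_def)
    \<comment> \<open>A Euclidean step by \<open>2 * ?a j\<close> instead of \<open>?a j\<close>
      still decreases the absolute value, because
      \<open>0 < \<bar>?a j\<bar> < \<bar>?a i\<bar>\<close>.\<close>
    have "\<bar>?a i + 2 * s * ?a j\<bar> < \<bar>?a i\<bar>" using ij by (auto simp: s_def split: if_splits)
    then show ?thesis
      by (intro step[OF admissible_single[OF ij(2,4) _ s] ij(3) _ ij(1,2)]) (use ij in auto)
  next
    case False
    \<comment> \<open>If all these entries vanished, 2 would divide them and hence 1.\<close>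
    obtain i0 where i0: "k \<le> i0" "i0 < p" "?a i0 \<noteq> 0"
      using primitive_column[OF assms(1) less.prems, of 2] by fastforce
    have same: "\<bar>?a i\<bar> = \<bar>?a i0\<bar>" if "k \<le> i" "i < p" "?a i \<noteq> 0" for i
      using False i0 that by (meson linorder_neqE)
    \<comment> \<open>The nonzero entries now share one absolute value, which divides the whole
      lower part of the column.\<close>
    have "?a i0 dvd 1"
    proof (rule primitive_column[OF assms(1) less.prems])
      fix i assume "k \<le> i" "i < p"
      then show "?a i0 dvd ?a i" using same[of i] by (cases "?a i = 0") (auto simp: abs_eq_iff)
    qed
    then have one: "?a i = 1 \<or> ?a i = -1" if "k \<le> i" "i < p" "?a i \<noteq> 0" for i
      using same[OF that] by (auto simp: zdvd1_eq)
    show ?thesis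
    proof (cases "\<exists>i j. k \<le> i \<and> i < p \<and> k \<le> j \<and> j < p \<and> i \<noteq> j \<and> ?a i \<noteq> 0 \<and> ?a j \<noteq> 0")
      case True
      then obtain i j where ij: "k \<le> i" "i < p" "k \<le> j" "j < p" "i \<noteq> j" "?a i \<noteq> 0" "?a j \<noteq> 0" by blast
      have "\<exists>l<p. l \<noteq> i \<and> l \<noteq> j \<and> (l < k \<or> ?a l \<noteq> 0)"
      proof (rule ccontr)
        assume no: "\<not> (\<exists>l<p. l \<noteq> i \<and> l \<noteq> j \<and> (l < k \<or> ?a l \<noteq> 0))"
        have "(\<Sum>l<p. ?a l) = (\<Sum>l\<in>{i, j}. ?a l)"
          by (rule sum.mono_neutral_right) (use ij no in auto)
        also have "\<dots> = ?a i + ?a j" using ij by simp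
        finally have "even (\<Sum>l<p. ?a l)" using one[OF ij(1,2,6)] one[OF ij(3,4,7)] by auto
        then show False using less.prems assms(1) by (simp add: reduced_def odd_columns_def)
      qed
      then obtain l where l: "l < p" "l \<noteq> i" "l \<noteq> j" "l < k \<or> ?a l \<noteq> 0" by blast
      \<comment> \<open>Row \<open>i\<close> is cleared with row \<open>j\<close>; row
        \<open>l\<close> absorbs the change of parity. If \<open>l < k\<close>, it is not counted in
        the measure and either sign will do; otherwise \<open>t\<close> clears row \<open>l\<close>
        as well.\<close>
      define t where "t = (if l < k then 1 else - (?a l * ?a j))"
      have aj: "?a j * ?a j = 1" using one[OF ij(3,4,7)] by auto
      have s: "- (?a i * ?a j) = 1 \<or> - (?a i * ?a j) = -1" using one[OF ij(1,2,6)] one[OF ij(3,4,7)] by auto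
      have t: "t = 1 \<or> t = -1" using one[of l] one[OF ij(3,4,7)] l by (auto simp: t_def)
      have z: "?a m * ?a j * ?a j = ?a m" for m
        using aj by (simp add: mult.assoc)
      show ?thesis
        by (rule step[OF admissible_pair[OF ij(2) l(1) ij(4) l(2)[symmetric] ij(5) l(3) s t] ij(3) _ ij(1,2)])
          (use l ij in \<open>auto simp: t_def z\<close>)
    next
      case unique: False
      define B where "B = (\<lambda>l. A (Transposition.transpose i0 k l))"
      have B: "reduced k B" unfolding B_def by (rule swap_rows_reduced) (use i0 assms less.prems in auto)
      have Bk: "B k k = 1 \<or> B k k = -1" unfolding B_def using one[OF i0] by simp
      have B0: "B i k = 0" if "k < i" "i < p" for i
      proof -
        have "?a j = 0" if "k \<le> j" "j < p" "j \<noteq> i0" for j using unique i0 that by blast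
        then show ?thesis unfolding B_def using i0 that assms(1) by (auto simp: Transposition.transpose_def)
      qed
      have "G (lin B)"
        using Bk
      proof
        assume "B k k = 1"
        then show ?thesis using clear_above[OF assms(1) next_col B] B0 by blast
      next
        assume m: "B k k = -1"
        show ?thesis
          by (rule neg_row_lin[OF assms(1)], rule clear_above[OF assms(1) next_col neg_row_reduced[OF assms(1) _ B]])
            (use m B0 in auto)
      qed
      then show ?thesis unfolding B_def by (rule swap_rows_lin[OF i0(2) assms(1)])
    qed
  qed
qed

theorem G_lin:
  assumes "0 < p" "primitive A" "odd_columns A" shows "G (lin A)"
proof -
  \<comment> \<open>The induction descends from \<open>k = p\<close>, where a reduced matrix acts as
    the identity.\<close>
  have "reduced k A \<Longrightarrow> G (lin A)" if "k \<le> p" for k A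
    using that
  proof (induction k arbitrary: A rule: inc_induct)
    case base
    then have "lin A \<theta> i = \<theta> i" if "i < p" for \<theta> i
      using that by (simp add: lin_def reduced_def if_distrib[of real_of_int] if_distrib[of "\<lambda>x. x * _"] sum.delta cong: if_cong)
    then show ?case by (intro G_cong[OF G_id[OF assms(1)]]) auto
  next
    case (step n)
    then show ?case using reduce_column[OF step.hyps(2)] by blast
  qed
  from this[of 0] show ?thesis using assms by (simp add: reduced_def)
qed

end

section \<open>A class in the first cohomology of the torus\<close>

lemma cis_eq_1_Ints: "cis (2 * pi * t) = 1 \<longleftrightarrow> t \<in> \<int>"
proof -
  have "cis (2 * pi * t) = 1 \<longleftrightarrow> exp (complex_of_real (2 * pi * t) * \<i>) = 1"
    by (simp add: cis_conv_exp mult.commute)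
  also have "\<dots> \<longleftrightarrow> (\<exists>n::int. 2 * pi * t = 2 * of_int n * pi)"
    by (auto simp: exp_eq_1)
  also have "\<dots> \<longleftrightarrow> (\<exists>n::int. t = of_int n)" by (auto simp: mult.commute)
  finally show ?thesis by (auto elim!: Ints_cases)
qed

text \<open>Unlike the winding number, the difference of the integer parts of a lift makes sense for paths that
  are not closed, and it telescopes around a simplex.\<close>

definition wind :: "(real \<Rightarrow> complex) \<Rightarrow> int" where
  "wind \<gamma> = (let g = SOME g. continuous_on {0..1} g \<and> (\<forall>s\<in>{0..1}. \<gamma> s = cis (2 * pi * g s)) in \<lfloor>g 1\<rfloor> - \<lfloor>g (0::real)\<rfloor>)"

text \<open>Two lifts differ by a continuous integer-valued function on an interval, hence by a
  constant integer, which passes through the floor and cancels.\<close>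

lemma wind_eq:
  assumes "continuous_on {0..1} g" "\<And>s. s \<in> {0..1} \<Longrightarrow> \<gamma> s = cis (2 * pi * g s)"
  shows "wind \<gamma> = \<lfloor>g 1\<rfloor> - \<lfloor>g (0::real)\<rfloor>"
proof -
  define h where "h = (SOME g. continuous_on {0..1} g \<and> (\<forall>s\<in>{0..1}. \<gamma> s = cis (2 * pi * g s)))"
  have h: "continuous_on {0..1} h" "\<And>s. s \<in> {0..1} \<Longrightarrow> \<gamma> s = cis (2 * pi * h s)"
    using someI[of "\<lambda>g. continuous_on {0..1} g \<and> (\<forall>s\<in>{0..1}. \<gamma> s = cis (2 * pi * g s))" g] assms
    unfolding h_def[symmetric] by auto
  have int: "h s - g s \<in> \<int>" if "s \<in> {0..1}" for s
  proof -
    have "cis (2 * pi * (h s - g s)) = cis (2 * pi * h s) / cis (2 * pi * g s)"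
      by (simp add: cis_divide algebra_simps)
    also have "\<dots> = 1" using h(2)[OF that] assms(2)[OF that] by simp
    finally show ?thesis by (simp only: cis_eq_1_Ints)
  qed
  have "(\<lambda>s. h s - g s) constant_on {0..1}"
  proof (rule continuous_discrete_range_constant)
    fix x :: real assume x: "x \<in> {0..1}"
    show "\<exists>e>0. \<forall>y. y \<in> {0..1} \<and> h y - g y \<noteq> h x - g x \<longrightarrow> e \<le> norm (h y - g y - (h x - g x))"
    proof (intro exI[of _ 1] conjI allI impI)
      fix y assume y: "y \<in> {0..1} \<and> h y - g y \<noteq> h x - g x"
      then have "h y - g y - (h x - g x) \<in> \<int>" "h y - g y - (h x - g x) \<noteq> 0" using int[OF x] int[of y] by auto
      then show "1 \<le> norm (h y - g y - (h x - g x))" unfolding real_norm_def by (rule Ints_nonzero_abs_ge1)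
    qed simp
  qed (use h(1) assms(1) in \<open>auto intro!: continuous_intros\<close>)
  then have c: "h 1 - g 1 = h 0 - g 0" by (auto simp: constant_on_def)
  obtain n where "h 0 - g 0 = of_int n" using int[of 0] by (auto elim: Ints_cases)
  then have "h 0 = g 0 + of_int n" "h 1 = g 1 + of_int n" using c by auto
  then show ?thesis unfolding wind_def h_def[symmetric] Let_def by simp
qed

lemma cis_lift:
  fixes S :: "'b::real_normed_vector set"
  assumes "continuous_on S f" "convex S" "\<And>x. x \<in> S \<Longrightarrow> cmod (f x) = 1"
  obtains g :: "'b \<Rightarrow> real" where "continuous_on S g" "\<And>x. x \<in> S \<Longrightarrow> f x = cis (2 * pi * g x)"
proof -
  obtain h where h: "continuous_on S h" "\<And>x. x \<in> S \<Longrightarrow> f x = exp (h x)"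
    using continuous_logarithm_on_contractible[OF assms(1) convex_imp_contractible[OF assms(2)]] assms(3)
    by (metis norm_zero zero_neq_one)
  show ?thesis
  proof
    show "continuous_on S (\<lambda>x. Im (h x) / (2 * pi))" by (intro continuous_intros h(1)) auto
    show "f x = cis (2 * pi * (Im (h x) / (2 * pi)))" if "x \<in> S" for x
    proof -
      have "exp (Re (h x)) = 1" using h(2)[OF that] assms(3)[OF that] by (metis norm_exp_eq_Re)
      then show ?thesis using h(2)[OF that] by (simp add: exp_eq_polar)
    qed
  qed
qed

text \<open>The parameter is the barycentric coordinate of vertex 1, so \<open>edge 0\<close> and
  \<open>edge 1\<close> are the vertices 0 and 1. In \<open>triangle\<close> the pair gives the
  coordinates of vertices 1 and 2.\<close>

definition edge :: "real \<Rightarrow> nat \<Rightarrow> real" where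
  "edge s = (\<lambda>i. if i = 0 then 1 - s else if i = 1 then s else 0)"

definition triangle :: "real \<times> real \<Rightarrow> nat \<Rightarrow> real" where
  "triangle z = (\<lambda>i. if i = 0 then 1 - fst z - snd z else if i = 1 then fst z else if i = 2 then snd z else 0)"

lemma edge_in_simplex: "s \<in> {0..1} \<Longrightarrow> edge s \<in> standard_simplex 1"
  by (auto simp: edge_def standard_simplex_def)

lemma triangle_in_simplex: "0 \<le> a \<Longrightarrow> 0 \<le> b \<Longrightarrow> a + b \<le> 1 \<Longrightarrow> triangle (a, b) \<in> standard_simplex 2"
  by (auto simp: triangle_def standard_simplex_def numeral_2_eq_2)

lemma face_edge:
  "simplical_face 0 (edge s) = triangle (1 - s, s)" "simplical_face 1 (edge s) = triangle (0, s)"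
  "simplical_face 2 (edge s) = triangle (s, 0)"
  by (auto simp: simplical_face_def edge_def triangle_def fun_eq_iff)

lemma face_vertex:
  "x \<in> standard_simplex 0 \<Longrightarrow> simplical_face 0 x = edge 1"
  "x \<in> standard_simplex 0 \<Longrightarrow> simplical_face 1 x = edge 0"
  by (auto simp: simplical_face_def edge_def standard_simplex_def fun_eq_iff)

lemma topspace_torus: "topspace (torus p) = (\<Pi>\<^sub>E i\<in>{..<p}. sphere 0 1)"
  by (simp add: torus_def)

definition parity_cochain :: "nat \<Rightarrow> ((nat \<Rightarrow> real) \<Rightarrow> (nat \<Rightarrow> complex)) \<Rightarrow> int" where
  "parity_cochain p = (\<lambda>\<sigma>\<in>singular_simplex_set 1 (torus p). (\<Sum>i<p. wind (\<lambda>s. \<sigma> (edge s) i)) mod 2)"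

text \<open>The test cycle of winding vector \<open>w\<close>; \<open>t 1\<close> is the barycentric
  coordinate that serves as time.\<close>

definition straight_loop :: "nat \<Rightarrow> (nat \<Rightarrow> int) \<Rightarrow> (nat \<Rightarrow> real) \<Rightarrow> (nat \<Rightarrow> complex)" where
  "straight_loop p w = (\<lambda>t\<in>standard_simplex 1. torus_proj p (vec p (\<lambda>i. t 1 * of_int (w i))))"

lemma continuous_coordinate:
  assumes "singular_simplex n (torus p) \<sigma>" "i < p" "e ` S \<subseteq> standard_simplex n"
    "\<And>k. continuous_on S (\<lambda>x. e x k)"
  shows "continuous_on S (\<lambda>x. \<sigma> (e x) i)" "\<And>x. x \<in> S \<Longrightarrow> cmod (\<sigma> (e x) i) = 1"
proof -
  have \<sigma>: "continuous_map (subtopology (powertop_real UNIV) (standard_simplex n)) (torus p) \<sigma>"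
    using assms(1) by (simp add: singular_simplex_def)
  have e: "continuous_map (top_of_set S) (subtopology (powertop_real UNIV) (standard_simplex n)) e"
    using assms(3,4) by (auto simp: continuous_map_in_subtopology continuous_map_componentwise_UNIV)
  have pr: "continuous_map (torus p) (top_of_set (sphere 0 1)) (\<lambda>v. v i)"
    unfolding torus_def using assms(2) by (intro continuous_map_product_projection) auto
  have "continuous_map (top_of_set S) (top_of_set (sphere 0 1)) ((\<lambda>v. v i) \<circ> (\<sigma> \<circ> e))"
    by (intro continuous_map_compose[OF continuous_map_compose[OF e \<sigma>] pr])
  then have "continuous_on S ((\<lambda>v. v i) \<circ> (\<sigma> \<circ> e))" "((\<lambda>v. v i) \<circ> (\<sigma> \<circ> e)) ` S \<subseteq> sphere 0 1"
    by (auto simp: continuous_map_in_subtopology)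
  then show "continuous_on S (\<lambda>x. \<sigma> (e x) i)" "\<And>x. x \<in> S \<Longrightarrow> cmod (\<sigma> (e x) i) = 1"
    by (auto simp: o_def)
qed

text \<open>A single lift over the whole triangle restricts to lifts on all three faces, so the
  floors at the vertices cancel in pairs.\<close>

lemma wind_faces:
  assumes "singular_simplex 2 (torus p) \<sigma>" "i < p"
  shows "wind (\<lambda>s. singular_face 2 0 \<sigma> (edge s) i) - wind (\<lambda>s. singular_face 2 1 \<sigma> (edge s) i)
    + wind (\<lambda>s. singular_face 2 2 \<sigma> (edge s) i) = 0"
proof -
  define K where "K = {z::real \<times> real. 0 \<le> fst z \<and> 0 \<le> snd z \<and> fst z + snd z \<le> 1}"
  have "convex K"
    unfolding convex_def
  proof (intro ballI allI impI)
    fix x y and u v :: real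
    assume *: "x \<in> K" "y \<in> K" "0 \<le> u" "0 \<le> v" "u + v = 1"
    have "u * (fst x + snd x) + v * (fst y + snd y) \<le> u * 1 + v * 1"
      using * by (intro add_mono mult_left_mono) (auto simp: K_def)
    then show "u *\<^sub>R x + v *\<^sub>R y \<in> K" using * by (auto simp: K_def algebra_simps)
  qed
  have im: "triangle ` K \<subseteq> standard_simplex 2" unfolding K_def using triangle_in_simplex by auto
  have cont: "continuous_on K (\<lambda>x. triangle x k)" for k
    unfolding triangle_def by (cases "k = 0"; cases "k = 1"; cases "k = 2") (auto intro!: continuous_intros)
  obtain g where g: "continuous_on K g" "\<And>x. x \<in> K \<Longrightarrow> \<sigma> (triangle x) i = cis (2 * pi * g x)"
    using cis_lift[OF continuous_coordinate(1)[OF assms im cont] \<open>convex K\<close> continuous_coordinate(2)[OF assms im cont]]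
    by blast
  have face: "singular_face 2 k \<sigma> (edge s) = \<sigma> (simplical_face k (edge s))" if "s \<in> {0..1}" for s k
    using edge_in_simplex[OF that] by (simp add: singular_face_def)
  have w: "wind (\<lambda>s. singular_face 2 k \<sigma> (edge s) i) = \<lfloor>g (e 1)\<rfloor> - \<lfloor>g (e 0)\<rfloor>"
    if "\<And>s. simplical_face k (edge s) = triangle (e s)" "continuous_on {0..1} e" "e ` {0..1} \<subseteq> K" for k e
  proof (rule wind_eq)
    show "continuous_on {0..1} (\<lambda>s. g (e s))" by (rule continuous_on_compose2[OF g(1) that(2,3)])
    show "singular_face 2 k \<sigma> (edge s) i = cis (2 * pi * g (e s))" if "s \<in> {0..1}" for s
    proof -
      have "e s \<in> K" using that \<open>e ` {0..1} \<subseteq> K\<close> by blast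
      then show ?thesis using face[OF that] \<open>\<And>s. simplical_face k (edge s) = triangle (e s)\<close> g(2)[of "e s"] by simp
    qed
  qed
  have "wind (\<lambda>s. singular_face 2 0 \<sigma> (edge s) i) = \<lfloor>g (1 - 1, 1)\<rfloor> - \<lfloor>g (1 - 0, 0)\<rfloor>"
    by (rule w[of 0 "\<lambda>s. (1 - s, s)", OF face_edge(1)])
      (auto simp: K_def intro!: continuous_on_Pair continuous_intros)
  moreover have "wind (\<lambda>s. singular_face 2 1 \<sigma> (edge s) i) = \<lfloor>g (0, 1)\<rfloor> - \<lfloor>g (0, 0)\<rfloor>"
    by (rule w[of 1 "\<lambda>s. (0, s)", OF face_edge(2)])
      (auto simp: K_def intro!: continuous_on_Pair continuous_intros)
  moreover have "wind (\<lambda>s. singular_face 2 2 \<sigma> (edge s) i) = \<lfloor>g (1, 0)\<rfloor> - \<lfloor>g (0, 0)\<rfloor>"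
    by (rule w[of 2 "\<lambda>s. (s, 0)", OF face_edge(3)])
      (auto simp: K_def intro!: continuous_on_Pair continuous_intros)
  ultimately show ?thesis by simp
qed

section \<open>The parity cocycle and its values on straight loops\<close>

lemma alternating_sum_mod_2:
  "(a mod 2 + ((- b) mod 2 + c mod 2) mod 2) mod 2 = (a - b + c) mod 2"
  "(a mod 2 - b mod 2 + c mod 2) mod 2 = (a - b + c) mod 2" for a b c :: int
  by presburger+

lemma coboundary_1_eq:
  assumes "singular_simplex 2 X \<sigma>" "\<phi> \<in> carrier (cochain_group 1 X (integer_mod_group 2))"
  shows "coboundary 1 X (integer_mod_group 2) \<phi> \<sigma> =
    (\<phi> (singular_face 2 0 \<sigma>) - \<phi> (singular_face 2 1 \<sigma>) + \<phi> (singular_face 2 2 \<sigma>)) mod 2"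
proof -
  interpret comm_group "integer_mod_group 2" by simp
  define f where "f = (\<lambda>k. \<phi> (singular_face 2 k \<sigma>) [^]\<^bsub>integer_mod_group 2\<^esub> ((-1) ^ k :: int))"
  have f: "f k = (((-1) ^ k) * \<phi> (singular_face 2 k \<sigma>)) mod 2" for k
    by (simp add: f_def int_pow_integer_mod_group)
  have fc: "f k \<in> carrier (integer_mod_group 2)" for k
    by (simp add: f carrier_integer_mod_group)
  have set: "{..2::nat} = insert 0 (insert 1 {2})" by auto
  have "finprod (integer_mod_group 2) f {..2} = (f 0 + (f 1 + f 2) mod 2) mod 2"
    unfolding set using fc by (simp add: finprod_insert Pi_def carrier_integer_mod_group)
  also have "\<dots> = (\<phi> (singular_face 2 0 \<sigma>) - \<phi> (singular_face 2 1 \<sigma>) + \<phi> (singular_face 2 2 \<sigma>)) mod 2"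
    unfolding f using alternating_sum_mod_2(1) by simp
  finally show ?thesis using assms(1) by (simp add: coboundary_def f_def numeral_2_eq_2)
qed

text \<open>The two ends of a loop are the same 0-simplex, and its two contributions have opposite
  signs.\<close>

lemma coboundary_0_loop:
  assumes "singular_simplex 1 X \<sigma>" "\<sigma> (edge 0) = \<sigma> (edge 1)"
    "\<phi> \<in> carrier (cochain_group 0 X (integer_mod_group 2))"
  shows "coboundary 0 X (integer_mod_group 2) \<phi> \<sigma> = 0"
proof -
  interpret comm_group "integer_mod_group 2" by simp
  define f where "f = (\<lambda>k. \<phi> (singular_face 1 k \<sigma>) [^]\<^bsub>integer_mod_group 2\<^esub> ((-1) ^ k :: int))"
  have f: "f k = (((-1) ^ k) * \<phi> (singular_face 1 k \<sigma>)) mod 2" for k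
    by (simp add: f_def int_pow_integer_mod_group)
  have fc: "f k \<in> carrier (integer_mod_group 2)" for k
    by (simp add: f carrier_integer_mod_group)
  have "singular_face 1 0 \<sigma> = singular_face 1 1 \<sigma>"
    unfolding singular_face_def
  proof (rule restrict_ext)
    fix x :: "nat \<Rightarrow> real" assume "x \<in> standard_simplex (1 - Suc 0)"
    then show "(\<sigma> \<circ> simplical_face 0) x = (\<sigma> \<circ> simplical_face 1) x"
      using face_vertex[of x] assms(2) by simp
  qed
  then have "(f 0 + f 1) mod 2 = 0" by (simp add: f mod_simps)
  moreover have "finprod (integer_mod_group 2) f {..1} = (f 0 + f 1) mod 2"
  proof -
    have set: "{..1::nat} = insert 0 {1}" by auto
    show ?thesis unfolding set using fc by (simp add: finprod_insert Pi_def carrier_integer_mod_group)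
  qed
  ultimately show ?thesis using assms(1) by (simp add: coboundary_def f_def)
qed

lemma parity_cochain_in_carrier: "parity_cochain p \<in> carrier (cochain_group 1 (torus p) (integer_mod_group 2))"
  by (auto simp: parity_cochain_def cochain_group_def carrier_integer_mod_group)

lemma parity_cochain_cocycle: "parity_cochain p \<in> cocycle_set 1 (torus p) (integer_mod_group 2)"
proof -
  have "coboundary 1 (torus p) (integer_mod_group 2) (parity_cochain p) =
    (\<lambda>\<sigma>\<in>singular_simplex_set 2 (torus p). 0)"
  proof (rule extensionalityI[of _ "singular_simplex_set 2 (torus p)"])
    fix \<sigma> assume "\<sigma> \<in> singular_simplex_set 2 (torus p)"
    then have \<sigma>: "singular_simplex 2 (torus p) \<sigma>" by simp
    have face: "singular_simplex 1 (torus p) (singular_face 2 k \<sigma>)" if "k \<le> 2" for k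
      using singular_simplex_singular_face[OF \<sigma>, of k] that by simp
    have "(\<Sum>i<p. wind (\<lambda>s. singular_face 2 0 \<sigma> (edge s) i)) - (\<Sum>i<p. wind (\<lambda>s. singular_face 2 1 \<sigma> (edge s) i))
       + (\<Sum>i<p. wind (\<lambda>s. singular_face 2 2 \<sigma> (edge s) i)) = 0"
      using wind_faces[OF \<sigma>] by (simp flip: sum_subtractf sum.distrib)
    then show "coboundary 1 (torus p) (integer_mod_group 2) (parity_cochain p) \<sigma> =
       (\<lambda>\<sigma>\<in>singular_simplex_set 2 (torus p). 0) \<sigma>"
      unfolding coboundary_1_eq[OF \<sigma> parity_cochain_in_carrier]
      using face[of 0] face[of 1] face[of 2] \<sigma>
      by (simp add: parity_cochain_def alternating_sum_mod_2(2) del: One_nat_def)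
  qed (auto simp: coboundary_def numeral_2_eq_2)
  then show ?thesis
    using parity_cochain_in_carrier
    by (simp add: cocycle_set_def kernel_def cochain_group_def numeral_2_eq_2)
qed

lemma straight_loop_singular: "singular_simplex 1 (torus p) (straight_loop p w)"
  unfolding singular_simplex_def
proof
  have "continuous_map (subtopology (powertop_real UNIV) (standard_simplex 1)) (top_of_set (sphere 0 1))
     (\<lambda>t. cis (2 * pi * (t 1 * of_int (w i))))" for i
  proof -
    have "continuous_map (subtopology (powertop_real UNIV) (standard_simplex 1)) euclideanreal (\<lambda>t. t (1::nat))"
      by (intro continuous_map_from_subtopology continuous_map_product_projection) auto
    moreover have "continuous_map euclideanreal (top_of_set (sphere 0 1)) (\<lambda>x. cis (2 * pi * (x * of_int (w i))))"
      by (auto simp: continuous_map_in_subtopology intro!: continuous_intros)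
    ultimately show ?thesis using continuous_map_compose by (fastforce simp: o_def)
  qed
  then have "continuous_map (subtopology (powertop_real UNIV) (standard_simplex 1)) (torus p)
     (\<lambda>t. torus_proj p (vec p (\<lambda>i. t 1 * of_int (w i))))"
    unfolding torus_def continuous_map_componentwise by (auto simp: torus_proj_def cong: restrict_cong)
  then show "continuous_map (subtopology (powertop_real UNIV) (standard_simplex 1)) (torus p) (straight_loop p w)"
    by (rule continuous_map_eq) (simp add: straight_loop_def)
qed (simp add: straight_loop_def)

lemma straight_loop_edge: "s \<in> {0..1} \<Longrightarrow> straight_loop p w (edge s) = torus_proj p (vec p (\<lambda>i. s * of_int (w i)))"
  using edge_in_simplex[of s] by (simp add: straight_loop_def) (simp add: edge_def)

lemma straight_loop_closed: "straight_loop p w (edge 0) = straight_loop p w (edge 1)"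
proof -
  have "cis (2 * pi * of_int n) = 1" for n by (simp add: cis_eq_1_Ints)
  then show ?thesis by (simp add: straight_loop_edge torus_proj_def cong: restrict_cong)
qed

lemma parity_cochain_straight_loop: "parity_cochain p (straight_loop p w) = (\<Sum>i<p. w i) mod 2"
proof -
  have "wind (\<lambda>s. straight_loop p w (edge s) i) = w i" if "i < p" for i
  proof -
    have "wind (\<lambda>s. straight_loop p w (edge s) i) = \<lfloor>1 * real_of_int (w i)\<rfloor> - \<lfloor>0 * real_of_int (w i)\<rfloor>"
      by (rule wind_eq[where g = "\<lambda>s. s * of_int (w i)"])
        (use that in \<open>auto intro!: continuous_intros simp: straight_loop_edge torus_proj_def\<close>)
    then show ?thesis by simp
  qed
  then show ?thesis using straight_loop_singular by (simp add: parity_cochain_def)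
qed

definition parity_class :: "nat \<Rightarrow> (((nat \<Rightarrow> real) \<Rightarrow> (nat \<Rightarrow> complex)) \<Rightarrow> int) set" where
  "parity_class p = coboundary_set 1 (torus p) (integer_mod_group 2)
     #>\<^bsub>cochain_group 1 (torus p) (integer_mod_group 2)\<^esub> parity_cochain p"

lemma coboundary_set_straight_loop:
  "b \<in> coboundary_set 1 (torus p) (integer_mod_group 2) \<Longrightarrow> b (straight_loop p w) = 0"
  by (auto simp: coboundary_0_loop[OF straight_loop_singular straight_loop_closed])

text \<open>Coboundaries vanish on closed loops, so the value on a straight loop depends only on the
  class.\<close>

lemma coset_straight_loop:
  assumes "\<psi> \<in> coboundary_set 1 (torus p) (integer_mod_group 2)
     #>\<^bsub>cochain_group 1 (torus p) (integer_mod_group 2)\<^esub> \<phi>"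
  shows "\<psi> (straight_loop p w) = \<phi> (straight_loop p w) mod 2"
proof -
  obtain b where "b \<in> coboundary_set 1 (torus p) (integer_mod_group 2)"
    "\<psi> = (\<lambda>\<sigma>\<in>singular_simplex_set 1 (torus p). (b \<sigma> + \<phi> \<sigma>) mod 2)"
    using assms unfolding r_coset_def cochain_group_def by auto
  then show ?thesis
    using straight_loop_singular[of p w] coboundary_set_straight_loop[of b p w] by simp
qed

lemma parity_class_in_carrier: "parity_class p \<in> carrier (torus_H1_Z2 p)"
proof -
  have C: "group (cochain_group 1 (torus p) (integer_mod_group 2))"
    unfolding cochain_group_def by (rule product_group) simp
  have "parity_cochain p \<in> carrier (subgroup_generated (cochain_group 1 (torus p) (integer_mod_group 2))
      (cocycle_set 1 (torus p) (integer_mod_group 2)))"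
    using group.subgroup_generated_subset_carrier_subset[OF C, of "cocycle_set 1 (torus p) (integer_mod_group 2)"]
      parity_cochain_cocycle by (auto simp: cocycle_set_def kernel_def)
  then show ?thesis
    unfolding cohomology_group_def FactGroup_def RCOSETS_def parity_class_def r_coset_def
    by (auto simp: subgroup_generated_def simp del: coboundary_set.simps One_nat_def)
qed

lemma zero_coboundary: "(\<lambda>\<sigma>\<in>singular_simplex_set 1 X. 0) \<in> coboundary_set 1 X (integer_mod_group 2)"
proof -
  interpret comm_group "integer_mod_group 2" by simp
  have "coboundary 0 X (integer_mod_group 2) (\<lambda>\<sigma>\<in>singular_simplex_set 0 X. 0) = (\<lambda>\<sigma>\<in>singular_simplex_set 1 X. 0)"
  proof -
    have "singular_simplex 0 X (singular_face 1 k \<sigma>)" if "singular_simplex 1 X \<sigma>" "k \<le> 1" for k \<sigma>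
      using singular_simplex_singular_face[OF that(1) _ that(2)] by simp
    then have "finprod (integer_mod_group 2) (\<lambda>k. (\<lambda>\<sigma>\<in>singular_simplex_set 0 X. 0) (singular_face 1 k \<sigma>)
       [^]\<^bsub>integer_mod_group 2\<^esub> ((-1) ^ k :: int)) {..1} = 0" if "singular_simplex 1 X \<sigma>" for \<sigma>
      using that finprod_one_eqI[of "{..1}"] by (simp add: int_pow_integer_mod_group)
    then show ?thesis by (auto simp: coboundary_def fun_eq_iff)
  qed
  moreover have "(\<lambda>\<sigma>\<in>singular_simplex_set 0 X. 0) \<in> carrier (cochain_group 0 X (integer_mod_group 2))"
    by (simp add: cochain_group_def carrier_integer_mod_group)
  ultimately show ?thesis unfolding One_nat_def coboundary_set.simps by (metis imageI)
qed

text \<open>Adding the zero coboundary in \<open>integer_mod_group 2\<close> reduces all values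
  modulo 2. This exhibits an element of the coset for an arbitrary function, in particular for a
  pulled back cochain.\<close>

lemma coset_zero_mem:
  "(\<lambda>\<sigma>\<in>singular_simplex_set 1 X. \<phi> \<sigma> mod 2) \<in> coboundary_set 1 X (integer_mod_group 2)
     #>\<^bsub>cochain_group 1 X (integer_mod_group 2)\<^esub> \<phi>"
  unfolding r_coset_def using zero_coboundary[of X]
  by (auto simp: cochain_group_def simp del: coboundary_set.simps One_nat_def intro!: bexI[of _ "\<lambda>\<sigma>\<in>singular_simplex_set 1 X. 0"])

lemma parity_class_nontrivial: assumes "1 \<le> p" shows "parity_class p \<noteq> \<one>\<^bsub>torus_H1_Z2 p\<^esub>"
proof
  assume "parity_class p = \<one>\<^bsub>torus_H1_Z2 p\<^esub>"
  then have "parity_class p = coboundary_set 1 (torus p) (integer_mod_group 2)"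
    by (simp add: cohomology_group_def del: coboundary_set.simps One_nat_def)
  then have mem: "(\<lambda>\<sigma>\<in>singular_simplex_set 1 (torus p). parity_cochain p \<sigma> mod 2) \<in> coboundary_set 1 (torus p) (integer_mod_group 2)"
    using coset_zero_mem[where X = "torus p" and \<phi> = "parity_cochain p"] by (simp only: parity_class_def)
  \<comment> \<open>The loop around the first circle factor.\<close>
  define w :: "nat \<Rightarrow> int" where "w = (\<lambda>i. if i = 0 then 1 else 0)"
  have "(\<Sum>i<p. w i) = 1" using assms by (simp add: w_def)
  then show False
    using coboundary_set_straight_loop[OF mem, of w] straight_loop_singular[of p w] by (simp add: parity_cochain_straight_loop)
qed

text \<open>The inverse of \<tau> carries the loop around factor \<open>j\<close> to the straight
  loop whose winding vector is column \<open>j\<close> of \<open>B\<close>. If the class is fixed,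
  its values on the two loops agree, and the first is 1.\<close>

lemma parity_class_stabilizer:
  assumes "torus_H1_action p \<tau> (parity_class p) = parity_class p"
    and "B \<in> carrier_mat p p" "induced_by p B (inv\<^bsub>torus_Aut p\<^esub> \<tau>)" "j < p"
  shows "odd (\<Sum>i<p. B $$ (i, j))"
proof -
  let ?t = "inv\<^bsub>torus_Aut p\<^esub> \<tau>"
  define e :: "nat \<Rightarrow> int" where "e = (\<lambda>i. if i = j then 1 else 0)"
  define b :: "nat \<Rightarrow> int" where "b = (\<lambda>i. B $$ (i, j))"
  define \<phi> where "\<phi> = (\<lambda>\<sigma>\<in>singular_simplex_set 1 (torus p). parity_cochain p \<sigma> mod 2)"
  have "simplex_map 1 ?t (straight_loop p e) = straight_loop p b"
  proof -
    have "?t (torus_proj p (vec p (\<lambda>i. s * of_int (e i)))) = torus_proj p (vec p (\<lambda>i. s * of_int (b i)))" for s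
    proof -
      have "map_mat real_of_int B *\<^sub>v vec p (\<lambda>i. s * of_int (e i)) = vec p (\<lambda>i. s * of_int (b i))"
      proof (rule eq_vecI)
        fix i assume "i < dim_vec (vec p (\<lambda>i. s * of_int (b i)))"
        then have i: "i < p" by simp
        have "(map_mat real_of_int B *\<^sub>v vec p (\<lambda>i. s * of_int (e i))) $ i
           = (\<Sum>l<p. of_int (B $$ (i, l)) * (s * of_int (e l)))"
          using assms(2) i by (simp add: scalar_prod_def lessThan_atLeast0)
        also have "\<dots> = (\<Sum>l<p. if l = j then s * of_int (B $$ (i, j)) else 0)"
          by (rule sum.cong) (auto simp: e_def)
        also have "\<dots> = s * of_int (b i)" using assms(4) by (simp add: b_def)
        finally show "(map_mat real_of_int B *\<^sub>v vec p (\<lambda>i. s * of_int (e i))) $ i = vec p (\<lambda>i. s * of_int (b i)) $ i"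
          using i by simp
      qed (use assms(2) in simp)
      then show ?thesis using assms(3) by (simp add: induced_by_def)
    qed
    then show ?thesis by (auto simp: simplex_map_def straight_loop_def restrict_def fun_eq_iff)
  qed
  have \<phi>: "\<phi> \<in> parity_class p" unfolding \<phi>_def parity_class_def by (rule coset_zero_mem)
  define \<psi> where "\<psi> = (\<lambda>\<sigma>\<in>singular_simplex_set 1 (torus p). cochain_pullback 1 (torus p) ?t \<phi> \<sigma> mod 2)"
  have "\<psi> \<in> coboundary_set 1 (torus p) (integer_mod_group 2)
     #>\<^bsub>cochain_group 1 (torus p) (integer_mod_group 2)\<^esub> cochain_pullback 1 (torus p) ?t \<phi>"
    unfolding \<psi>_def by (rule coset_zero_mem)
  then have "\<psi> \<in> torus_H1_action p \<tau> (parity_class p)"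
    unfolding torus_H1_action_def cohomology_pullback_def using \<phi> parity_class_in_carrier by auto
  then have "\<psi> \<in> parity_class p" by (simp only: assms(1))
  then have "\<psi> (straight_loop p e) = parity_cochain p (straight_loop p e) mod 2"
    unfolding parity_class_def by (rule coset_straight_loop)
  also have "\<dots> = 1" using assms(4) by (simp add: parity_cochain_straight_loop e_def)
  finally have "parity_cochain p (straight_loop p b) mod 2 = 1"
    using \<open>simplex_map 1 ?t _ = _\<close> straight_loop_singular[of p e] straight_loop_singular[of p b]
    by (simp add: \<psi>_def \<phi>_def cochain_pullback_def)
  then show ?thesis by (simp add: parity_cochain_straight_loop b_def odd_iff_mod_2_eq_one)
qed

section \<open>Extendable automorphisms\<close>

text \<open>Spinning a map without parameter acts alike on every slice and merely adds a fixed
  angle.\<close>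

lemma (in frame) extends_mono:
  assumes "extends q (\<lambda>_. T)" "q \<le> q'" "q' \<le> p" "\<And>\<theta> i. q \<le> i \<Longrightarrow> T \<theta> i = \<theta> i"
  shows "extends q' (\<lambda>_. T)"
  using assms(2,3)
proof (induction q' rule: dec_induct)
  case base show ?case by (rule assms(1))
next
  case (step n)
  have "extends (Suc n) (\<lambda>_ \<theta>. (T \<theta>)(n := \<theta> n))"
    using extends_spin[of n "\<lambda>_. T"] step by simp
  then show ?case by (rule extends_cong) (use assms(4) step in auto)
qed

lemma (in frame) torus_moves_extends:
  assumes "1 \<le> p" shows "torus_moves p (\<lambda>T. extends p (\<lambda>_. T))"
proof
  fix T U
  assume "extends p (\<lambda>_. T)" "extends p (\<lambda>_. U)"
  then show "extends p (\<lambda>_ \<theta>. T (U \<theta>))" by (rule extends_compose)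
next
  fix T U :: "(nat \<Rightarrow> real) \<Rightarrow> nat \<Rightarrow> real"
  assume "extends p (\<lambda>_. T)" "\<And>\<theta> i. i < p \<Longrightarrow> T \<theta> i = U \<theta> i"
  then show "extends p (\<lambda>_. U)" by (rule extends_cong)
next
  have "extends 1 (\<lambda>_ \<theta>. \<theta>(0 := - \<theta> 0))"
    using extends_const[OF extends_circle_flip[OF assms], of 0] by simp
  then show "extends p (\<lambda>_ \<theta>. \<theta>(0 := - \<theta> 0))"
    by (rule extends_mono) (use assms in auto)
next
  assume p: "1 < p"
  have "extends (Suc 1) (\<lambda>_ \<theta>. (\<theta>(0 := 2 * \<theta> 1 - \<theta> 0))(1 := \<theta> 1))"
    by (rule extends_spin[OF p extends_circle_flip[OF assms]])
  then have "extends (Suc 1) (\<lambda>_ \<theta>. \<theta>(0 := 2 * \<theta> 1 - \<theta> 0))" by (rule extends_cong) (auto simp: less_Suc_eq One_nat_def)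
  then show "extends p (\<lambda>_ \<theta>. \<theta>(0 := 2 * \<theta> 1 - \<theta> 0))"
    by (rule extends_mono) (use p in auto)
next
  fix k assume k: "Suc k < p"
  have "extends (Suc (Suc k)) (\<lambda>_ \<theta>. \<theta>(k := - \<theta> (Suc k), Suc k := - \<theta> k))"
    using extends_const[OF extends_torus_swap[of k], of 0] k by simp
  then show "extends p (\<lambda>_ \<theta>. \<theta>(k := - \<theta> (Suc k), Suc k := - \<theta> k))"
    by (rule extends_mono) (use k in auto)
next
  assume p: "2 < p"
  have "extends (Suc (Suc 0)) (\<lambda>\<phi> \<theta>. \<theta>(0 := \<phi> - \<theta> (Suc 0), Suc 0 := \<phi> - \<theta> 0))"
    by (rule extends_torus_swap) (use p in simp)
  then have "extends (Suc (Suc (Suc 0))) (\<lambda>_ \<theta>. (\<theta>(0 := \<theta> (Suc (Suc 0)) - \<theta> (Suc 0), Suc 0 := \<theta> (Suc (Suc 0)) - \<theta> 0))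
      (Suc (Suc 0) := \<theta> (Suc (Suc 0))))"
    by (intro extends_spin[of "Suc (Suc 0)" "\<lambda>\<phi> \<theta>. \<theta>(0 := \<phi> - \<theta> (Suc 0), Suc 0 := \<phi> - \<theta> 0)"]) (use p in simp_all)
  then have "extends (Suc (Suc (Suc 0))) (\<lambda>_ \<theta>. \<theta>(0 := \<theta> 2 - \<theta> 1, 1 := \<theta> 2 - \<theta> 0))"
    by (rule extends_cong) (auto simp: numeral_2_eq_2 One_nat_def less_Suc_eq)
  then show "extends p (\<lambda>_ \<theta>. \<theta>(0 := \<theta> 2 - \<theta> 1, 1 := \<theta> 2 - \<theta> 0))"
    by (rule extends_mono) (use p in auto)
qed

section \<open>Linear automorphisms of the torus and their group\<close>

lemma torus_proj_in_torus: "torus_proj p x \<in> topspace (torus p)"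
  by (auto simp: topspace_torus torus_proj_def)

lemma torus_proj_surj:
  assumes "v \<in> topspace (torus p)" obtains x where "x \<in> carrier_vec p" "v = torus_proj p x"
proof
  show "vec p (\<lambda>i. Arg (v i) / (2 * pi)) \<in> carrier_vec p" by simp
  have "cis (Arg (v i)) = v i" if "i < p" for i
  proof -
    have "cmod (v i) = 1" using assms that by (simp add: topspace_torus PiE_iff)
    then have "v i \<noteq> 0" "sgn (v i) = v i" by (auto simp: sgn_div_norm)
    then show ?thesis by (simp add: cis_Arg)
  qed
  then show "v = torus_proj p (vec p (\<lambda>i. Arg (v i) / (2 * pi)))"
    using assms by (auto simp: torus_proj_def topspace_torus PiE_iff extensional_def fun_eq_iff)
qed

lemma SL_int_inverse:
  assumes "A \<in> SL_int p" obtains B where "B \<in> SL_int p" "A * B = 1\<^sub>m p" "B * A = 1\<^sub>m p"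
proof
  have A: "A \<in> carrier_mat p p" "Determinant.det A = 1" using assms by (auto simp: SL_int_def)
  have "(1::int) \<cdot>\<^sub>m 1\<^sub>m p = 1\<^sub>m p" by (rule eq_matI) auto
  then show AB: "A * adj_mat A = 1\<^sub>m p" and "adj_mat A * A = 1\<^sub>m p"
    using adj_mat(2,3)[OF A(1)] A(2) by simp_all
  have "Determinant.det A * Determinant.det (adj_mat A) = 1"
    using arg_cong[OF AB, of Determinant.det] det_mult[OF A(1) adj_mat(1)[OF A(1)]] by simp
  then show "adj_mat A \<in> SL_int p" using A adj_mat(1)[OF A(1)] by (simp add: SL_int_def)
qed

lemma int_mat_vec_carrier:
  assumes "A \<in> carrier_mat p p" shows "map_mat real_of_int A *\<^sub>v x \<in> carrier_vec p"
  by (rule carrier_vecI) (simp add: carrier_matD(1)[OF assms])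

lemma induced_by_mult:
  assumes "A \<in> carrier_mat p p" "B \<in> carrier_mat p p" "induced_by p A \<sigma>" "induced_by p B \<tau>"
  shows "induced_by p (A * B) (compose (topspace (torus p)) \<sigma> \<tau>)"
  unfolding induced_by_def
proof
  fix x :: "real vec" assume x: "x \<in> carrier_vec p"
  have Bx: "map_mat real_of_int B *\<^sub>v x \<in> carrier_vec p" by (rule int_mat_vec_carrier[OF assms(2)])
  have "compose (topspace (torus p)) \<sigma> \<tau> (torus_proj p x) = torus_proj p (map_mat real_of_int A *\<^sub>v (map_mat real_of_int B *\<^sub>v x))"
    using assms(3,4) x Bx torus_proj_in_torus by (simp add: compose_def induced_by_def)
  also have "map_mat real_of_int A *\<^sub>v (map_mat real_of_int B *\<^sub>v x) = map_mat real_of_int (A * B) *\<^sub>v x"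
    using assms(1,2) x by (simp add: of_int_hom.mat_hom_mult[OF assms(1,2)] assoc_mult_mat_vec[of _ p p _ p])
  finally show "compose (topspace (torus p)) \<sigma> \<tau> (torus_proj p x) = torus_proj p (map_mat real_of_int (A * B) *\<^sub>v x)" .
qed

lemma induced_by_one: "induced_by p (1\<^sub>m p) (\<lambda>v\<in>topspace (torus p). v)"
  using torus_proj_in_torus by (simp add: induced_by_def of_int_hom.mat_hom_one)

lemma induced_by_inverse:
  assumes "A \<in> carrier_mat p p" "B \<in> carrier_mat p p" "A * B = 1\<^sub>m p" "induced_by p A \<tau>"
    and "\<And>v. v \<in> topspace (torus p) \<Longrightarrow> \<tau>' (\<tau> v) = v"
  shows "induced_by p B \<tau>'"
  unfolding induced_by_def
proof
  fix x :: "real vec" assume x: "x \<in> carrier_vec p"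
  let ?y = "map_mat real_of_int B *\<^sub>v x"
  have "\<tau> (torus_proj p ?y) = torus_proj p (map_mat real_of_int A *\<^sub>v ?y)"
    using int_mat_vec_carrier[OF assms(2)] assms(4) by (simp add: induced_by_def)
  also have "map_mat real_of_int A *\<^sub>v ?y = map_mat real_of_int (A * B) *\<^sub>v x"
    using assms(1,2) x by (simp add: of_int_hom.mat_hom_mult[OF assms(1,2)] assoc_mult_mat_vec[of _ p p _ p])
  also have "\<dots> = x" using x by (simp add: assms(3) of_int_hom.mat_hom_one)
  finally show "\<tau>' (torus_proj p x) = torus_proj p ?y"
    using assms(5)[OF torus_proj_in_torus, of ?y] by simp
qed

lemma torus_Aut_carrier:
  "\<tau> \<in> carrier (torus_Aut p) \<longleftrightarrow> \<tau> \<in> Bij (topspace (torus p)) \<and> (\<exists>A \<in> SL_int p. induced_by p A \<tau>)"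
  by (simp add: torus_Aut_def)

lemma torus_Aut_mult:
  "\<sigma> \<in> carrier (torus_Aut p) \<Longrightarrow> \<tau> \<in> carrier (torus_Aut p) \<Longrightarrow>
     \<sigma> \<otimes>\<^bsub>torus_Aut p\<^esub> \<tau> = compose (topspace (torus p)) \<sigma> \<tau>"
  by (simp add: torus_Aut_def BijGroup_def)

lemma torus_Aut_one: "\<one>\<^bsub>torus_Aut p\<^esub> = (\<lambda>v\<in>topspace (torus p). v)"
  by (simp add: torus_Aut_def BijGroup_def)

lemma group_torus_Aut: "group (torus_Aut p)"
proof -
  let ?S = "topspace (torus p)"
  let ?H = "{\<tau> \<in> Bij ?S. \<exists>A \<in> SL_int p. induced_by p A \<tau>}"
  interpret Bij: group "BijGroup ?S" by (rule group_BijGroup)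
  have carrier: "carrier (BijGroup ?S) = Bij ?S" and one: "\<one>\<^bsub>BijGroup ?S\<^esub> = (\<lambda>v\<in>?S. v)"
    and mult: "\<And>\<sigma> \<tau>. \<sigma> \<in> Bij ?S \<Longrightarrow> \<tau> \<in> Bij ?S \<Longrightarrow> \<sigma> \<otimes>\<^bsub>BijGroup ?S\<^esub> \<tau> = compose ?S \<sigma> \<tau>"
    by (simp_all add: BijGroup_def)
  have "subgroup ?H (BijGroup ?S)"
  proof (rule Bij.subgroupI)
    show "?H \<subseteq> carrier (BijGroup ?S)" by (auto simp: carrier)
    have "1\<^sub>m p \<in> SL_int p" by (simp add: SL_int_def)
    then have "(\<lambda>v\<in>?S. v) \<in> ?H" using induced_by_one id_Bij by blast
    then show "?H \<noteq> {}" by blast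
  next
    fix \<tau> assume "\<tau> \<in> ?H"
    then obtain A where \<tau>: "\<tau> \<in> Bij ?S" and A: "A \<in> SL_int p" "induced_by p A \<tau>" by blast
    obtain B where B: "B \<in> SL_int p" "A * B = 1\<^sub>m p" using SL_int_inverse[OF A(1)] by blast
    have inv: "inv\<^bsub>BijGroup ?S\<^esub> \<tau> \<in> Bij ?S" using Bij.inv_closed[of \<tau>] \<tau> by (simp add: carrier)
    have "compose ?S (inv\<^bsub>BijGroup ?S\<^esub> \<tau>) \<tau> = (\<lambda>v\<in>?S. v)"
      using Bij.l_inv[of \<tau>] mult[OF inv \<tau>] \<tau> by (simp add: carrier one)
    then have "(inv\<^bsub>BijGroup ?S\<^esub> \<tau>) (\<tau> v) = v" if "v \<in> ?S" for v
      using that by (metis compose_eq restrict_apply')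
    then have "induced_by p B (inv\<^bsub>BijGroup ?S\<^esub> \<tau>)"
      using induced_by_inverse[of A p B \<tau>] A B by (auto simp: SL_int_def)
    then show "inv\<^bsub>BijGroup ?S\<^esub> \<tau> \<in> ?H" using inv B(1) by blast
  next
    fix \<sigma> \<tau> assume "\<sigma> \<in> ?H" "\<tau> \<in> ?H"
    then obtain A B where \<sigma>: "\<sigma> \<in> Bij ?S" "A \<in> SL_int p" "induced_by p A \<sigma>"
      and \<tau>: "\<tau> \<in> Bij ?S" "B \<in> SL_int p" "induced_by p B \<tau>" by blast
    have "A * B \<in> SL_int p" using \<sigma>(2) \<tau>(2) by (auto simp: SL_int_def det_mult)
    moreover have "induced_by p (A * B) (compose ?S \<sigma> \<tau>)"
      using \<sigma> \<tau> by (intro induced_by_mult) (auto simp: SL_int_def)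
    ultimately show "\<sigma> \<otimes>\<^bsub>BijGroup ?S\<^esub> \<tau> \<in> ?H"
      using mult[OF \<sigma>(1) \<tau>(1)] compose_Bij[OF \<sigma>(1) \<tau>(1)] by auto
  qed
  then show ?thesis
    unfolding torus_Aut_def by (rule subgroup.subgroup_is_group) (rule group_BijGroup)
qed

lemma torus_Aut_closed: "\<tau> \<in> carrier (torus_Aut p) \<Longrightarrow> v \<in> topspace (torus p) \<Longrightarrow> \<tau> v \<in> topspace (torus p)"
  using Bij_imp_funcset by (auto simp: torus_Aut_carrier)

lemma torus_Aut_inv:
  assumes "\<tau> \<in> carrier (torus_Aut p)" "v \<in> topspace (torus p)"
  shows "(inv\<^bsub>torus_Aut p\<^esub> \<tau>) (\<tau> v) = v" "\<tau> ((inv\<^bsub>torus_Aut p\<^esub> \<tau>) v) = v"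
proof -
  interpret group "torus_Aut p" by (rule group_torus_Aut)
  have inv: "inv\<^bsub>torus_Aut p\<^esub> \<tau> \<in> carrier (torus_Aut p)" using assms(1) by simp
  have "compose (topspace (torus p)) (inv\<^bsub>torus_Aut p\<^esub> \<tau>) \<tau> = (\<lambda>v\<in>topspace (torus p). v)"
    "compose (topspace (torus p)) \<tau> (inv\<^bsub>torus_Aut p\<^esub> \<tau>) = (\<lambda>v\<in>topspace (torus p). v)"
    using l_inv[OF assms(1)] r_inv[OF assms(1)] inv assms(1) by (simp_all add: torus_Aut_mult torus_Aut_one)
  then show "(inv\<^bsub>torus_Aut p\<^esub> \<tau>) (\<tau> v) = v" "\<tau> ((inv\<^bsub>torus_Aut p\<^esub> \<tau>) v) = v"
    using assms(2) by (metis compose_eq restrict_apply')+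
qed

section \<open>The extendable automorphisms form a subgroup\<close>

lemma self_diffeomorphism_compose:
  fixes f g :: "'a::euclidean_space \<Rightarrow> 'a"
  assumes "self_diffeomorphism f" "self_diffeomorphism g" shows "self_diffeomorphism (\<lambda>x. f (g x))"
proof -
  have b: "bij f" "bij g" using assms by (auto simp: self_diffeomorphism_def)
  have "inv_into UNIV (\<lambda>x. f (g x)) = (\<lambda>x. inv_into UNIV g (inv_into UNIV f x))"
    using o_inv_distrib[OF b] by (simp add: o_def)
  moreover have "bij (\<lambda>x. f (g x))" using bij_comp[OF b(2,1)] by (simp add: o_def)
  ultimately show ?thesis
    using assms unfolding self_diffeomorphism_def smooth_map_iff_smooth_on
    by (auto intro: smooth_on_compose[of UNIV f UNIV g] smooth_on_compose[of UNIV "inv_into UNIV g" UNIV "inv_into UNIV f"])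
qed

lemma self_diffeomorphism_inv:
  assumes "self_diffeomorphism f" shows "self_diffeomorphism (inv_into UNIV f)"
  using assms inv_inv_eq[of f] bij_imp_bij_inv[of f] by (simp add: self_diffeomorphism_def)

lemma self_diffeomorphism_id: "self_diffeomorphism (\<lambda>x::'a::euclidean_space. x)"
proof -
  have "inv_into UNIV (\<lambda>x::'a. x) = (\<lambda>x. x)" using inv_id by (simp add: id_def)
  then show ?thesis
    using bij_id smooth_on_id[of "UNIV :: 'a set"]
    by (simp add: self_diffeomorphism_def smooth_map_iff_smooth_on id_def)
qed

lemma compactly_supported_compose:
  assumes "compactly_supported f" "compactly_supported g" shows "compactly_supported (\<lambda>x. f (g x))"
proof -
  obtain K L where "compact K" "\<And>x. x \<notin> K \<Longrightarrow> f x = x" "compact L" "\<And>x. x \<notin> L \<Longrightarrow> g x = x"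
    using assms by (auto simp: compactly_supported_def)
  then show ?thesis unfolding compactly_supported_def by (intro exI[of _ "K \<union> L"]) auto
qed

lemma compactly_supported_inv:
  assumes "bij f" "compactly_supported f" shows "compactly_supported (inv_into UNIV f)"
  using assms unfolding compactly_supported_def by (metis bij_inv_eq_iff)

lemma subgroup_extendable_Aut:
  fixes \<iota> :: "(nat \<Rightarrow> complex) \<Rightarrow> 'a::euclidean_space"
  shows "subgroup (extendable_Aut p \<iota>) (torus_Aut p)"
proof -
  interpret group "torus_Aut p" by (rule group_torus_Aut)
  show ?thesis
  proof (rule subgroupI)
    show "extendable_Aut p \<iota> \<subseteq> carrier (torus_Aut p)" by (auto simp: extendable_Aut_def)
    have "\<one>\<^bsub>torus_Aut p\<^esub> \<in> extendable_Aut p \<iota>"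
    proof -
      have "\<forall>v\<in>topspace (torus p). \<iota> v = \<iota> (\<one>\<^bsub>torus_Aut p\<^esub> v)" by (simp add: torus_Aut_one)
      moreover have "compactly_supported (\<lambda>x::'a. x)" by (auto simp: compactly_supported_def)
      ultimately show ?thesis
        unfolding extendable_Aut_def using one_closed self_diffeomorphism_id by blast
    qed
    then show "extendable_Aut p \<iota> \<noteq> {}" by blast
  next
    fix \<tau> assume "\<tau> \<in> extendable_Aut p \<iota>"
    then obtain f where \<tau>: "\<tau> \<in> carrier (torus_Aut p)" and f: "self_diffeomorphism f" "compactly_supported f"
      "\<And>v. v \<in> topspace (torus p) \<Longrightarrow> f (\<iota> v) = \<iota> (\<tau> v)" by (auto simp: extendable_Aut_def)
    have bij: "bij f" using f(1) by (simp add: self_diffeomorphism_def)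
    have inv: "inv\<^bsub>torus_Aut p\<^esub> \<tau> \<in> carrier (torus_Aut p)" using \<tau> by simp
    have "inv_into UNIV f (\<iota> v) = \<iota> ((inv\<^bsub>torus_Aut p\<^esub> \<tau>) v)" if "v \<in> topspace (torus p)" for v
      using f(3)[OF torus_Aut_closed[OF inv that]] torus_Aut_inv(2)[OF \<tau> that] bij by (metis bij_inv_eq_iff)
    then show "inv\<^bsub>torus_Aut p\<^esub> \<tau> \<in> extendable_Aut p \<iota>"
      unfolding extendable_Aut_def
      using inv self_diffeomorphism_inv[OF f(1)] compactly_supported_inv[OF bij f(2)] by blast
  next
    fix \<sigma> \<tau> assume "\<sigma> \<in> extendable_Aut p \<iota>" "\<tau> \<in> extendable_Aut p \<iota>"
    then obtain f g where \<sigma>: "\<sigma> \<in> carrier (torus_Aut p)" and f: "self_diffeomorphism f" "compactly_supported f"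
      "\<And>v. v \<in> topspace (torus p) \<Longrightarrow> f (\<iota> v) = \<iota> (\<sigma> v)"
      and \<tau>: "\<tau> \<in> carrier (torus_Aut p)" and g: "self_diffeomorphism g" "compactly_supported g"
      "\<And>v. v \<in> topspace (torus p) \<Longrightarrow> g (\<iota> v) = \<iota> (\<tau> v)" by (auto simp: extendable_Aut_def)
    have "f (g (\<iota> v)) = \<iota> ((\<sigma> \<otimes>\<^bsub>torus_Aut p\<^esub> \<tau>) v)" if "v \<in> topspace (torus p)" for v
      using f(3)[OF torus_Aut_closed[OF \<tau> that]] g(3)[OF that] that by (simp add: torus_Aut_mult[OF \<sigma> \<tau>] compose_eq)
    then show "\<sigma> \<otimes>\<^bsub>torus_Aut p\<^esub> \<tau> \<in> extendable_Aut p \<iota>"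
      unfolding extendable_Aut_def
      using m_closed[OF \<sigma> \<tau>] self_diffeomorphism_compose[OF f(1) g(1)] compactly_supported_compose[OF f(2) g(2)] by blast
  qed
qed

section \<open>Column sums modulo 2 and the bound on the index\<close>

definition column_sum :: "nat \<Rightarrow> int mat \<Rightarrow> nat \<Rightarrow> int" where
  "column_sum p A j = (\<Sum>i<p. A $$ (i, j))"

lemma mat_mult_index:
  "A \<in> carrier_mat p p \<Longrightarrow> B \<in> carrier_mat p p \<Longrightarrow> i < p \<Longrightarrow> l < p \<Longrightarrow>
     (A * B) $$ (i, l) = (\<Sum>j<p. A $$ (i, j) * B $$ (j, l))"
  by (simp add: scalar_prod_def lessThan_atLeast0)

lemma column_sum_mult:
  assumes "A \<in> carrier_mat p p" "B \<in> carrier_mat p p" "l < p"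
  shows "column_sum p (A * B) l = (\<Sum>j<p. column_sum p A j * B $$ (j, l))"
proof -
  have "column_sum p (A * B) l = (\<Sum>i<p. \<Sum>j<p. A $$ (i, j) * B $$ (j, l))"
    unfolding column_sum_def by (rule sum.cong) (use assms in \<open>auto simp: mat_mult_index simp del: index_mult_mat\<close>)
  also have "\<dots> = (\<Sum>j<p. \<Sum>i<p. A $$ (i, j) * B $$ (j, l))" by (rule sum.swap)
  finally show ?thesis by (simp add: column_sum_def sum_distrib_right)
qed

lemma column_sum_one: "l < p \<Longrightarrow> column_sum p (1\<^sub>m p) l = 1"
  by (simp add: column_sum_def sum.delta cong: if_cong)

text \<open>The column sums are the entries of the row vector (1, ..., 1) A, so modulo 2 those of
  \<open>A * B\<close> depend on \<open>A\<close> only through its own column sums modulo 2.\<close>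

lemma column_sum_mult_parity:
  assumes "A \<in> carrier_mat p p" "A' \<in> carrier_mat p p" "B \<in> carrier_mat p p" "l < p"
    and "\<And>j. j < p \<Longrightarrow> odd (column_sum p A j) \<longleftrightarrow> odd (column_sum p A' j)"
  shows "odd (column_sum p (A * B) l) \<longleftrightarrow> odd (column_sum p (A' * B) l)"
proof -
  have "even (\<Sum>j<p. (column_sum p A j - column_sum p A' j) * B $$ (j, l))"
    by (rule dvd_sum) (use assms(5) in auto)
  then show ?thesis
    using assms by (simp add: column_sum_mult left_diff_distrib sum_subtractf)
qed

text \<open>The integral left inverse recovers \<open>x\<close> from its image, so divisibility of
  the image passes to \<open>x\<close>.\<close>

lemma (in torus_moves) primitive_mat:
  assumes "A \<in> carrier_mat p p" "B \<in> carrier_mat p p" "B * A = 1\<^sub>m p"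
  shows "primitive (\<lambda>i j. A $$ (i, j))"
  unfolding primitive_def
proof (intro allI impI)
  fix d x l assume d: "\<forall>i<p. d dvd (\<Sum>j<p. A $$ (i, j) * x j)" and l: "l < (p::nat)"
  have "(\<Sum>i<p. B $$ (l, i) * (\<Sum>j<p. A $$ (i, j) * x j)) = (\<Sum>i<p. \<Sum>j<p. B $$ (l, i) * A $$ (i, j) * x j)"
    by (simp add: sum_distrib_left mult.assoc)
  also have "\<dots> = (\<Sum>j<p. (\<Sum>i<p. B $$ (l, i) * A $$ (i, j)) * x j)"
    unfolding sum_distrib_right by (rule sum.swap)
  also have "\<dots> = (\<Sum>j<p. (1\<^sub>m p) $$ (l, j) * x j)"
    by (rule sum.cong) (use assms l in \<open>auto simp: mat_mult_index simp flip: assms(3) simp del: index_mult_mat index_one_mat\<close>)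
  also have "\<dots> = (\<Sum>j<p. if j = l then x l else 0)" by (rule sum.cong) (use l in auto)
  also have "\<dots> = x l" using l by simp
  finally show "d dvd x l" using d by (metis (no_types, lifting) dvd_mult dvd_sum lessThan_iff)
qed

text \<open>Algebra and geometry meet here: \<open>G_lin\<close>, read with \<open>G\<close> as
  extendability, yields a family, and freezing its parameter at 1 gives the diffeomorphism. For
  \<open>q = p\<close> the function \<open>sqnorm\<close> is the full squared norm, so the support
  lies in the ball of radius 2.\<close>

lemma (in frame) extendable_if_odd_columns:
  assumes "1 \<le> p" "\<tau> \<in> carrier (torus_Aut p)" "A \<in> SL_int p" "induced_by p A \<tau>"
    and "\<And>j. j < p \<Longrightarrow> odd (column_sum p A j)"
  shows "\<tau> \<in> extendable_Aut p (std_embedding \<epsilon> p)"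
proof -
  interpret torus_moves p "\<lambda>T. extends p (\<lambda>_. T)" by (rule torus_moves_extends[OF assms(1)])
  obtain B where B: "B \<in> SL_int p" "B * A = 1\<^sub>m p" using SL_int_inverse[OF assms(3)] by blast
  have A: "A \<in> carrier_mat p p" using assms(3) by (simp add: SL_int_def)
  have "extends p (\<lambda>_. lin (\<lambda>i j. A $$ (i, j)))"
  proof (rule G_lin)
    show "primitive (\<lambda>i j. A $$ (i, j))" using primitive_mat[OF A _ B(2)] B(1) by (simp add: SL_int_def)
    show "odd_columns (\<lambda>i j. A $$ (i, j))" using assms(5) by (simp add: odd_columns_def column_sum_def)
  qed (use assms(1) in simp)
  then obtain H H' where H: "family p H H'" "family p H' H"
    "\<And>\<phi> \<theta>. H (cis \<phi>) (torus_pt p \<theta>) = torus_pt p (lin (\<lambda>i j. A $$ (i, j)) \<theta>)"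
    unfolding extends_def by blast
  have fam: "H' 1 (H 1 x) = x" "H 1 (H' 1 x) = x" "sqnorm p x \<ge> 3 \<Longrightarrow> H 1 x = x" for x
    using H(1,2) unfolding family_def by (metis norm_one)+
  have bij: "bij (H 1)" by (rule bij_betw_byWitness[where f' = "H' 1"]) (auto simp: fam)
  have inv: "inv_into UNIV (H 1) = H' 1" by (rule inv_equality) (auto simp: fam)
  have "smooth_on UNIV (\<lambda>z. H (fst z) (snd z))" "smooth_on UNIV (\<lambda>z. H' (fst z) (snd z))"
    using H(1,2) by (simp_all add: family_def)
  from this[THEN smooth_on_uncurry[OF _ open_UNIV smooth_on_const smooth_on_id]]
  have "smooth_on UNIV (H 1)" "smooth_on UNIV (H' 1)" by blast+
  then have "self_diffeomorphism (H 1)"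
    using bij by (simp add: self_diffeomorphism_def smooth_map_iff_smooth_on inv)
  moreover have "compactly_supported (H 1)"
    unfolding compactly_supported_def
  proof (intro exI[of _ "cball 0 2"] conjI allI impI fam(3) compact_cball)
    fix x :: 'a assume "x \<notin> cball 0 2"
    then have "2\<^sup>2 \<le> (norm x)\<^sup>2" by (intro power_mono) auto
    moreover have "sqnorm p x = x \<bullet> x" unfolding sqnorm_def by (rule inner_frame[symmetric])
    ultimately show "3 \<le> sqnorm p x" by (simp add: power2_norm_eq_inner)
  qed
  moreover have "H 1 (std_embedding \<epsilon> p v) = std_embedding \<epsilon> p (\<tau> v)" if v: "v \<in> topspace (torus p)" for v
  proof -
    obtain x where x: "x \<in> carrier_vec p" "v = torus_proj p x" using torus_proj_surj[OF v] .
    have pt: "std_embedding \<epsilon> p (torus_proj p y) = torus_pt p (\<lambda>i. 2 * pi * y $ i)" for y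
      by (simp add: torus_pt_def torus_proj_def)
    have "H 1 (std_embedding \<epsilon> p v) = torus_pt p (lin (\<lambda>i j. A $$ (i, j)) (\<lambda>i. 2 * pi * x $ i))"
      using H(3)[of 0] by (simp add: x(2) pt)
    also have "\<dots> = torus_pt p (\<lambda>i. 2 * pi * (map_mat real_of_int A *\<^sub>v x) $ i)"
    proof (rule torus_pt_cong)
      fix i assume i: "i < p"
      have "(map_mat real_of_int A *\<^sub>v x) $ i = (\<Sum>j<p. of_int (A $$ (i, j)) * x $ j)"
        using A x(1) i by (simp add: scalar_prod_def lessThan_atLeast0)
      then show "lin (\<lambda>i j. A $$ (i, j)) (\<lambda>i. 2 * pi * x $ i) i = 2 * pi * (map_mat real_of_int A *\<^sub>v x) $ i"
        by (simp add: lin_def sum_distrib_left mult_ac)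
    qed
    also have "\<dots> = std_embedding \<epsilon> p (\<tau> v)" using assms(4) x by (simp add: pt[symmetric] induced_by_def)
    finally show ?thesis .
  qed
  ultimately show ?thesis using assms(2) unfolding extendable_Aut_def by blast
qed

text \<open>On \<open>C\<close> the function \<open>f\<close> factors through
  \<open>g\<close>.\<close>

lemma card_image_le_card_image:
  assumes "finite (g ` C)" "\<And>a b. a \<in> C \<Longrightarrow> b \<in> C \<Longrightarrow> g a = g b \<Longrightarrow> f a = f b"
  shows "finite (f ` C)" "card (f ` C) \<le> card (g ` C)"
proof -
  have "f ` C \<subseteq> (\<lambda>s. f (SOME a. a \<in> C \<and> g a = s)) ` g ` C"
  proof
    fix y assume "y \<in> f ` C"
    then obtain a where a: "a \<in> C" "y = f a" by blast
    have "(SOME b. b \<in> C \<and> g b = g a) \<in> C \<and> g (SOME b. b \<in> C \<and> g b = g a) = g a"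
      by (rule someI[of _ a]) (use a in simp)
    then have "y = f (SOME b. b \<in> C \<and> g b = g a)" using assms(2) a by metis
    then show "y \<in> (\<lambda>s. f (SOME a. a \<in> C \<and> g a = s)) ` g ` C" using a(1) by blast
  qed
  then show "finite (f ` C)" "card (f ` C) \<le> card (g ` C)"
    using finite_subset[OF _ finite_imageI[OF assms(1)]]
      order_trans[OF card_mono[OF finite_imageI[OF assms(1)]] card_image_le[OF assms(1)]] by blast+
qed

theorem theorem1p5:
  fixes p :: nat and \<epsilon> :: "nat \<Rightarrow> 'a::euclidean_space"
  assumes "p \<ge> 1"
    and "bij_betw \<epsilon> {1..p+2} (Basis :: 'a set)"
  shows "subgroup (extendable_Aut p (std_embedding \<epsilon> p)) (torus_Aut p) \<and>
    (\<exists>c \<in> carrier (torus_H1_Z2 p). c \<noteq> \<one>\<^bsub>torus_H1_Z2 p\<^esub> \<and>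
       stabilizer (torus_Aut p) (torus_H1_action p) c \<subseteq> extendable_Aut p (std_embedding \<epsilon> p)) \<and>
    finite (rcosets\<^bsub>torus_Aut p\<^esub> (extendable_Aut p (std_embedding \<epsilon> p))) \<and>
    card (rcosets\<^bsub>torus_Aut p\<^esub> (extendable_Aut p (std_embedding \<epsilon> p))) \<le> 2 ^ p - 1"
proof -
  interpret frame \<epsilon> p by unfold_locales (rule assms(2))
  interpret group "torus_Aut p" by (rule group_torus_Aut)
  let ?E = "extendable_Aut p (std_embedding \<epsilon> p)"
  have sub: "subgroup ?E (torus_Aut p)" by (rule subgroup_extendable_Aut)
  have stab: "stabilizer (torus_Aut p) (torus_H1_action p) (parity_class p) \<subseteq> ?E"
  proof
    fix \<tau> assume "\<tau> \<in> stabilizer (torus_Aut p) (torus_H1_action p) (parity_class p)"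
    then have \<tau>: "\<tau> \<in> carrier (torus_Aut p)" and fixed: "torus_H1_action p \<tau> (parity_class p) = parity_class p"
      by (simp_all add: stabilizer_def)
    obtain A where A: "A \<in> SL_int p" "induced_by p A \<tau>" using \<tau> by (auto simp: torus_Aut_carrier)
    obtain B where B: "B \<in> SL_int p" "A * B = 1\<^sub>m p" "B * A = 1\<^sub>m p" using SL_int_inverse[OF A(1)] .
    have c: "A \<in> carrier_mat p p" "B \<in> carrier_mat p p" using A B by (auto simp: SL_int_def)
    have "induced_by p B (inv\<^bsub>torus_Aut p\<^esub> \<tau>)"
      by (rule induced_by_inverse[OF c B(2) A(2)]) (rule torus_Aut_inv(1)[OF \<tau>])
    then have "odd (column_sum p B j)" if "j < p" for j
      using parity_class_stabilizer[OF fixed c(2) _ that] by (simp add: column_sum_def)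
    \<comment> \<open>\<open>B\<close> and the identity have the same parities of column sums;
      multiplying both by \<open>A\<close> compares \<open>B * A = 1\<close> with
      \<open>A\<close>.\<close>
    then have "odd (column_sum p (B * A) j) \<longleftrightarrow> odd (column_sum p (1\<^sub>m p * A) j)" if "j < p" for j
      using that c by (intro column_sum_mult_parity) (auto simp: column_sum_one)
    then have "odd (column_sum p A j)" if "j < p" for j
      using that c by (simp add: B(3) column_sum_one)
    then show "\<tau> \<in> ?E" by (rule extendable_if_odd_columns[OF assms(1) \<tau> A])
  qed
  \<comment> \<open>Any matrix inducing \<tau> would serve; a fixed choice turns the parities of its
    column sums into a function of \<tau>.\<close>
  define mat_of where "mat_of \<tau> = (SOME A. A \<in> SL_int p \<and> induced_by p A \<tau>)" for \<tau>
  define pattern where "pattern \<tau> = {j. j < p \<and> odd (column_sum p (mat_of \<tau>) j)}" for \<tau>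
  have mat_of: "mat_of \<tau> \<in> SL_int p" "induced_by p (mat_of \<tau>) \<tau>" if "\<tau> \<in> carrier (torus_Aut p)" for \<tau>
    using that someI_ex[of "\<lambda>A. A \<in> SL_int p \<and> induced_by p A \<tau>"] unfolding mat_of_def torus_Aut_carrier by blast+
  have coset_eq: "?E #>\<^bsub>torus_Aut p\<^esub> \<sigma> = ?E #>\<^bsub>torus_Aut p\<^esub> \<tau>"
    if \<sigma>: "\<sigma> \<in> carrier (torus_Aut p)" and \<tau>: "\<tau> \<in> carrier (torus_Aut p)" and eq: "pattern \<sigma> = pattern \<tau>" for \<sigma> \<tau>
  proof -
    let ?A = "mat_of \<sigma>" and ?B = "mat_of \<tau>"
    obtain C where C: "C \<in> SL_int p" "?B * C = 1\<^sub>m p" using SL_int_inverse[OF mat_of(1)[OF \<tau>]] by blast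
    have c: "?A \<in> carrier_mat p p" "?B \<in> carrier_mat p p" "C \<in> carrier_mat p p"
      using mat_of[OF \<sigma>] mat_of[OF \<tau>] C by (auto simp: SL_int_def)
    have inv: "inv\<^bsub>torus_Aut p\<^esub> \<tau> \<in> carrier (torus_Aut p)" using \<tau> by simp
    have "induced_by p C (inv\<^bsub>torus_Aut p\<^esub> \<tau>)"
      by (rule induced_by_inverse[OF c(2,3) C(2) mat_of(2)[OF \<tau>]]) (rule torus_Aut_inv(1)[OF \<tau>])
    then have ind: "induced_by p (?A * C) (\<sigma> \<otimes>\<^bsub>torus_Aut p\<^esub> inv\<^bsub>torus_Aut p\<^esub> \<tau>)"
      unfolding torus_Aut_mult[OF \<sigma> inv] by (rule induced_by_mult[OF c(1,3) mat_of(2)[OF \<sigma>]])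
    have SL: "?A * C \<in> SL_int p" using mat_of(1)[OF \<sigma>] C(1) by (auto simp: SL_int_def det_mult)
    \<comment> \<open>Equal patterns stay equal after multiplication by \<open>C\<close>, and
      \<open>?B * C\<close> is the identity, whose column sums are odd.\<close>
    have "odd (column_sum p (?A * C) l) \<longleftrightarrow> odd (column_sum p (?B * C) l)" if "l < p" for l
      using that c eq by (intro column_sum_mult_parity) (auto simp: pattern_def)
    then have "odd (column_sum p (?A * C) l)" if "l < p" for l
      using that by (simp add: C(2) column_sum_one)
    then have "\<sigma> \<otimes>\<^bsub>torus_Aut p\<^esub> inv\<^bsub>torus_Aut p\<^esub> \<tau> \<in> ?E"
      by (intro extendable_if_odd_columns[OF assms(1) _ SL ind]) (use \<sigma> inv in auto)
    then have "?E #>\<^bsub>torus_Aut p\<^esub> (\<sigma> \<otimes>\<^bsub>torus_Aut p\<^esub> inv\<^bsub>torus_Aut p\<^esub> \<tau>) = ?E"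
      using sub \<sigma> inv by (intro coset_join2) auto
    then show ?thesis by (rule coset_mult_inv1) (use \<sigma> \<tau> sub in \<open>auto dest: subgroup.subset\<close>)
  qed
  have pattern: "pattern ` carrier (torus_Aut p) \<subseteq> Pow {..<p} - {{}}"
  proof
    fix s assume "s \<in> pattern ` carrier (torus_Aut p)"
    then obtain \<tau> where \<tau>: "\<tau> \<in> carrier (torus_Aut p)" and s: "s = pattern \<tau>" by blast
    obtain C where C: "C \<in> SL_int p" "mat_of \<tau> * C = 1\<^sub>m p" using SL_int_inverse[OF mat_of(1)[OF \<tau>]] by blast
    have c: "mat_of \<tau> \<in> carrier_mat p p" "C \<in> carrier_mat p p" using mat_of(1)[OF \<tau>] C(1) by (auto simp: SL_int_def)
    \<comment> \<open>This accounts for the 1 subtracted from \<open>2 ^ p\<close>: even column sums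
      would remain even after multiplication by the inverse matrix, but the identity has column sums
      1.\<close>
    have "s \<noteq> {}"
    proof
      assume "s = {}"
      then have "even (\<Sum>j<p. column_sum p (mat_of \<tau>) j * C $$ (j, 0))"
        by (intro dvd_sum) (auto simp: s pattern_def)
      then have "even (column_sum p (1\<^sub>m p) 0)"
        using column_sum_mult[OF c, of 0] assms(1) by (simp add: C(2))
      then show False using assms(1) by (simp add: column_sum_one)
    qed
    then show "s \<in> Pow {..<p} - {{}}" by (auto simp: s pattern_def)
  qed
  have fin: "finite (pattern ` carrier (torus_Aut p))" by (rule finite_subset[OF pattern]) simp
  have "card (pattern ` carrier (torus_Aut p)) \<le> card (Pow {..<p} - {{}})"
    by (rule card_mono[OF _ pattern]) simp
  also have "\<dots> = 2 ^ p - 1" by (simp add: card_Diff_singleton card_Pow)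
  finally have bound: "card (pattern ` carrier (torus_Aut p)) \<le> 2 ^ p - 1" .
  have rcosets: "rcosets\<^bsub>torus_Aut p\<^esub> ?E = (\<lambda>\<tau>. ?E #>\<^bsub>torus_Aut p\<^esub> \<tau>) ` carrier (torus_Aut p)"
    by (auto simp: RCOSETS_def)
  have "finite (rcosets\<^bsub>torus_Aut p\<^esub> ?E)"
    unfolding rcosets by (rule card_image_le_card_image(1)[OF fin coset_eq])
  moreover have "card (rcosets\<^bsub>torus_Aut p\<^esub> ?E) \<le> 2 ^ p - 1"
    unfolding rcosets by (rule order_trans[OF card_image_le_card_image(2)[OF fin coset_eq] bound])
  ultimately show ?thesis
    using sub stab parity_class_in_carrier parity_class_nontrivial[OF assms(1)] by blast
qed

end
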